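(* Let $X\subset\mathbb{C}$ and let $\{\Phi^\gamma\}_{\gamma\in\Gamma}$ be an analytic family in $\mathrm{HIFS}(X)$ with the following property: for every $\gamma_0\in\Gamma$ there exist a neighborhood $\Gamma_0$ of $\gamma_0$ and $B\ge0$ such that $$\left|\frac{(\varphi_{\omega_1}^\gamma)'(\pi_\gamma(\sigma(\omega)))}{(\varphi_{\omega_1}^{\gamma_0})'(\pi_{\gamma_0}(\sigma(\omega)))}\right|\le B\qquad\text{for every }\omega\in\mathbb{N}^\infty\text{ and all }\gamma\in\Gamma_0 .$$ If $t\ge0$ and $P(\gamma_1,t)<\infty$ for some $\gamma_1\in\Gamma$, then $P(\gamma,t)<\infty$ for all $\gamma\in\Gamma$ and the function $\gamma\mapsto P(\gamma,t)$, $\gamma\in\Gamma$, is real-analytic.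
   Context: **CIFSs.** $X\subset\mathbb{C}=\mathbb{R}^2$ is a compact connected set with $X=\overline{\mathrm{Int}(X)}\neq\emptyset$, with the Euclidean metric. $\mathrm{CIFS}(X)$ is the set of conformal iterated function systems $\Phi=\{\varphi_i:X\to X\}_{i\in\mathbb{N}}$: the $\varphi_i$ are injective, there is $s\in(0,1)$ with $|\varphi_i(x)-\varphi_i(y)|\le s|x-y|$ for all $i$ and $x,y\in X$, and (i) $\varphi_i(\mathrm{Int}X)\subset\mathrm{Int}X$ for all $i$ and $\varphi_i(\mathrm{Int}X)\cap\varphi_j(\mathrm{Int}X)=\emptyset$ for $i\ne j$; (ii) there is an open connected $V\supset X$ such that all $\varphi_i$ extend to $C^1$ conformal diffeomorphisms of $V$ into $V$; (iii) there are $\beta,l>0$ such that every $x\in X$ is the vertex of an open cone contained in $\mathrm{Int}(X)$ with central angle of measure $\beta$ and altitude $l$; (iv) there are $L\ge1$, $\alpha>0$ with $\bigl||\varphi_i'(y)|-|\varphi_i'(x)|\bigr|\le L\,(\inf_V|\varphi_i'|)\,|y-x|^\alpha$ for all $x,y\in V$ and all $i$. **Analytic families.** $\mathrm{HIFS}(X)$ is the set of $\Phi\in\mathrm{CIFS}(X)$ for which there is an open connected neighborhood $V$ of $X$ in $\mathbb{C}$ such that every $\varphi_i$ extends to a holomorphic diffeomorphism of $V$ into $V$. A family $\{\Phi^\gamma\}_{\gamma\in\Gamma}=\{\{\varphi_i^\gamma\}_{i}\}_{\gamma\in\Gamma}$ in $\mathrm{HIFS}(X)$ is *analytic* if $\Gamma$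 is a connected finite-dimensional complex manifold and for each $\gamma_0\in\Gamma$ there are a neighborhood $\Gamma_0$ of $\gamma_0$ and a bounded connected open neighborhood $V_0$ of $X$ in $\mathbb{C}$ such that for each $i$ and each $\gamma\in\Gamma$, $\varphi_i^\gamma$ extends to a holomorphic diffeomorphism of $V_0$ into $V_0$, and for each $i$ the map $(\gamma,x)\mapsto\varphi_i^\gamma(x)$ is holomorphic on $\Gamma_0\times V_0$. **Pressure and coding.** For $\omega\in\mathbb{N}^n$ put $\varphi_\omega=\varphi_{\omega_1}\circ\cdots\circ\varphi_{\omega_n}$; $P_\Phi(t)=\lim_{n\to\infty}\frac1n\log\sum_{\omega\in\mathbb{N}^n}\|\varphi_\omega'\|^t\in(-\infty,\infty]$ for $t\ge0$, where $\|\cdot\|$ is the supremum norm over $X$; and $P(\gamma,t)=P_{\Phi^\gamma}(t)$. For $\omega\in\mathbb{N}^\infty$, $\pi_\Phi(\omega)$ is the unique point of $\bigcap_{n\ge1}\varphi_{\omega_1\cdots\omega_n}(X)$, and $\pi_\gamma=\pi_{\Phi^\gamma}$. The shift is $\sigma(\omega_1\omega_2\omega_3\ldots)=\omega_2\omega_3\ldots$. *)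

theory Defs
  imports "HOL-Complex_Analysis.Complex_Analysis"
begin

section \<open>Finite-dimensional complex manifolds\<close>

text \<open>
  Charts take values in the coordinate subspace of \<^typ>\<open>complex ^ 'n\<close> belonging to a set
  \<open>I\<close> of coordinates, that is, in a copy of complex \<open>d\<close>-space for \<open>d = card I\<close>.
  For \<open>I = UNIV\<close> this is \<^typ>\<open>complex ^ 'n\<close> itself; the only purpose of \<open>I\<close> is to allow
  dimension \<open>0\<close> (\<open>I = {}\<close>) as well, since index types are nonempty.
\<close>

definition coord_space :: "'n::finite set \<Rightarrow> (complex ^ 'n) set" where
  "coord_space I = {z. \<forall>i. i \<notin> I \<longrightarrow> z $ i = 0}"

text \<open>
  Holomorphy on a (relatively open) set: existence of a complex linear Frechet derivative at
  every point, with respect to complex scalar multiplications \<open>sa\<close> and \<open>sb\<close> on the two spaces.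
\<close>

definition complex_differentiable_on ::
  "(complex \<Rightarrow> 'a \<Rightarrow> 'a) \<Rightarrow> (complex \<Rightarrow> 'b \<Rightarrow> 'b) \<Rightarrow>
    ('a::real_normed_vector \<Rightarrow> 'b::real_normed_vector) \<Rightarrow> 'a set \<Rightarrow> bool" where
  "complex_differentiable_on sa sb f S \<longleftrightarrow>
     (\<forall>x\<in>S. \<exists>D. (f has_derivative D) (at x within S) \<and> (\<forall>c v. D (sa c v) = sb c (D v)))"

definition holomorphic_vec_on :: "(complex ^ 'n \<Rightarrow> complex ^ 'm) \<Rightarrow> (complex ^ 'n) set \<Rightarrow> bool" where
  "holomorphic_vec_on f S \<longleftrightarrow> complex_differentiable_on (*s) (*s) f S"

definition holomorphic_joint_on ::
  "((complex ^ 'n) \<times> complex \<Rightarrow> complex) \<Rightarrow> ((complex ^ 'n) \<times> complex) set \<Rightarrow> bool" where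
  "holomorphic_joint_on f S \<longleftrightarrow>
     complex_differentiable_on (\<lambda>c (z, x). (c *s z, c * x)) (*) f S"

text \<open>
  A chart is a pair of its domain and its coordinate map; the values of the coordinate map
  outside the domain are irrelevant.
\<close>

type_synonym ('g, 'n) chart = "'g set \<times> ('g \<Rightarrow> complex ^ 'n)"

definition complex_manifold ::
  "'g topology \<Rightarrow> 'n::finite set \<Rightarrow> ('g, 'n) chart set \<Rightarrow> bool" where
  "complex_manifold M I A \<longleftrightarrow>
     Hausdorff_space M \<and>
     (\<exists>\<B>. countable \<B> \<and> openin M = arbitrary union_of (\<lambda>U. U \<in> \<B>)) \<and>
     (\<Union>(U, \<kappa>)\<in>A. U) = topspace M \<and>
     (\<forall>(U, \<kappa>)\<in>A. openin M U \<and>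
        openin (top_of_set (coord_space I)) (\<kappa> ` U) \<and>
        homeomorphic_map (subtopology M U) (top_of_set (\<kappa> ` U)) \<kappa>) \<and>
     (\<forall>(U, \<kappa>)\<in>A. \<forall>(U', \<kappa>')\<in>A.
        holomorphic_vec_on (\<kappa>' \<circ> inv_into U \<kappa>) (\<kappa> ` (U \<inter> U')))"

text \<open>
  Real-analyticity on a (relatively open) set: near every point of \<open>S\<close>, the function is the sum
  of a convergent power series in the real coordinates. The multi-indices \<open>\<alpha>\<close> are functions
  on the standard basis, extended by \<open>0\<close>; for \<^typ>\<open>complex ^ 'n\<close> the coordinates
  are the real and imaginary parts of the components.
\<close>

definition real_analytic_on :: "('a::euclidean_space \<Rightarrow> real) \<Rightarrow> 'a set \<Rightarrow> bool" where
  "real_analytic_on f S \<longleftrightarrow>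
     (\<forall>x\<in>S. \<exists>r>0. \<exists>a :: ('a \<Rightarrow> nat) \<Rightarrow> real. \<forall>y \<in> S \<inter> ball x r.
        ((\<lambda>\<alpha>. a \<alpha> * (\<Prod>b\<in>Basis. ((y - x) \<bullet> b) ^ \<alpha> b)) has_sum f y)
          {\<alpha>. \<forall>b. b \<notin> Basis \<longrightarrow> \<alpha> b = 0})"

definition manifold_real_analytic :: "('g, 'n::finite) chart set \<Rightarrow> ('g \<Rightarrow> real) \<Rightarrow> bool" where
  "manifold_real_analytic A f \<longleftrightarrow>
     (\<forall>(U, \<kappa>)\<in>A. real_analytic_on (f \<circ> inv_into U \<kappa>) (\<kappa> ` U))"


section \<open>Conformal iterated function systems\<close>

text \<open>
  Maps \<open>X \<rightarrow> X\<close> are represented by functions on \<^typ>\<open>complex\<close> whose values outside \<open>X\<close> are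
  irrelevant; none of the notions below depends on them.
\<close>

definition cifs_domain :: "complex set \<Rightarrow> bool" where
  "cifs_domain X \<longleftrightarrow> compact X \<and> connected X \<and> X = closure (interior X) \<and> X \<noteq> {}"

text \<open>The open triangle with vertex \<open>x\<close>, axis of direction \<open>u\<close> (a unit vector), central
  angle \<open>\<beta>\<close> and altitude \<open>l\<close>.\<close>

definition open_cone :: "complex \<Rightarrow> complex \<Rightarrow> real \<Rightarrow> real \<Rightarrow> complex set" where
  "open_cone x u \<beta> l = {y. norm (y - x) * cos (\<beta> / 2) < (y - x) \<bullet> u \<and> (y - x) \<bullet> u < l}"

definition C1_on :: "(complex \<Rightarrow> complex) \<Rightarrow> complex set \<Rightarrow> bool" where
  "C1_on f V \<longleftrightarrow> (\<exists>f' :: complex \<Rightarrow> complex \<Rightarrow>\<^sub>L complex.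
     (\<forall>x\<in>V. (f has_derivative blinfun_apply (f' x)) (at x)) \<and> continuous_on V f')"

text \<open>Conformal means that the derivatives are similarities; they may reverse orientation.\<close>

definition conformal_diffeo_into :: "complex set \<Rightarrow> (complex \<Rightarrow> complex) \<Rightarrow> bool" where
  "conformal_diffeo_into V f \<longleftrightarrow>
     f ` V \<subseteq> V \<and> inj_on f V \<and> C1_on f V \<and> C1_on (inv_into V f) (f ` V) \<and>
     (\<forall>x\<in>V. \<exists>r>0. \<forall>v. norm (frechet_derivative f (at x) v) = r * norm v)"

definition holomorphic_diffeo_into :: "complex set \<Rightarrow> (complex \<Rightarrow> complex) \<Rightarrow> bool" where
  "holomorphic_diffeo_into V f \<longleftrightarrow>
     f ` V \<subseteq> V \<and> inj_on f V \<and> f holomorphic_on V \<and> inv_into V f holomorphic_on (f ` V)"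

definition CIFS :: "complex set \<Rightarrow> (nat \<Rightarrow> complex \<Rightarrow> complex) set" where
  "CIFS X = {\<phi>.
     (\<forall>i. \<phi> i ` X \<subseteq> X \<and> inj_on (\<phi> i) X) \<and>
     (\<exists>s. 0 < s \<and> s < 1 \<and>
        (\<forall>i. \<forall>x\<in>X. \<forall>y\<in>X. norm (\<phi> i x - \<phi> i y) \<le> s * norm (x - y))) \<and>
     (\<forall>i. \<phi> i ` interior X \<subseteq> interior X) \<and>
     (\<forall>i j. i \<noteq> j \<longrightarrow> \<phi> i ` interior X \<inter> \<phi> j ` interior X = {}) \<and>
     (\<exists>\<beta> l. 0 < \<beta> \<and> \<beta> < pi \<and> 0 < l \<and>
        (\<forall>x\<in>X. \<exists>u. norm u = 1 \<and> open_cone x u \<beta> l \<subseteq> interior X)) \<and>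
     (\<exists>V \<psi>. open V \<and> connected V \<and> X \<subseteq> V \<and>
        (\<forall>i. conformal_diffeo_into V (\<psi> i) \<and> (\<forall>x\<in>X. \<psi> i x = \<phi> i x)) \<and>
        (\<exists>L \<alpha>. 1 \<le> L \<and> 0 < \<alpha> \<and>
           (\<forall>i. \<forall>x\<in>V. \<forall>y\<in>V.
              \<bar>onorm (frechet_derivative (\<psi> i) (at y)) - onorm (frechet_derivative (\<psi> i) (at x))\<bar>
              \<le> L * (INF z\<in>V. onorm (frechet_derivative (\<psi> i) (at z))) * norm (y - x) powr \<alpha>)))}"

definition HIFS :: "complex set \<Rightarrow> (nat \<Rightarrow> complex \<Rightarrow> complex) set" where
  "HIFS X = {\<phi> \<in> CIFS X.
     \<exists>V. open V \<and> connected V \<and> X \<subseteq> V \<and>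
       (\<forall>i. \<exists>\<psi>. holomorphic_diffeo_into V \<psi> \<and> (\<forall>x\<in>X. \<psi> x = \<phi> i x))}"

text \<open>
  The parameter set is \<^term>\<open>topspace M\<close>. The extensions of \<open>\<phi> \<gamma> i\<close> to \<open>V0\<close> are
  called \<open>\<psi> \<gamma> i\<close>; joint holomorphy on a subset of \<open>M \<times> complex\<close> is tested in the charts of \<open>M\<close>.
\<close>

definition analytic_family ::
  "'g topology \<Rightarrow> 'n::finite set \<Rightarrow> ('g, 'n) chart set \<Rightarrow> complex set \<Rightarrow>
    ('g \<Rightarrow> nat \<Rightarrow> complex \<Rightarrow> complex) \<Rightarrow> bool" where
  "analytic_family M I A X \<phi> \<longleftrightarrow>
     complex_manifold M I A \<and> connected_space M \<and>
     (\<forall>\<gamma>\<in>topspace M. \<phi> \<gamma> \<in> HIFS X) \<and>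
     (\<forall>\<gamma>0\<in>topspace M. \<exists>\<Gamma>0 V0 \<psi>.
        openin M \<Gamma>0 \<and> \<gamma>0 \<in> \<Gamma>0 \<and>
        open V0 \<and> connected V0 \<and> bounded V0 \<and> X \<subseteq> V0 \<and>
        (\<forall>i. \<forall>\<gamma>\<in>topspace M.
           holomorphic_diffeo_into V0 (\<psi> \<gamma> i) \<and> (\<forall>x\<in>X. \<psi> \<gamma> i x = \<phi> \<gamma> i x)) \<and>
        (\<forall>i. \<forall>(U, \<kappa>)\<in>A.
           holomorphic_joint_on (\<lambda>(z, x). \<psi> (inv_into U \<kappa> z) i x) (\<kappa> ` (U \<inter> \<Gamma>0) \<times> V0)))"


section \<open>Pressure and coding\<close>

text \<open>
  The complex derivative relative to \<open>X\<close>. For \<open>X\<close> as in \<open>cifs_domain\<close> all points of \<open>X\<close> are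
  limit points, so this is the derivative of every holomorphic extension to a neighbourhood of \<open>X\<close>.
\<close>

definition deriv_within :: "complex set \<Rightarrow> (complex \<Rightarrow> complex) \<Rightarrow> complex \<Rightarrow> complex" where
  "deriv_within X f x = (THE D. (f has_field_derivative D) (at x within X))"

definition deriv_norm :: "complex set \<Rightarrow> (complex \<Rightarrow> complex) \<Rightarrow> real" where
  "deriv_norm X f = (SUP x\<in>X. cmod (deriv_within X f x))"

definition word_map :: "(nat \<Rightarrow> complex \<Rightarrow> complex) \<Rightarrow> nat list \<Rightarrow> complex \<Rightarrow> complex" where
  "word_map \<phi> w = foldr (\<lambda>i f. \<phi> i \<circ> f) w id"

definition partition_sum :: "complex set \<Rightarrow> (nat \<Rightarrow> complex \<Rightarrow> complex) \<Rightarrow> real \<Rightarrow> nat \<Rightarrow> ennreal" where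
  "partition_sum X \<phi> t n =
     (\<Sum>\<^sub>\<infinity>w\<in>{w :: nat list. length w = n}. ennreal (deriv_norm X (word_map \<phi> w) powr t))"

definition log_ennreal :: "ennreal \<Rightarrow> ereal" where
  "log_ennreal x = (if x = 0 then -\<infinity> else if x = \<infinity> then \<infinity> else ereal (ln (enn2real x)))"

text \<open>Only meant for \<open>\<phi>\<close> in \<open>HIFS X\<close>, because \<^const>\<open>deriv_within\<close> is the complex derivative.\<close>

definition pressure :: "complex set \<Rightarrow> (nat \<Rightarrow> complex \<Rightarrow> complex) \<Rightarrow> real \<Rightarrow> ereal" where
  "pressure X \<phi> t = lim (\<lambda>n. log_ennreal (partition_sum X \<phi> t n) / ereal (real n))"

text \<open>Infinite words are indexed from \<open>0\<close>, so \<open>\<omega> 0\<close> is the first letter.\<close>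

definition coding_map :: "complex set \<Rightarrow> (nat \<Rightarrow> complex \<Rightarrow> complex) \<Rightarrow> (nat \<Rightarrow> nat) \<Rightarrow> complex" where
  "coding_map X \<phi> \<omega> = (THE x. x \<in> (\<Inter>n\<in>{1..}. word_map \<phi> (map \<omega> [0..<n]) ` X))"

definition shift :: "(nat \<Rightarrow> nat) \<Rightarrow> nat \<Rightarrow> nat" where
  "shift \<omega> = (\<lambda>n. \<omega> (Suc n))"

end

theory Submission
  imports Defs
begin

text \<open>
  Near a parameter \<open>\<gamma>\<^sub>0\<close>, the quotients of the derivatives in the hypothesis are holomorphic in \<open>\<gamma>\<close>,
  equal to \<open>1\<close> at \<open>\<gamma>\<^sub>0\<close> and bounded by \<open>B\<close>; by the Schwarz lemma they are close to \<open>1\<close>, uniformly in the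
  word \<open>\<omega>\<close>. By Koebe distortion they are also uniformly Hoelder continuous in \<open>\<omega>\<close>. Taking
  logarithms and making the real and imaginary parts of the coordinates of \<open>\<gamma>\<close> complex, one
  extends the potential \<open>t log |\<phi>'|\<close> to complex parameters as a small, Hoelder-small
  perturbation of its value at \<open>\<gamma>\<^sub>0\<close>. The contraction of Markov operators on moduli of continuity
  shows that the partition sums \<open>Z\<^sub>n\<close> of the perturbed potential never vanish, and that
  \<open>Z\<^sub>n\<^sub>+\<^sub>1 / Z\<^sub>n\<close> is within relative distance \<open>1/2\<close> of its unperturbed value, uniformly in \<open>n\<close> and in
  the finite alphabet. So \<open>1/n log (Z\<^sub>n(\<gamma>) / Z\<^sub>n(\<gamma>\<^sub>0))\<close> is holomorphic and bounded on a fixed polydisc, its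
  Taylor coefficients satisfy uniform Cauchy estimates, and the limits over the alphabet and
  over \<open>n\<close>, that is \<open>P(\<gamma>, t) - P(\<gamma>\<^sub>0, t)\<close>, are again sums of power series. Finiteness of the pressure is
  locally constant, hence constant as \<open>\<Gamma>\<close> is connected.
\<close>

section \<open>Complex perturbations of transfer operators\<close>

text \<open>The alphabet is infinite, and each system has its own contraction ratio, with no
  uniformity assumed in the parameter. Analytic perturbation of a leading eigenvalue is therefore
  replaced by scalar estimates for finite alphabets, whose constants depend neither on the alphabet
  nor on the word length; limits are then needed only pointwise and at real parameters. A
  perturbation that is merely small in modulus would not do: over long words its phases add up and
  might let the sums cancel. Small oscillation along cylinders prevents this, so the Schwarz lemma
  is applied not only to the logarithms but also to their differences at two words with a common
  prefix. The passage to complex coordinates is forced by the modulus: log |u| is only the real part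
  of a holomorphic function. Written as half of log u plus its conjugate, it extends holomorphically
  once holomorphic and antiholomorphic parameters are treated as independent, which takes twice as
  many complex coordinates.\<close>

abbreviation prepend :: "nat \<Rightarrow> (nat \<Rightarrow> nat) \<Rightarrow> nat \<Rightarrow> nat" (infixr "##" 65) where
  "i ## \<omega> \<equiv> case_nat i \<omega>"

definition agree :: "nat \<Rightarrow> (nat \<Rightarrow> nat) \<Rightarrow> (nat \<Rightarrow> nat) \<Rightarrow> bool" where
  "agree n \<omega> \<tau> \<longleftrightarrow> (\<forall>k<n. \<omega> k = \<tau> k)"

lemma agree_0 [simp]: "agree 0 \<omega> \<tau>"
  by (simp add: agree_def)

lemma agree_Suc_case_nat [simp]:
  "agree (Suc n) (i ## \<omega>) (j ## \<tau>) \<longleftrightarrow> i = j \<and> agree n \<omega> \<tau>"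
  unfolding agree_def by (auto simp: less_Suc_eq_0_disj)

lemma agree_sym: "agree n \<omega> \<tau> \<Longrightarrow> agree n \<tau> \<omega>"
  by (simp add: agree_def)

text \<open>The first letter is always shared, and \<open>n\<close> counts the agreement after it.
  Across different first letters nothing is required, since over infinitely many letters the
  potential may be unbounded.\<close>

definition prefix_Hoelder :: "real \<Rightarrow> real \<Rightarrow> ((nat \<Rightarrow> nat) \<Rightarrow> 'a::real_normed_vector) \<Rightarrow> bool" where
  "prefix_Hoelder \<theta> C g \<longleftrightarrow>
     (\<forall>n i \<omega> \<tau>. agree n \<omega> \<tau> \<longrightarrow> norm (g (i ## \<omega>) - g (i ## \<tau>)) \<le> C * \<theta> ^ n)"

lemma prefix_HoelderD:
  "prefix_Hoelder \<theta> C g \<Longrightarrow> agree n \<omega> \<tau> \<Longrightarrow> norm (g (i ## \<omega>) - g (i ## \<tau>)) \<le> C * \<theta> ^ n"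
  by (simp add: prefix_Hoelder_def)

text \<open>Coupling of two probability vectors: the common part \<open>(1 - b) * Q\<close> is
  matched letter by letter at cost \<open>V1\<close>; the remainder \<open>R\<close>, of mass
  \<open>b\<close>, is matched independently with \<open>Q\<close> at cost
  \<open>V0\<close>.\<close>

lemma convex_combination_diff_le:
  fixes x y :: "'i \<Rightarrow> complex"
  assumes fin: "finite E" and b: "0 \<le> b" "b \<le> 1"
    and P1: "sum P E = 1" and Q1: "sum Q E = 1"
    and Q0: "\<And>i. i \<in> E \<Longrightarrow> 0 \<le> Q i" and PQ: "\<And>i. i \<in> E \<Longrightarrow> (1 - b) * Q i \<le> P i"
    and V1: "\<And>i. i \<in> E \<Longrightarrow> cmod (x i - y i) \<le> V1"
    and V0: "\<And>i j. i \<in> E \<Longrightarrow> j \<in> E \<Longrightarrow> cmod (x i - y j) \<le> V0"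
  shows "cmod ((\<Sum>i\<in>E. of_real (P i) * x i) - (\<Sum>i\<in>E. of_real (Q i) * y i))
    \<le> (1 - b) * V1 + b * V0"
proof -
  define R where "R i = P i - (1 - b) * Q i" for i
  have R0: "0 \<le> R i" if "i \<in> E" for i using PQ[OF that] by (simp add: R_def)
  have R1: "sum R E = b"
    unfolding R_def sum_subtractf sum_distrib_left[symmetric] P1 Q1 by simp
  have P_eq: "P i = (1 - b) * Q i + R i" for i by (simp add: R_def)
  have "(\<Sum>i\<in>E. of_real (P i) * x i) - (\<Sum>i\<in>E. of_real (Q i) * y i)
     = (1 - b) * (\<Sum>i\<in>E. of_real (Q i) * (x i - y i))
       + ((\<Sum>i\<in>E. of_real (R i) * x i) - b * (\<Sum>i\<in>E. of_real (Q i) * y i))"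
    unfolding P_eq
    by (simp add: algebra_simps sum.distrib sum_subtractf sum_distrib_left)
  also have "(\<Sum>i\<in>E. of_real (R i) * x i) - b * (\<Sum>i\<in>E. of_real (Q i) * y i)
     = (\<Sum>i\<in>E. \<Sum>j\<in>E. of_real (R i * Q j) * (x i - y j))"
  proof -
    have "(\<Sum>i\<in>E. \<Sum>j\<in>E. of_real (R i * Q j) * (x i - y j))
       = (\<Sum>i\<in>E. \<Sum>j\<in>E. (of_real (R i) * x i) * of_real (Q j))
         - (\<Sum>i\<in>E. \<Sum>j\<in>E. of_real (R i) * (of_real (Q j) * y j))"
      by (simp add: algebra_simps sum_subtractf)
    also have "\<dots> = (\<Sum>i\<in>E. of_real (R i) * x i) * of_real (sum Q E)
         - of_real (sum R E) * (\<Sum>j\<in>E. of_real (Q j) * y j)"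
      by (simp add: sum_product[symmetric])
    finally show ?thesis by (simp add: R1 Q1)
  qed
  finally have eq: "(\<Sum>i\<in>E. of_real (P i) * x i) - (\<Sum>i\<in>E. of_real (Q i) * y i)
     = (1 - b) * (\<Sum>i\<in>E. of_real (Q i) * (x i - y i))
       + (\<Sum>i\<in>E. \<Sum>j\<in>E. of_real (R i * Q j) * (x i - y j))" by simp
  have "cmod (\<Sum>i\<in>E. of_real (Q i) * (x i - y i)) \<le> (\<Sum>i\<in>E. Q i * V1)"
    by (rule sum_norm_le) (auto simp: norm_mult Q0 intro!: mult_left_mono V1)
  also have "\<dots> = V1" by (simp add: sum_distrib_right[symmetric] Q1)
  finally have 1: "cmod ((1 - b) * (\<Sum>i\<in>E. of_real (Q i) * (x i - y i))) \<le> (1 - b) * V1"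
    using b by (simp add: norm_mult mult_left_mono del: of_real_diff)
  have "cmod (\<Sum>i\<in>E. \<Sum>j\<in>E. of_real (R i * Q j) * (x i - y j)) \<le> (\<Sum>i\<in>E. \<Sum>j\<in>E. R i * Q j * V0)"
    by (intro sum_norm_le) (auto simp: norm_mult Q0 R0 abs_mult intro!: mult_left_mono V0)
  also have "\<dots> = sum R E * sum Q E * V0"
    by (simp add: sum_product sum_distrib_right sum_distrib_left mult_ac)
  finally have 2: "cmod (\<Sum>i\<in>E. \<Sum>j\<in>E. of_real (R i * Q j) * (x i - y j)) \<le> b * V0"
    by (simp add: R1 Q1)
  show ?thesis unfolding eq by (rule order_trans[OF norm_triangle_ineq]) (use 1 2 in linarith)
qed

lemma one_minus_exp_concave:
  fixes x c :: real
  assumes "0 \<le> c" "c \<le> 1"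
  shows "c * (1 - exp (- x)) \<le> 1 - exp (- (c * x))"
proof -
  have "convex_on UNIV (exp :: real \<Rightarrow> real)" by (rule exp_convex)
  from convex_onD[OF this, of c 0 "- x"] assms
  show ?thesis by (simp add: algebra_simps)
qed

text \<open>The moduli of continuity of a function transform under a Markov operator like the expectations
  of a chain on the natural numbers that moves from \<open>n\<close> to \<open>n + 1\<close> with probability
  \<open>exp (-a \<theta>^n)\<close> and otherwise falls back to \<open>0\<close>; \<open>1 - exp (-A \<theta>^n)\<close> is the probability
  that it ever falls back.\<close>

lemma markov_contraction:
  fixes s :: "(nat \<Rightarrow> nat) \<Rightarrow> complex" and P :: "(nat \<Rightarrow> nat) \<Rightarrow> nat \<Rightarrow> real"
  assumes fin: "finite E" and a: "0 < a" and \<theta>: "0 < \<theta>" "\<theta> < 1" and A: "A = a / (1 - \<theta>)"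
    and P0: "\<And>\<omega> i. i \<in> E \<Longrightarrow> 0 \<le> P \<omega> i" and P1: "\<And>\<omega>. sum (P \<omega>) E = 1"
    and PP: "\<And>n \<omega> \<tau> i. agree n \<omega> \<tau> \<Longrightarrow> i \<in> E \<Longrightarrow> exp (- (a * \<theta> ^ n)) * P \<tau> i \<le> P \<omega> i"
    and s1: "\<And>n \<omega> \<tau> i. agree n \<omega> \<tau> \<Longrightarrow> i \<in> E \<Longrightarrow>
       cmod (s (i ## \<omega>) - s (i ## \<tau>)) \<le> D * (1 - exp (- (A * \<theta> ^ Suc n)))"
    and s0: "\<And>\<omega> \<tau> i j. i \<in> E \<Longrightarrow> j \<in> E \<Longrightarrow>
       cmod (s (i ## \<omega>) - s (j ## \<tau>)) \<le> D * (1 - exp (- A))"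
    and D: "0 \<le> D" and ag: "agree n \<omega> \<tau>"
  shows "cmod ((\<Sum>i\<in>E. of_real (P \<omega> i) * s (i ## \<omega>)) - (\<Sum>i\<in>E. of_real (P \<tau> i) * s (i ## \<tau>)))
    \<le> (1 - (1 - \<theta>) * exp (- A)) * D * (1 - exp (- (A * \<theta> ^ n)))"
proof -
  define b where "b = 1 - exp (- (a * \<theta> ^ n))"
  have b: "0 \<le> b" "b \<le> 1" using a \<theta> by (simp_all add: b_def)
  have A0: "A > 0" using a \<theta> A by simp
  have "A * (1 - \<theta>) = a" using \<theta> A by simp
  hence Aa: "A - A * \<theta> = a" by (simp add: algebra_simps)
  have "cmod ((\<Sum>i\<in>E. of_real (P \<omega> i) * s (i ## \<omega>)) - (\<Sum>i\<in>E. of_real (P \<tau> i) * s (i ## \<tau>)))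
    \<le> (1 - b) * (D * (1 - exp (- (A * \<theta> ^ Suc n)))) + b * (D * (1 - exp (- A)))"
    by (rule convex_combination_diff_le[OF fin b P1 P1 P0])
       (use PP[OF ag] s1[OF ag] s0 in \<open>auto simp: b_def\<close>)
  also have "\<dots> = D * ((1 - b) * (1 - exp (- (A * \<theta> ^ Suc n))) + b - b * exp (- A))"
    by (simp add: algebra_simps)
  \<comment> \<open>First-step analysis for the probability of ever falling back: fall now, or move
    on and fall later.\<close>
  also have "(1 - b) * (1 - exp (- (A * \<theta> ^ Suc n))) + b = 1 - exp (- (A * \<theta> ^ n))"
  proof -
    have "a * \<theta> ^ n + A * \<theta> ^ Suc n = A * \<theta> ^ n"
      unfolding Aa[symmetric] by (simp add: algebra_simps)
    hence "exp (- (a * \<theta> ^ n)) * exp (- (A * \<theta> ^ Suc n)) = exp (- (A * \<theta> ^ n))"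
      by (metis exp_add minus_add_distrib)
    thus ?thesis by (simp add: b_def algebra_simps)
  qed
  \<comment> \<open>The gain is \<open>b * exp (- A)\<close>: fall now and never again. By concavity
    \<open>b\<close> is at least \<open>1 - \<theta>\<close> times the probability of ever falling,
    so the gain is a fixed proportion for every \<open>n\<close>.\<close>
  also have "D * ((1 - exp (- (A * \<theta> ^ n))) - b * exp (- A))
     \<le> D * ( (1 - exp (- (A * \<theta> ^ n))) - (1 - \<theta>) * (1 - exp (- (A * \<theta> ^ n))) * exp (- A))"
  proof (rule mult_left_mono[OF _ D])
    have "(1 - \<theta>) * (1 - exp (- (A * \<theta> ^ n))) \<le> 1 - exp (- ((1 - \<theta>) * (A * \<theta> ^ n)))"
      by (rule one_minus_exp_concave) (use \<theta> in auto)
    also have "(1 - \<theta>) * (A * \<theta> ^ n) = a * \<theta> ^ n"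
      unfolding Aa[symmetric] by (simp add: algebra_simps)
    finally show "(1 - exp (- (A * \<theta> ^ n))) - b * exp (- A)
      \<le> (1 - exp (- (A * \<theta> ^ n))) - (1 - \<theta>) * (1 - exp (- (A * \<theta> ^ n))) * exp (- A)" by (simp add: b_def)
  qed
  finally show ?thesis by (simp add: algebra_simps)
qed

text \<open>The iterates of the Ruelle operator of \<open>G\<close>, applied to the constant
  function 1. One recursion serves real and complex potentials.\<close>

primrec transfer ::
  "nat set \<Rightarrow> ((nat \<Rightarrow> nat) \<Rightarrow> 'a::{real_normed_field,banach}) \<Rightarrow> nat \<Rightarrow> (nat \<Rightarrow> nat) \<Rightarrow> 'a" where
  "transfer E G 0 \<omega> = 1"
| "transfer E G (Suc k) \<omega> = (\<Sum>i\<in>E. exp (G (i ## \<omega>)) * transfer E G k (i ## \<omega>))"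

text \<open>Dividing by the unperturbed iterate of the same order turns weights into probabilities
  without an eigenfunction of the operator; the price is that these probabilities depend on
  \<open>k\<close>.\<close>

definition transfer_quotient ::
  "nat set \<Rightarrow> ((nat \<Rightarrow> nat) \<Rightarrow> real) \<Rightarrow> ((nat \<Rightarrow> nat) \<Rightarrow> complex) \<Rightarrow> nat \<Rightarrow> (nat \<Rightarrow> nat) \<Rightarrow> complex" where
  "transfer_quotient E g p k \<omega> = transfer E (\<lambda>\<omega>. of_real (g \<omega>) + p \<omega>) k \<omega> / of_real (transfer E g k \<omega>)"

lemma of_real_transfer:
  "(of_real (transfer E g k \<omega>) :: complex) = transfer E (\<lambda>\<omega>. of_real (g \<omega>)) k \<omega>"
  by (induction k arbitrary: \<omega>) (simp_all add: exp_of_real)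

lemma transfer_pos:
  fixes g :: "(nat \<Rightarrow> nat) \<Rightarrow> real"
  assumes "finite E" "E \<noteq> {}"
  shows "transfer E g k \<omega> > 0"
  by (induction k arbitrary: \<omega>) (use assms in \<open>auto intro!: sum_pos\<close>)

text \<open>Each prepended letter lengthens the agreement by one, so the errors form a geometric
  series with sum \<open>C / (1 - \<theta>) * \<theta> ^ n\<close>.\<close>

lemma transfer_distortion:
  fixes g :: "(nat \<Rightarrow> nat) \<Rightarrow> real"
  assumes E: "finite E" "E \<noteq> {}" and \<theta>: "0 < \<theta>" "\<theta> < 1" and C: "C > 0"
    and g: "prefix_Hoelder \<theta> C g" and "agree n \<omega> \<tau>"
  shows "transfer E g k \<omega> \<le> exp (C / (1 - \<theta>) * \<theta> ^ n) * transfer E g k \<tau>"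
  using \<open>agree n \<omega> \<tau>\<close>
proof (induction k arbitrary: n \<omega> \<tau>)
  case 0
  have "C / (1 - \<theta>) * \<theta> ^ n \<ge> 0" using C \<theta> by simp
  thus ?case by simp
next
  case (Suc k)
  have eq: "C * \<theta> ^ n + C / (1 - \<theta>) * \<theta> ^ Suc n = C / (1 - \<theta>) * \<theta> ^ n"
    using \<theta> by (simp add: field_simps)
  have "exp (g (i ## \<omega>)) * transfer E g k (i ## \<omega>)
     \<le> exp (C / (1 - \<theta>) * \<theta> ^ n) * (exp (g (i ## \<tau>)) * transfer E g k (i ## \<tau>))" for i
  proof -
    have 1: "exp (g (i ## \<omega>)) \<le> exp (C * \<theta> ^ n) * exp (g (i ## \<tau>))"
      using prefix_HoelderD[OF g Suc.prems, of i] by (simp flip: exp_add)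
    have 2: "transfer E g k (i ## \<omega>)
       \<le> exp (C / (1 - \<theta>) * \<theta> ^ Suc n) * transfer E g k (i ## \<tau>)"
      by (rule Suc.IH) (use Suc.prems in simp)
    have "exp (g (i ## \<omega>)) * transfer E g k (i ## \<omega>)
      \<le> (exp (C * \<theta> ^ n) * exp (g (i ## \<tau>)))
         * (exp (C / (1 - \<theta>) * \<theta> ^ Suc n) * transfer E g k (i ## \<tau>))"
      by (rule mult_mono[OF 1 2]) (simp_all add: less_imp_le[OF transfer_pos[OF E]])
    also have "\<dots> = exp (C / (1 - \<theta>) * \<theta> ^ n) * (exp (g (i ## \<tau>)) * transfer E g k (i ## \<tau>))"
      unfolding eq[symmetric] exp_add by (simp add: mult_ac)
    finally show ?thesis .
  qed
  thus ?case by (auto simp: sum_distrib_left intro!: sum_mono)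
qed

lemma norm_exp_diff_le:
  fixes a b :: complex
  assumes "cmod a \<le> \<epsilon>" "cmod b \<le> \<epsilon>"
  shows "cmod (exp a - exp b) \<le> exp \<epsilon> * cmod (a - b)"
proof (rule field_differentiable_bound[of "cball 0 \<epsilon>" exp exp])
  fix z :: complex assume "z \<in> cball 0 \<epsilon>"
  thus "cmod (exp z) \<le> exp \<epsilon>" by (intro order_trans[OF norm_exp]) simp
qed (use assms in \<open>auto intro!: derivative_eq_intros\<close>)

text \<open>At \<open>\<epsilon> = 0\<close> both inequalities are strict, by
  \<open>\<kappa> < 1 - \<eta>\<close> and \<open>\<kappa> \<le> 1 / 4\<close>; continuity in
  \<open>\<epsilon>\<close> does the rest.\<close>

lemma perturbation_constant_exists:
  fixes \<eta> D :: real
  assumes "0 < \<kappa>" "\<kappa> \<le> 1 / 4" "\<kappa> < 1 - \<eta>"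
  shows "\<exists>\<epsilon>>0. \<eta> * (exp \<epsilon> * (\<kappa> + 2 * \<epsilon> * D)) \<le> \<kappa> * (1 - (\<kappa> + 2 * (exp \<epsilon> * \<epsilon>)))
     \<and> \<kappa> + 2 * (exp \<epsilon> * \<epsilon>) \<le> 1 / 2"
proof -
  have "((\<lambda>\<epsilon>. \<kappa> * (1 - (\<kappa> + 2 * (exp \<epsilon> * \<epsilon>))) - \<eta> * (exp \<epsilon> * (\<kappa> + 2 * \<epsilon> * D)))
      \<longlongrightarrow> \<kappa> * (1 - (\<kappa> + 2 * (exp 0 * 0))) - \<eta> * (exp 0 * (\<kappa> + 2 * 0 * D))) (at_right 0)"
    by (intro tendsto_intros)
  moreover have "0 < \<kappa> * (1 - (\<kappa> + 2 * (exp 0 * 0))) - \<eta> * (exp 0 * (\<kappa> + 2 * 0 * D))"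
    using mult_strict_left_mono[OF assms(3,1)] by (simp add: algebra_simps)
  ultimately have 1: "eventually (\<lambda>\<epsilon>. 0 < \<kappa> * (1 - (\<kappa> + 2 * (exp \<epsilon> * \<epsilon>))) - \<eta> * (exp \<epsilon> * (\<kappa> + 2 * \<epsilon> * D))) (at_right 0)"
    by (rule order_tendstoD)
  have "((\<lambda>\<epsilon>. \<kappa> + 2 * (exp \<epsilon> * \<epsilon>)) \<longlongrightarrow> \<kappa> + 2 * (exp 0 * 0)) (at_right (0::real))"
    by (intro tendsto_intros)
  hence 2: "eventually (\<lambda>\<epsilon>. \<kappa> + 2 * (exp \<epsilon> * \<epsilon>) < 1 / 2) (at_right (0::real))"
    by (rule order_tendstoD) (use assms in auto)
  have 3: "eventually (\<lambda>\<epsilon>::real. \<epsilon> > 0) (at_right 0)" by (simp add: eventually_at_right_less)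
  have "eventually (\<lambda>\<epsilon>. \<epsilon> > 0 \<and> \<eta> * (exp \<epsilon> * (\<kappa> + 2 * \<epsilon> * D)) \<le> \<kappa> * (1 - (\<kappa> + 2 * (exp \<epsilon> * \<epsilon>)))
     \<and> \<kappa> + 2 * (exp \<epsilon> * \<epsilon>) \<le> 1 / 2) (at_right 0)"
    using 1 2 3 by eventually_elim auto
  thus ?thesis using eventually_happens trivial_limit_at_right_real by blast
qed

text \<open>The invariant bounds the oscillation of \<open>r\<close> by \<open>\<kappa>\<close>
  times \<open>cmod (r o')\<close>. Multiplication with \<open>exp p\<close> raises
  \<open>\<kappa>\<close> to \<open>b\<close>, the Markov operator contracts by
  \<open>\<eta>\<close>, and the reference value shrinks at most by the factor \<open>1 - c\<close>;
  the condition \<open>\<eta> * b \<le> \<kappa> * (1 - c)\<close> closes the loop. Measuring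
  against \<open>cmod (r o')\<close> makes the invariant independent of scale, although
  \<open>r\<close> may grow or decay exponentially.\<close>

lemma perturbed_markov_step:
  fixes r p :: "(nat \<Rightarrow> nat) \<Rightarrow> complex" and P :: "(nat \<Rightarrow> nat) \<Rightarrow> nat \<Rightarrow> real"
  assumes fin: "finite E" and a: "0 < a" and \<theta>: "0 < \<theta>" "\<theta> < 1" and A: "A = a / (1 - \<theta>)"
    and \<eta>: "\<eta> = 1 - (1 - \<theta>) * exp (- A)" and D: "D = 2 / (\<theta> * (1 - exp (- A)))"
    and P0: "\<And>\<omega> i. i \<in> E \<Longrightarrow> 0 \<le> P \<omega> i" and P1: "\<And>\<omega>. sum (P \<omega>) E = 1"
    and PP: "\<And>n \<omega> \<tau> i. agree n \<omega> \<tau> \<Longrightarrow> i \<in> E \<Longrightarrow> exp (- (a * \<theta> ^ n)) * P \<tau> i \<le> P \<omega> i"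
    and b: "b = exp e * (\<kappa> + 2 * e * D)" and c: "c = \<kappa> + 2 * (exp e * e)"
    and e: "0 < e" "\<eta> * b \<le> \<kappa> * (1 - c)"
      "c \<le> 1 / 2"
    and \<kappa>: "0 < \<kappa>" "\<kappa> \<le> 1 / 4"
    and p: "\<And>\<omega>. cmod (p \<omega>) \<le> e"
    and p1: "prefix_Hoelder \<theta> e p"
    and r0: "r o' \<noteq> 0"
    and r: "\<And>n \<omega> \<tau>. agree n \<omega> \<tau> \<Longrightarrow> cmod (r \<omega> - r \<tau>) \<le> \<kappa> * (1 - exp (- (A * \<theta> ^ n))) * cmod (r o')"
    and r': "\<And>\<omega>. r' \<omega> = (\<Sum>i\<in>E. of_real (P \<omega> i) * (exp (p (i ## \<omega>)) * r (i ## \<omega>)))"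
  shows "cmod (r' o' / r o' - 1) \<le> 1 / 2" and "r' o' \<noteq> 0"
    and "agree n \<omega> \<tau> \<Longrightarrow> cmod (r' \<omega> - r' \<tau>) \<le> \<kappa> * (1 - exp (- (A * \<theta> ^ n))) * cmod (r' o')"
proof -
  define s where "s \<omega> = exp (p \<omega>) * r \<omega>" for \<omega>
  define \<psi> where "\<psi> n = 1 - exp (- (A * \<theta> ^ n))" for n :: nat
  have A0: "A > 0" using a \<theta> A by simp
  have \<psi>0: "0 < \<psi> 0" "\<psi> 0 < 1" using A0 by (auto simp: \<psi>_def)
  have D0: "D > 0" using A0 \<theta> by (simp add: D)
  have \<psi>_ge: "\<theta> ^ n * \<psi> 0 \<le> \<psi> n" for n
    using one_minus_exp_concave[of "\<theta> ^ n" A] \<theta> by (simp add: \<psi>_def mult_ac power_le_one)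
  have \<psi>_nn: "0 \<le> \<psi> n" for n using A0 \<theta> by (simp add: \<psi>_def)
  \<comment> \<open>\<open>D\<close> is chosen so that \<open>D * \<psi>\<close> dominates both the
    Hoelder bound for equal first letters, where the agreement has grown by one, and the crude
    factor 2 for different ones.\<close>
  have D\<psi>: "D * \<psi> (Suc n) \<ge> 2 * \<theta> ^ n" "D * \<psi> 0 \<ge> 2" for n
  proof -
    have "2 * \<theta> ^ n = D * (\<theta> ^ Suc n * \<psi> 0)" using \<psi>0 \<theta> by (simp add: D \<psi>_def)
    also have "\<dots> \<le> D * \<psi> (Suc n)" using D0 \<psi>_ge[of "Suc n"] by (intro mult_left_mono) auto
    finally show "D * \<psi> (Suc n) \<ge> 2 * \<theta> ^ n" .
    have "D * \<psi> 0 = 2 * \<psi> 0 / (\<theta> * \<psi> 0)" by (simp add: D \<psi>_def)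
    hence "D * \<psi> 0 = 2 / \<theta>" using \<psi>0 by simp
    moreover have "2 \<le> 2 / \<theta>" using \<theta> by (simp add: le_divide_eq)
    ultimately show "D * \<psi> 0 \<ge> 2" by linarith
  qed
  have r_le: "cmod (r \<omega> - r o') \<le> \<kappa> * cmod (r o')" for \<omega>
  proof -
    have "cmod (r \<omega> - r o') \<le> \<kappa> * \<psi> 0 * cmod (r o')" using r[of 0 \<omega> o'] by (simp add: \<psi>_def)
    also have "\<dots> \<le> \<kappa> * 1 * cmod (r o')" using \<psi>0 \<kappa> by (intro mult_right_mono mult_left_mono) auto
    finally show ?thesis by simp
  qed
  have r2: "cmod (r \<omega>) \<le> 2 * cmod (r o')" for \<omega>
  proof -
    have "cmod (r \<omega>) \<le> cmod (r \<omega> - r o') + cmod (r o')" by (metis diff_add_cancel norm_triangle_ineq)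
    also have "\<dots> \<le> \<kappa> * cmod (r o') + cmod (r o')" using r_le by simp
    also have "\<dots> \<le> 1 * cmod (r o') + cmod (r o')" using \<kappa> by (intro add_right_mono mult_right_mono) auto
    finally show ?thesis by simp
  qed
  have s_diff: "cmod (s \<omega> - s \<tau>) \<le> b * cmod (r o') * \<psi> n"
    if 1: "cmod (r \<omega> - r \<tau>) \<le> \<kappa> * \<psi> n * cmod (r o')" and 2: "cmod (p \<omega> - p \<tau>) \<le> e * (D * \<psi> n)" for \<omega> \<tau> n
  proof -
    have "s \<omega> - s \<tau> = exp (p \<omega>) * (r \<omega> - r \<tau>) + (exp (p \<omega>) - exp (p \<tau>)) * r \<tau>"
      by (simp add: s_def algebra_simps)
    hence "cmod (s \<omega> - s \<tau>) \<le> cmod (exp (p \<omega>)) * cmod (r \<omega> - r \<tau>) + cmod (exp (p \<omega>) - exp (p \<tau>)) * cmod (r \<tau>)"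
      by (metis norm_mult norm_triangle_ineq)
    also have "\<dots> \<le> exp e * (\<kappa> * \<psi> n * cmod (r o')) + (exp e * (e * (D * \<psi> n))) * (2 * cmod (r o'))"
    proof (intro add_mono mult_mono 1 r2)
      show "cmod (exp (p \<omega>)) \<le> exp e" using norm_exp[of "p \<omega>"] p[of \<omega>] by (meson exp_le_cancel_iff order_trans)
      have "cmod (exp (p \<omega>) - exp (p \<tau>)) \<le> exp e * cmod (p \<omega> - p \<tau>)" by (rule norm_exp_diff_le[OF p p])
      also have "\<dots> \<le> exp e * (e * (D * \<psi> n))" using 2 by simp
      finally show "cmod (exp (p \<omega>) - exp (p \<tau>)) \<le> exp e * (e * (D * \<psi> n))" .
    qed (use e D0 \<psi>_nn \<kappa> in auto)
    also have "\<dots> = b * cmod (r o') * \<psi> n" by (simp add: b algebra_simps)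
    finally show ?thesis .
  qed
  have mc: "cmod (r' \<omega> - r' \<tau>) \<le> \<eta> * (b * cmod (r o')) * (1 - exp (- (A * \<theta> ^ n)))"
    if "agree n \<omega> \<tau>" for n \<omega> \<tau>
    unfolding r' \<eta>
    unfolding s_def[symmetric]
  proof (rule markov_contraction[OF fin a \<theta> A P0 P1 PP _ _ _ that])
    fix n \<omega> \<tau> i assume ag: "agree n \<omega> \<tau>" "i \<in> E"
    have "cmod (s (i ## \<omega>) - s (i ## \<tau>)) \<le> b * cmod (r o') * \<psi> (Suc n)"
    proof (rule s_diff)
      show "cmod (r (i ## \<omega>) - r (i ## \<tau>)) \<le> \<kappa> * \<psi> (Suc n) * cmod (r o')"
        unfolding \<psi>_def by (rule r) (use ag in simp)
      have "e * \<theta> ^ n \<le> e * (D * \<psi> (Suc n))" using e D\<psi>(1)[of n] \<theta> by (intro mult_left_mono) (auto intro: order_trans[rotated])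
      thus "cmod (p (i ## \<omega>) - p (i ## \<tau>)) \<le> e * (D * \<psi> (Suc n))"
        using prefix_HoelderD[OF p1 ag(1), of i] by linarith
    qed
    thus "cmod (s (i ## \<omega>) - s (i ## \<tau>)) \<le> b * cmod (r o') * (1 - exp (- (A * \<theta> ^ Suc n)))"
      by (simp only: \<psi>_def)
  next
    fix \<omega> \<tau> i j
    have "cmod (s (i ## \<omega>) - s (j ## \<tau>)) \<le> b * cmod (r o') * \<psi> 0"
    proof (rule s_diff)
      show "cmod (r (i ## \<omega>) - r (j ## \<tau>)) \<le> \<kappa> * \<psi> 0 * cmod (r o')"
        unfolding \<psi>_def by (rule r) simp
      have "cmod (p (i ## \<omega>) - p (j ## \<tau>)) \<le> e + e"
        by (intro norm_triangle_le_diff add_mono p)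
      also have "\<dots> \<le> e * (D * \<psi> 0)" using e mult_left_mono[OF D\<psi>(2), of e] by simp
      finally show "cmod (p (i ## \<omega>) - p (j ## \<tau>)) \<le> e * (D * \<psi> 0)" .
    qed
    thus "cmod (s (i ## \<omega>) - s (j ## \<tau>)) \<le> b * cmod (r o') * (1 - exp (- A))"
      by (simp add: \<psi>_def)
  qed (use \<kappa> e D0 b in auto)
  have close: "cmod (r' o' - r o') \<le> c * cmod (r o')"
  proof -
    have "r' o' - r o' = (\<Sum>i\<in>E. of_real (P o' i) * (s (i ## o') - r o'))"
      unfolding r' s_def[symmetric] by (simp add: right_diff_distrib sum_subtractf P1 flip: sum_distrib_right of_real_sum)
    also have "cmod \<dots> \<le> (\<Sum>i\<in>E. P o' i * (c * cmod (r o')))"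
    proof (rule sum_norm_le)
      fix i assume i: "i \<in> E"
      let ?w = "i ## o'"
      have "s ?w - r o' = (exp (p ?w) - 1) * r ?w + (r ?w - r o')" by (simp add: s_def algebra_simps)
      hence "cmod (s ?w - r o') \<le> cmod (exp (p ?w) - 1) * cmod (r ?w) + cmod (r ?w - r o')"
        by (metis norm_mult norm_triangle_ineq)
      also have "\<dots> \<le> (exp e * e) * (2 * cmod (r o')) + \<kappa> * cmod (r o')"
      proof (intro add_mono mult_mono r2 r_le)
        have "cmod (exp (p ?w) - exp 0) \<le> exp e * cmod (p ?w - 0)" by (rule norm_exp_diff_le) (use p e in auto)
        also have "\<dots> \<le> exp e * e" using p[of ?w] by simp
        finally show "cmod (exp (p ?w) - 1) \<le> exp e * e" by simp
      qed (use e in auto)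
      finally have "cmod (s ?w - r o') \<le> c * cmod (r o')" by (simp add: c algebra_simps)
      thus "cmod (of_real (P o' i) * (s ?w - r o')) \<le> P o' i * (c * cmod (r o'))"
        using P0[OF i, of o'] by (auto simp: norm_mult intro!: mult_left_mono)
    qed
    also have "\<dots> = c * cmod (r o')" by (simp add: P1 flip: sum_distrib_right)
    finally show ?thesis .
  qed
  have "r' o' / r o' - 1 = (r' o' - r o') / r o'" using r0 by (simp add: field_simps)
  hence "cmod (r' o' / r o' - 1) \<le> c" using close r0 by (simp add: norm_divide field_simps)
  thus half: "cmod (r' o' / r o' - 1) \<le> 1 / 2" using e(3) by linarith
  thus "r' o' \<noteq> 0" by auto
  have ge: "(1 - c) * cmod (r o') \<le> cmod (r' o')"
  proof -
    have "cmod (r o') \<le> cmod (r' o') + cmod (r' o' - r o')" by (metis norm_minus_commute norm_triangle_sub)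
    thus ?thesis using close by (simp add: algebra_simps)
  qed
  show "cmod (r' \<omega> - r' \<tau>) \<le> \<kappa> * (1 - exp (- (A * \<theta> ^ n))) * cmod (r' o')" if "agree n \<omega> \<tau>"
  proof -
    have "cmod (r' \<omega> - r' \<tau>) \<le> (\<eta> * b) * (cmod (r o') * \<psi> n)"
      using mc[OF that] by (simp add: \<psi>_def mult_ac)
    also have "\<dots> \<le> (\<kappa> * (1 - c)) * (cmod (r o') * \<psi> n)"
      using e(2) \<psi>_nn by (intro mult_right_mono) auto
    also have "\<dots> = \<kappa> * \<psi> n * ((1 - c) * cmod (r o'))" by (simp add: mult_ac)
    also have "\<dots> \<le> \<kappa> * \<psi> n * cmod (r' o')" using ge \<kappa> \<psi>_nn by (intro mult_left_mono) auto
    finally show ?thesis by (simp add: \<psi>_def)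
  qed
qed

text \<open>\<open>\<epsilon>\<close> is fixed before the alphabet, the base word and the order
  \<open>k\<close>, which is what permits the later limits. Consecutive quotients are controlled
  because the quotient itself may drift exponentially in \<open>k\<close>; its logarithm then grows
  at most linearly.\<close>

theorem transfer_quotient_stable:
  fixes g :: "(nat \<Rightarrow> nat) \<Rightarrow> real"
  assumes C: "C > 0" and \<theta>: "0 < \<theta>" "\<theta> < 1" and g: "prefix_Hoelder \<theta> C g"
  obtains \<epsilon> where "\<epsilon> > 0"
    "\<And>E p o' k. finite E \<Longrightarrow> E \<noteq> {} \<Longrightarrow> \<forall>\<omega>. cmod (p \<omega>) \<le> \<epsilon> \<Longrightarrow> prefix_Hoelder \<theta> \<epsilon> p \<Longrightarrow>
       transfer_quotient E g p k o' \<noteq> 0 \<and>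
       cmod (transfer_quotient E g p (Suc k) o' / transfer_quotient E g p k o' - 1) \<le> 1 / 2"
proof -
  define C1 where "C1 = C / (1 - \<theta>)"
  \<comment> \<open>The probabilities \<open>P k\<close> are fractions: numerator and denominator
    each contribute a distortion exponent \<open>C1 * \<theta> ^ n\<close>, the letter weight being
    absorbed by \<open>C + C1 * \<theta> = C1\<close>.\<close>
  define a where "a = 2 * C1"
  define A where "A = a / (1 - \<theta>)"
  define \<eta> where "\<eta> = 1 - (1 - \<theta>) * exp (- A)"
  define D where "D = 2 / (\<theta> * (1 - exp (- A)))"
  define \<kappa> where "\<kappa> = min (1 / 4) ((1 - \<eta>) / 2)"
  have C1: "C1 > 0" and a: "a > 0" and C1eq: "C + C1 * \<theta> = C1" using C \<theta> by (auto simp: C1_def a_def field_simps)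
  have \<eta>1: "\<eta> < 1" using \<theta> by (simp add: \<eta>_def)
  have \<kappa>: "0 < \<kappa>" "\<kappa> \<le> 1 / 4" "\<kappa> < 1 - \<eta>" using \<eta>1 by (auto simp: \<kappa>_def min_def)
  obtain \<epsilon> where \<epsilon>: "\<epsilon> > 0" "\<eta> * (exp \<epsilon> * (\<kappa> + 2 * \<epsilon> * D)) \<le> \<kappa> * (1 - (\<kappa> + 2 * (exp \<epsilon> * \<epsilon>)))"
     "\<kappa> + 2 * (exp \<epsilon> * \<epsilon>) \<le> 1 / 2"
    using perturbation_constant_exists[OF \<kappa>] by blast
  show ?thesis
  proof (rule that[OF \<epsilon>(1)])
    fix E :: "nat set" and p :: "(nat \<Rightarrow> nat) \<Rightarrow> complex" and o' :: "nat \<Rightarrow> nat" and k :: nat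
    assume E: "finite E" "E \<noteq> {}" and p_le: "\<forall>\<omega>. cmod (p \<omega>) \<le> \<epsilon>" and p1: "prefix_Hoelder \<theta> \<epsilon> p"
    have p: "cmod (p \<omega>) \<le> \<epsilon>" for \<omega> using p_le by simp
    define f where "f k \<omega> = transfer E g k \<omega>" for k \<omega>
    define r where "r k \<omega> = transfer_quotient E g p k \<omega>" for k \<omega>
    define P where "P k \<omega> i = exp (g (i ## \<omega>)) * f k (i ## \<omega>) / f (Suc k) \<omega>" for k \<omega> i
    have f0: "f k \<omega> > 0" for k \<omega> unfolding f_def by (rule transfer_pos[OF E])
    have fS: "f (Suc k) \<omega> = (\<Sum>i\<in>E. exp (g (i ## \<omega>)) * f k (i ## \<omega>))" for k \<omega> by (simp add: f_def)
    have fd: "f k \<omega> \<le> exp (C1 * \<theta> ^ n) * f k \<tau>" if "agree n \<omega> \<tau>" for k n \<omega> \<tau>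
      unfolding f_def C1_def by (rule transfer_distortion[OF E \<theta> C g that])
    have P0: "0 \<le> P k \<omega> i" for k \<omega> i using f0 by (simp add: P_def less_imp_le)
    have P1: "sum (P k \<omega>) E = 1" for k \<omega>
      using f0[of "Suc k" \<omega>] by (simp add: P_def fS flip: sum_divide_distrib)
    have PP: "exp (- (a * \<theta> ^ n)) * P k \<tau> i \<le> P k \<omega> i" if ag: "agree n \<omega> \<tau>" for k n \<omega> \<tau> i
    proof -
      have 1: "exp (g (i ## \<tau>)) \<le> exp (C * \<theta> ^ n) * exp (g (i ## \<omega>))"
        using prefix_HoelderD[OF g ag, of i] by (simp flip: exp_add)
      have 2: "f k (i ## \<tau>) \<le> exp (C1 * \<theta> ^ Suc n) * f k (i ## \<omega>)"
        by (rule fd) (use agree_sym[OF ag] in simp)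
      have 3: "f (Suc k) \<omega> \<le> exp (C1 * \<theta> ^ n) * f (Suc k) \<tau>" by (rule fd[OF ag])
      have "P k \<tau> i * f (Suc k) \<omega> \<le> P k \<tau> i * (exp (C1 * \<theta> ^ n) * f (Suc k) \<tau>)"
        by (intro mult_left_mono 3 P0)
      also have "\<dots> = exp (C1 * \<theta> ^ n) * (exp (g (i ## \<tau>)) * f k (i ## \<tau>))"
        using f0[of "Suc k" \<tau>] by (simp add: P_def)
      also have "\<dots> \<le> exp (C1 * \<theta> ^ n) * ((exp (C * \<theta> ^ n) * exp (g (i ## \<omega>))) * (exp (C1 * \<theta> ^ Suc n) * f k (i ## \<omega>)))"
        by (intro mult_left_mono mult_mono 1 2) (simp_all add: less_imp_le[OF f0])
      also have "\<dots> = exp (C1 * \<theta> ^ n + (C * \<theta> ^ n + C1 * \<theta> ^ Suc n)) * (P k \<omega> i * f (Suc k) \<omega>)"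
        using f0[of "Suc k" \<omega>] by (simp add: P_def exp_add mult_ac)
      also have "C1 * \<theta> ^ n + (C * \<theta> ^ n + C1 * \<theta> ^ Suc n) = C1 * \<theta> ^ n + (C + C1 * \<theta>) * \<theta> ^ n"
        by (simp add: algebra_simps)
      also have "\<dots> = a * \<theta> ^ n" unfolding C1eq by (simp add: a_def)
      finally have "P k \<tau> i * f (Suc k) \<omega> \<le> (exp (a * \<theta> ^ n) * P k \<omega> i) * f (Suc k) \<omega>" by (simp add: mult_ac)
      hence "P k \<tau> i \<le> exp (a * \<theta> ^ n) * P k \<omega> i" using f0[of "Suc k" \<omega>] by (simp add: mult_le_cancel_right)
      thus ?thesis by (simp add: exp_minus field_simps)
    qed
    \<comment> \<open>The quotients evolve under a Markov operator preceded by multiplication with \<open>exp p\<close>.\<close>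
    have rS: "r (Suc k) \<omega> = (\<Sum>i\<in>E. of_real (P k \<omega> i) * (exp (p (i ## \<omega>)) * r k (i ## \<omega>)))" for k \<omega>
      using f0 unfolding r_def P_def transfer_quotient_def f_def[symmetric]
      by (simp add: sum_divide_distrib exp_add exp_of_real less_imp_neq[symmetric] mult_ac)
    have step: "cmod (r (Suc k) o' / r k o' - 1) \<le> 1 / 2 \<and> r (Suc k) o' \<noteq> 0 \<and>
        (\<forall>n \<omega> \<tau>. agree n \<omega> \<tau> \<longrightarrow> cmod (r (Suc k) \<omega> - r (Suc k) \<tau>) \<le> \<kappa> * (1 - exp (- (A * \<theta> ^ n))) * cmod (r (Suc k) o'))"
      if r0: "r k o' \<noteq> 0" and rr: "\<And>n \<omega> \<tau>. agree n \<omega> \<tau> \<Longrightarrow> cmod (r k \<omega> - r k \<tau>) \<le> \<kappa> * (1 - exp (- (A * \<theta> ^ n))) * cmod (r k o')" for k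
    proof -
      note st = perturbed_markov_step[where E = E and P = "P k" and p = p and r = "r k" and r' = "r (Suc k)" and o' = o',
          OF E(1) a \<theta> A_def \<eta>_def D_def P0 P1 _ refl refl \<epsilon> \<kappa>(1,2) p p1 r0 _ rS]
      show ?thesis using st(1,2) st(3) PP rr by (intro conjI allI impI) simp_all
    qed
    have inv: "r k o' \<noteq> 0 \<and> (\<forall>n \<omega> \<tau>. agree n \<omega> \<tau> \<longrightarrow> cmod (r k \<omega> - r k \<tau>) \<le> \<kappa> * (1 - exp (- (A * \<theta> ^ n))) * cmod (r k o'))" for k
    proof (induction k)
      case 0
      have "A > 0" using a \<theta> by (simp add: A_def)
      thus ?case using \<kappa> \<theta> by (simp add: r_def transfer_quotient_def)
    next
      case (Suc k)
      show ?case using step[of k] Suc by blast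
    qed
    have "cmod (r (Suc k) o' / r k o' - 1) \<le> 1 / 2" using step[of k] inv[of k] by blast
    moreover have "r k o' \<noteq> 0" using inv by blast
    ultimately show "transfer_quotient E g p k o' \<noteq> 0 \<and>
       cmod (transfer_quotient E g p (Suc k) o' / transfer_quotient E g p k o' - 1) \<le> 1 / 2"
      by (simp add: r_def)
  qed
qed

section \<open>Power series in several variables\<close>

text \<open>By Montel's theorem a subsequence has a holomorphic limit, which can only be
  \<open>g\<close>. This serves where the convergence has no known uniform rate, as for the coding
  maps.\<close>

lemma holomorphic_on_bounded_pointwise_limit:
  fixes f :: "nat \<Rightarrow> complex \<Rightarrow> complex"
  assumes S: "open S" and hol: "\<And>n. f n holomorphic_on S"
    and bnd: "\<And>n z. z \<in> S \<Longrightarrow> cmod (f n z) \<le> B"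
    and lim: "\<And>z. z \<in> S \<Longrightarrow> (\<lambda>n. f n z) \<longlonglongrightarrow> g z"
  shows "g holomorphic_on S"
proof -
  obtain h r where h: "h holomorphic_on S" "strict_mono (r :: nat \<Rightarrow> nat)"
      "\<And>x. x \<in> S \<Longrightarrow> (\<lambda>n. f (r n) x) \<longlonglongrightarrow> h x"
  proof (rule Montel[of S "range f" f])
    show "\<exists>B. \<forall>h\<in>range f. \<forall>z\<in>K. cmod (h z) \<le> B" if "compact K" "K \<subseteq> S" for K
      using bnd that by (intro exI[of _ B]) auto
  qed (use S hol in auto)
  have "h x = g x" if "x \<in> S" for x
    using LIMSEQ_unique[OF h(3)[OF that] LIMSEQ_subseq_LIMSEQ[OF lim[OF that] h(2), unfolded o_def]] .
  thus ?thesis using h(1) holomorphic_transform by blast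
qed

lemma Cauchy_coefficient_bound:
  assumes hol: "f holomorphic_on ball 0 R" and R: "0 < R"
    and bnd: "\<And>z. z \<in> ball 0 R \<Longrightarrow> cmod (f z) \<le> C"
  shows "cmod ((deriv ^^ k) f 0 / fact k) \<le> C / R ^ k"
\<comment> \<open>\<open>f\<close> is given on the open disc only: estimate on circles of radius
  \<open>r < R\<close>, then let \<open>r\<close> tend to \<open>R\<close>. Keeping \<open>R\<close>
  exact avoids a loss in each step of the later induction over coordinates.\<close>
proof (rule tendsto_lowerbound)
  have "eventually (\<lambda>r. r \<in> {0<..<R}) (at_left R)"
    using R by (rule eventually_at_leftI[of 0, rotated]) auto
  thus "eventually (\<lambda>r. cmod ((deriv ^^ k) f 0 / fact k) \<le> C / r ^ k) (at_left R)"
  proof eventually_elim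
    case (elim r)
    have "cmod ((deriv ^^ k) f 0) \<le> fact k * C / r ^ k"
    proof (rule Cauchy_inequality)
      show "f holomorphic_on ball 0 r" by (rule holomorphic_on_subset[OF hol]) (use elim in auto)
      show "continuous_on (cball 0 r) f"
        by (rule holomorphic_on_imp_continuous_on, rule holomorphic_on_subset[OF hol]) (use elim in auto)
      show "cmod (f x) \<le> C" if "cmod (0 - x) = r" for x using bnd elim that by auto
    qed (use elim in auto)
    thus ?case by (simp add: norm_divide pos_divide_le_eq mult.commute)
  qed
  show "((\<lambda>r. C / r ^ k) \<longlongrightarrow> C / R ^ k) (at_left R)" using R by (intro tendsto_intros) auto
qed auto

text \<open>For \<open>cmod w \<le> R / 2\<close> the tail is dominated by a geometric series of
  ratio 1/2, whence the factor 2. The case \<open>k = 1\<close> serves as a Schwarz lemma with a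
  worse constant.\<close>

lemma power_series_remainder_bound:
  assumes hol: "f holomorphic_on ball 0 R" and R: "0 < R"
    and bnd: "\<And>z. z \<in> ball 0 R \<Longrightarrow> cmod (f z) \<le> C" and w: "cmod w \<le> R / 2"
  shows "cmod (f w - (\<Sum>l<k. (deriv ^^ l) f 0 / fact l * w ^ l)) \<le> 2 * C * (cmod w / R) ^ k"
proof -
  define c where "c l = (deriv ^^ l) f 0 / fact l" for l
  have C0: "0 \<le> C" using bnd[of 0] R by (auto intro: order_trans[OF norm_ge_zero])
  have cb: "cmod (c l) \<le> C / R ^ l" for l unfolding c_def by (rule Cauchy_coefficient_bound[OF hol R bnd])
  have "(\<lambda>l. c l * w ^ l) sums f w"
    using holomorphic_power_series[OF hol, of w] w R by (simp add: c_def)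
  hence "(\<lambda>l. c (l + k) * w ^ (l + k)) sums (f w - (\<Sum>l<k. c l * w ^ l))"
    by (rule sums_split_initial_segment)
  moreover have geo: "(\<lambda>l. C * (cmod w / R) ^ k * (1 / 2) ^ l) sums (C * (cmod w / R) ^ k * 2)"
    using geometric_sums[of "1 / 2 :: real"] by (intro sums_mult) simp
  moreover have le: "cmod (c (l + k) * w ^ (l + k)) \<le> C * (cmod w / R) ^ k * (1 / 2) ^ l" for l
  proof -
    have "cmod (c (l + k) * w ^ (l + k)) \<le> C / R ^ (l + k) * cmod w ^ (l + k)"
      unfolding norm_mult norm_power by (intro mult_right_mono cb) simp
    also have "\<dots> = C * (cmod w / R) ^ k * (cmod w / R) ^ l" by (simp add: power_add field_simps)
    also have "\<dots> \<le> C * (cmod w / R) ^ k * (1 / 2) ^ l"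
      using w R C0 by (intro mult_left_mono power_mono) (auto simp: field_simps)
    finally show ?thesis .
  qed
  ultimately have "cmod (f w - (\<Sum>l<k. c l * w ^ l)) \<le> C * (cmod w / R) ^ k * 2"
    using norm_sums_le by blast
  thus ?thesis by (simp add: c_def)
qed

text \<open>With only separate holomorphy and a bound at hand, the coefficient is not treated as a
  Cauchy integral depending on \<open>v\<close>. It is the limit, as \<open>w\<close> tends to 0, of
  the remainder of order \<open>k\<close> divided by \<open>w ^ k\<close>; these quotients are
  uniformly bounded and, by induction on \<open>k\<close>, holomorphic in \<open>v\<close>.\<close>

lemma holomorphic_on_Taylor_coefficient:
  fixes F :: "complex \<Rightarrow> complex \<Rightarrow> complex"
  assumes T: "open T" and R: "0 < R"
    and hol1: "\<And>w. w \<in> ball 0 R \<Longrightarrow> (\<lambda>v. F v w) holomorphic_on T"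
    and hol2: "\<And>v. v \<in> T \<Longrightarrow> F v holomorphic_on ball 0 R"
    and bnd: "\<And>v w. v \<in> T \<Longrightarrow> w \<in> ball 0 R \<Longrightarrow> cmod (F v w) \<le> C"
  shows "(\<lambda>v. (deriv ^^ k) (F v) 0 / fact k) holomorphic_on T"
proof (induction k rule: less_induct)
  case (less k)
  define c where "c l v = (deriv ^^ l) (F v) 0 / fact l" for l v
  have hol: "c l holomorphic_on T" if "l < k" for l
    using less[OF that] by (simp add: c_def[abs_def])
  \<comment> \<open>The shift by 2 keeps \<open>e m\<close> within radius \<open>R / 2\<close>,
    where the remainder bound holds.\<close>
  define e :: "nat \<Rightarrow> complex" where "e m = of_real (R / real (m + 2))" for m
  have e: "e m \<noteq> 0" "cmod (e m) \<le> R / 2" "e m \<in> ball 0 R" for m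
  proof -
    show "e m \<noteq> 0" using R unfolding e_def of_real_eq_0_iff by simp
    have "R / real (m + 2) \<le> R / 2" using R by (intro divide_left_mono) auto
    thus "cmod (e m) \<le> R / 2" using R unfolding e_def norm_of_real by simp
    thus "e m \<in> ball 0 R" using R by simp
  qed
  have rem: "cmod (F v (e m) - (\<Sum>l<j. c l v * e m ^ l)) \<le> 2 * C * (cmod (e m) / R) ^ j" if "v \<in> T" for v m j
    unfolding c_def by (rule power_series_remainder_bound[OF hol2[OF that] R bnd[OF that] e(2)])
  show ?case
  proof (rule holomorphic_on_bounded_pointwise_limit[OF T])
    fix n
    show "(\<lambda>v. (F v (e n) - (\<Sum>l<k. c l v * e n ^ l)) / e n ^ k) holomorphic_on T"
      by (intro holomorphic_intros hol1 e hol) (use e in auto)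
  next
    fix n v assume v: "v \<in> T"
    show "cmod ((F v (e n) - (\<Sum>l<k. c l v * e n ^ l)) / e n ^ k) \<le> 2 * C / R ^ k"
      using rem[OF v, of n k] e[of n] R by (simp add: norm_divide norm_power field_simps)
  next
    fix v assume v: "v \<in> T"
    show "(\<lambda>n. (F v (e n) - (\<Sum>l<k. c l v * e n ^ l)) / e n ^ k) \<longlonglongrightarrow> (deriv ^^ k) (F v) 0 / fact k"
    proof (rule LIM_zero_cancel, rule Lim_null_comparison)
      show "eventually (\<lambda>n. cmod ((F v (e n) - (\<Sum>l<k. c l v * e n ^ l)) / e n ^ k - (deriv ^^ k) (F v) 0 / fact k)
         \<le> 2 * C / R ^ Suc k * (R / real (n + 2))) sequentially"
      proof (rule always_eventually, rule allI)
        fix n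
        have "(F v (e n) - (\<Sum>l<k. c l v * e n ^ l)) / e n ^ k - (deriv ^^ k) (F v) 0 / fact k
           = (F v (e n) - (\<Sum>l<Suc k. c l v * e n ^ l)) / e n ^ k"
          using e[of n] by (simp add: c_def diff_divide_distrib add_divide_distrib)
        also have "cmod \<dots> \<le> 2 * C * (cmod (e n) / R) ^ Suc k / cmod (e n) ^ k"
          unfolding norm_divide norm_power by (intro divide_right_mono rem[OF v]) auto
        also have "\<dots> = 2 * C / R ^ Suc k * cmod (e n)"
          using e[of n] by (simp add: power_divide field_simps)
        also have "cmod (e n) = R / real (n + 2)" using R unfolding e_def norm_of_real by simp
        finally show "cmod ((F v (e n) - (\<Sum>l<k. c l v * e n ^ l)) / e n ^ k - (deriv ^^ k) (F v) 0 / fact k)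
         \<le> 2 * C / R ^ Suc k * (R / real (n + 2))" .
      qed
      have "(\<lambda>n. R / real (n + 2)) \<longlonglongrightarrow> 0"
        using LIMSEQ_ignore_initial_segment[OF lim_const_over_n[of R], of 2] by simp
      thus "(\<lambda>n. 2 * C / R ^ Suc k * (R / real (n + 2))) \<longlonglongrightarrow> 0"
        by (rule tendsto_mult_right_zero)
    qed
  qed
qed

definition multi_indices :: "'i set \<Rightarrow> ('i \<Rightarrow> nat) set" where
  "multi_indices S = {\<alpha>. \<forall>b. b \<notin> S \<longrightarrow> \<alpha> b = 0}"

lemma multi_indices_empty [simp]: "multi_indices {} = {\<lambda>_. 0}"
  by (auto simp: multi_indices_def)

lemma bij_betw_multi_indices_insert:
  assumes "i \<notin> S"
  shows "bij_betw (\<lambda>(k, \<alpha>). \<alpha>(i := k)) (UNIV \<times> multi_indices S) (multi_indices (insert i S))"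
  by (rule bij_betw_byWitness[where f' = "\<lambda>\<alpha>. (\<alpha> i, \<alpha>(i := 0))"])
     (use assms in \<open>auto simp: multi_indices_def fun_eq_iff\<close>)

lemma prod_insert_fun_upd:
  fixes x :: "'i \<Rightarrow> 'a::comm_semiring_1"
  assumes "finite S" "i \<notin> S"
  shows "(\<Prod>b\<in>insert i S. x b ^ (\<alpha>(i := k)) b) = x i ^ k * (\<Prod>b\<in>S. x b ^ \<alpha> b)"
proof -
  have "(\<Prod>b\<in>S. x b ^ (\<alpha>(i := k)) b) = (\<Prod>b\<in>S. x b ^ \<alpha> b)"
    by (rule prod.cong) (use assms in auto)
  thus ?thesis using assms by simp
qed

lemma summable_on_multi_indices:
  fixes x :: "'i \<Rightarrow> real"
  assumes "finite S" and "\<And>b. b \<in> S \<Longrightarrow> 0 \<le> x b \<and> x b < 1"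
  shows "(\<lambda>\<alpha>. \<Prod>b\<in>S. x b ^ \<alpha> b) summable_on multi_indices S"
  using assms
proof (induction S)
  case empty
  show ?case by simp
next
  case (insert i S)
  obtain s where s: "((\<lambda>\<alpha>. \<Prod>b\<in>S. x b ^ \<alpha> b) has_sum s) (multi_indices S)"
    using insert by (auto simp: summable_on_def)
  have "(\<lambda>(k, \<alpha>). x i ^ k * (\<Prod>b\<in>S. x b ^ \<alpha> b)) summable_on UNIV \<times> multi_indices S"
  proof (rule summable_on_SigmaI)
    show "((\<lambda>\<alpha>. case (k, \<alpha>) of (k, \<alpha>) \<Rightarrow> x i ^ k * (\<Prod>b\<in>S. x b ^ \<alpha> b)) has_sum x i ^ k * s) (multi_indices S)" for k
      using has_sum_cmult_right[OF s] by simp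
    have "summable (\<lambda>k. x i ^ k * s)"
      using insert.prems[of i] by (intro summable_mult2 summable_geometric) auto
    thus "(\<lambda>k. x i ^ k * s) summable_on UNIV"
    proof (rule summable_nonneg_imp_summable_on)
      have "0 \<le> s" by (rule has_sum_nonneg[OF s]) (use insert.prems in \<open>auto intro!: prod_nonneg\<close>)
      thus "0 \<le> x i ^ k * s" for k using insert.prems[of i] by simp
    qed
  qed (use insert.prems in \<open>auto intro!: mult_nonneg_nonneg prod_nonneg\<close>)
  also have "?this \<longleftrightarrow> (\<lambda>p. \<Prod>b\<in>insert i S. x b ^ (case p of (k, \<alpha>) \<Rightarrow> \<alpha>(i := k)) b) summable_on UNIV \<times> multi_indices S"
    by (rule summable_on_cong) (use insert in \<open>auto simp: prod_insert_fun_upd simp del: prod.insert fun_upd_apply\<close>)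
  also have "\<dots> \<longleftrightarrow> ?case"
    by (rule summable_on_reindex_bij_betw[OF bij_betw_multi_indices_insert]) (use insert in auto)
  finally show ?case .
qed

text \<open>Points vanish outside \<open>S\<close>, so for positive \<open>R\<close> the polydisc
  over \<open>S\<close> lies in the one over a larger set, and a coordinate is added by a function
  update.\<close>

definition polydisc :: "'i set \<Rightarrow> real \<Rightarrow> ('i \<Rightarrow> complex) set" where
  "polydisc S R = {z. (\<forall>b\<in>S. cmod (z b) < R) \<and> (\<forall>b. b \<notin> S \<longrightarrow> z b = 0)}"

lemma monomial_bound:
  fixes z :: "'i \<Rightarrow> 'a::real_normed_field" and \<alpha> :: "'i \<Rightarrow> nat"
  assumes "finite S" "norm a \<le> C / R ^ sum \<alpha> S"
  shows "norm (a * (\<Prod>b\<in>S. z b ^ \<alpha> b)) \<le> C * (\<Prod>b\<in>S. (norm (z b) / R) ^ \<alpha> b)"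
proof -
  have "norm (a * (\<Prod>b\<in>S. z b ^ \<alpha> b)) \<le> C / R ^ sum \<alpha> S * (\<Prod>b\<in>S. norm (z b) ^ \<alpha> b)"
    unfolding norm_mult prod_norm[symmetric] norm_power by (intro mult_right_mono assms prod_nonneg) auto
  also have "\<dots> = C * (\<Prod>b\<in>S. (norm (z b) / R) ^ \<alpha> b)"
    by (simp add: power_divide prod_dividef power_sum)
  finally show ?thesis .
qed

text \<open>The coefficient bound is part of the notion because it is what survives limits.
  \<open>D\<close> is a parameter since the series is first found on a complex polydisc, while
  limits are taken at real points only.\<close>

definition bounded_power_series ::
  "'i set \<Rightarrow> real \<Rightarrow> real \<Rightarrow> ('i \<Rightarrow> 'a::real_normed_field) set \<Rightarrow> (('i \<Rightarrow> 'a) \<Rightarrow> 'a) \<Rightarrow> bool" where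
  "bounded_power_series S R C D f \<longleftrightarrow> (\<exists>c. (\<forall>\<alpha>\<in>multi_indices S. norm (c \<alpha>) \<le> C / R ^ sum \<alpha> S) \<and>
     (\<forall>x\<in>D. ((\<lambda>\<alpha>. c \<alpha> * (\<Prod>b\<in>S. x b ^ \<alpha> b)) has_sum f x) (multi_indices S)))"

text \<open>Osgood's lemma by induction on the coordinates: the Taylor coefficients in the new
  variable are again separately holomorphic in the others and bounded by \<open>C / R ^ k\<close>,
  so they have series with that constant; absolute convergence permits merging the iterated
  series.\<close>

theorem separately_holomorphic_power_series:
  fixes f :: "('i \<Rightarrow> complex) \<Rightarrow> complex"
  assumes "finite S" and R: "0 < R"
    and "\<And>i z. i \<in> S \<Longrightarrow> z \<in> polydisc S R \<Longrightarrow> (\<lambda>w. f (z(i := w))) holomorphic_on ball 0 R"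
    and "\<And>z. z \<in> polydisc S R \<Longrightarrow> cmod (f z) \<le> C"
  shows "bounded_power_series S R C (polydisc S R) f"
  using assms(1,3,4)
proof (induction S arbitrary: f C)
  case empty
  have "polydisc {} R = {\<lambda>_::'i. 0}" by (auto simp: polydisc_def)
  thus ?case using empty unfolding bounded_power_series_def
    by (intro exI[of _ "\<lambda>_. f (\<lambda>_. 0)"]) (auto intro!: has_sum_finiteI)
next
  case (insert i S)
  have i: "i \<notin> S" and fin: "finite S" using insert by auto
  have PD: "z(i := w) \<in> polydisc (insert i S) R" if "z \<in> polydisc S R" "w \<in> ball 0 R" for z w
    using that i by (auto simp: polydisc_def)
  have PDu: "z(j := w) \<in> polydisc S R" if "z \<in> polydisc S R" "w \<in> ball 0 R" "j \<in> S" for z w j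
    using that by (auto simp: polydisc_def)
  define F where "F z w = f (z(i := w))" for z w
  have hol: "F z holomorphic_on ball 0 R" if "z \<in> polydisc S R" for z
  proof -
    have "z \<in> polydisc (insert i S) R" using that R i by (auto simp: polydisc_def)
    from insert.prems(1)[OF _ this, of i] show ?thesis by (simp add: F_def[abs_def] del: fun_upd_apply)
  qed
  have bnd: "cmod (F z w) \<le> C" if "z \<in> polydisc S R" "w \<in> ball 0 R" for z w
    unfolding F_def by (rule insert.prems(2)[OF PD[OF that]])
  define c where "c k z = (deriv ^^ k) (F z) 0 / fact k" for k z
  have c_series: "bounded_power_series S R (C / R ^ k) (polydisc S R) (c k)" for k
  proof (rule insert.IH)
    fix j z assume jz: "j \<in> S" "z \<in> polydisc S R"
    show "(\<lambda>v. c k (z(j := v))) holomorphic_on ball 0 R"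
      unfolding c_def
    proof (rule holomorphic_on_Taylor_coefficient[OF open_ball R, where C = C])
      fix w assume w: "w \<in> ball (0::complex) R"
      have "(\<lambda>v. f ((z(i := w))(j := v))) holomorphic_on ball 0 R"
        by (rule insert.prems(1)[OF _ PD[OF jz(2) w]]) (use jz in auto)
      moreover have "(z(i := w))(j := v) = (z(j := v))(i := w)" for v
        using i jz by (auto simp: fun_upd_twist)
      ultimately show "(\<lambda>v. F (z(j := v)) w) holomorphic_on ball 0 R" by (simp add: F_def)
    qed (use PDu jz bnd hol in auto)
  next
    fix z assume "z \<in> polydisc S R"
    thus "cmod (c k z) \<le> C / R ^ k"
      unfolding c_def by (intro Cauchy_coefficient_bound hol R bnd)
  qed
  define Q where "Q k d \<longleftrightarrow> (\<forall>\<alpha>\<in>multi_indices S. cmod (d \<alpha>) \<le> C / R ^ k / R ^ sum \<alpha> S) \<and>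
    (\<forall>z\<in>polydisc S R. ((\<lambda>\<alpha>. d \<alpha> * (\<Prod>b\<in>S. z b ^ \<alpha> b)) has_sum c k z) (multi_indices S))" for k d
  have "\<exists>d. Q k d" for k using c_series[of k] by (simp add: bounded_power_series_def Q_def)
  then obtain d where "\<And>k. Q k (d k)" by metis
  hence db: "\<And>k \<alpha>. \<alpha> \<in> multi_indices S \<Longrightarrow> cmod (d k \<alpha>) \<le> C / R ^ k / R ^ sum \<alpha> S"
    and d: "\<And>k z. z \<in> polydisc S R \<Longrightarrow> ((\<lambda>\<alpha>. d k \<alpha> * (\<Prod>b\<in>S. z b ^ \<alpha> b)) has_sum c k z) (multi_indices S)"
    by (simp_all add: Q_def)
  define e where "e \<alpha> = d (\<alpha> i) (\<alpha>(i := 0))" for \<alpha>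
  have eb: "cmod (e \<alpha>) \<le> C / R ^ sum \<alpha> (insert i S)" if "\<alpha> \<in> multi_indices (insert i S)" for \<alpha>
  proof -
    have "sum (\<alpha>(i := 0)) S = sum \<alpha> S" by (rule sum.cong) (use i in auto)
    moreover have "\<alpha>(i := 0) \<in> multi_indices S" using that by (simp add: multi_indices_def)
    ultimately show ?thesis using db[of "\<alpha>(i := 0)" "\<alpha> i"] fin i by (simp add: e_def power_add)
  qed
  show ?case
    unfolding bounded_power_series_def
  proof (intro exI[of _ e] conjI ballI eb)
    fix z assume z: "z \<in> polydisc (insert i S) R"
    have zi: "z i \<in> ball 0 R" and z': "z(i := 0) \<in> polydisc S R" using z R by (auto simp: polydisc_def)
    have sm: "(\<lambda>\<alpha>. e \<alpha> * (\<Prod>b\<in>insert i S. z b ^ \<alpha> b)) summable_on multi_indices (insert i S)"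
    proof (rule abs_summable_summable, rule Infinite_Sum.abs_summable_on_comparison_test')
      show "(\<lambda>\<alpha>. C * (\<Prod>b\<in>insert i S. (cmod (z b) / R) ^ \<alpha> b)) summable_on multi_indices (insert i S)"
        by (intro summable_on_cmult_right summable_on_multi_indices) (use fin z R in \<open>auto simp: polydisc_def\<close>)
      show "cmod (e \<alpha> * (\<Prod>b\<in>insert i S. z b ^ \<alpha> b)) \<le> C * (\<Prod>b\<in>insert i S. (cmod (z b) / R) ^ \<alpha> b)"
        if "\<alpha> \<in> multi_indices (insert i S)" for \<alpha>
        by (rule monomial_bound[OF _ eb[OF that]]) (use fin in simp)
    qed
    have eq: "e (\<alpha>(i := k)) * (\<Prod>b\<in>insert i S. z b ^ (\<alpha>(i := k)) b) = z i ^ k * (d k \<alpha> * (\<Prod>b\<in>S. (z(i := 0)) b ^ \<alpha> b))"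
      if "\<alpha> \<in> multi_indices S" for k \<alpha>
    proof -
      have "\<alpha>(i := 0) = \<alpha>" using that i by (auto simp: multi_indices_def)
      moreover have "(\<Prod>b\<in>S. (z(i := 0)) b ^ \<alpha> b) = (\<Prod>b\<in>S. z b ^ \<alpha> b)" by (rule prod.cong) (use i in auto)
      ultimately show ?thesis using fin i by (simp add: e_def prod_insert_fun_upd mult_ac fun_upd_same del: prod.insert fun_upd_apply)
    qed
    let ?h = "\<lambda>p. e ((case p of (k, \<alpha>) \<Rightarrow> \<alpha>(i := k))) * (\<Prod>b\<in>insert i S. z b ^ (case p of (k, \<alpha>) \<Rightarrow> \<alpha>(i := k)) b)"
    have "(?h has_sum f z) (UNIV \<times> multi_indices S)"
    proof (rule has_sum_SigmaI)
      fix k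
      have "((\<lambda>\<alpha>. z i ^ k * (d k \<alpha> * (\<Prod>b\<in>S. (z(i := 0)) b ^ \<alpha> b))) has_sum z i ^ k * c k (z(i := 0))) (multi_indices S)"
        by (rule has_sum_cmult_right[OF d[OF z']])
      thus "((\<lambda>\<alpha>. ?h (k, \<alpha>)) has_sum z i ^ k * c k (z(i := 0))) (multi_indices S)"
        by (rule has_sum_cong[THEN iffD1, rotated]) (simp add: eq del: prod.insert fun_upd_apply)
    next
      show "((\<lambda>k. z i ^ k * c k (z(i := 0))) has_sum f z) UNIV"
      proof (rule norm_summable_imp_has_sum)
        have "(\<lambda>k. c k (z(i := 0)) * (z i - 0) ^ k) sums F (z(i := 0)) (z i)"
          unfolding c_def by (rule holomorphic_power_series[OF hol[OF z'] zi])
        thus "(\<lambda>k. z i ^ k * c k (z(i := 0))) sums f z" by (simp add: F_def mult.commute)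
        show "summable (\<lambda>k. cmod (z i ^ k * c k (z(i := 0))))"
        proof (rule summable_comparison_test_ev[OF always_eventually])
          show "\<forall>k. norm (cmod (z i ^ k * c k (z(i := 0)))) \<le> C * (cmod (z i) / R) ^ k"
          proof
            fix k
            have "cmod (c k (z(i := 0))) \<le> C / R ^ k"
              unfolding c_def by (rule Cauchy_coefficient_bound[OF hol[OF z'] R bnd[OF z']])
            hence "cmod (z i) ^ k * cmod (c k (z(i := 0))) \<le> cmod (z i) ^ k * (C / R ^ k)"
              by (rule mult_left_mono) auto
            thus "norm (cmod (z i ^ k * c k (z(i := 0)))) \<le> C * (cmod (z i) / R) ^ k"
              by (simp add: norm_mult norm_power power_divide mult_ac)
          qed
          show "summable (\<lambda>k. C * (cmod (z i) / R) ^ k)"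
            using zi R by (intro summable_mult summable_geometric) auto
        qed
      qed
    next
      show "?h summable_on UNIV \<times> multi_indices S"
        using summable_on_reindex_bij_betw[OF bij_betw_multi_indices_insert[OF i]] sm by fast
    qed
    thus "((\<lambda>\<alpha>. e \<alpha> * (\<Prod>b\<in>insert i S. z b ^ \<alpha> b)) has_sum f z) (multi_indices (insert i S))"
      using has_sum_reindex_bij_betw[OF bij_betw_multi_indices_insert[OF i]] by fast
  qed
qed

text \<open>Lebesgue's theorem for the counting measure on \<open>A\<close>.\<close>

lemma has_sum_dominated_limit:
  fixes g :: "nat \<Rightarrow> 'a \<Rightarrow> real"
  assumes lim: "\<And>x. x \<in> A \<Longrightarrow> (\<lambda>n. g n x) \<longlonglongrightarrow> h x"
    and dom: "\<And>n x. x \<in> A \<Longrightarrow> \<bar>g n x\<bar> \<le> M x" and M: "M summable_on A"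
    and sums: "\<And>n. (g n has_sum s n) A" and s: "s \<longlonglongrightarrow> t"
  shows "(h has_sum t) A"
proof -
  let ?C = "count_space A"
  have summable_iff: "f summable_on A \<longleftrightarrow> integrable ?C f" for f :: "'a \<Rightarrow> real"
    using summable_on_iff_abs_summable_on_real[of f A] abs_summable_equivalent[of f A] abs_summable_on_def[of f A] by blast
  have M_int: "integrable ?C M" using M by (rule summable_iff[THEN iffD1])
  have ae: "AE x in ?C. (\<lambda>n. g n x) \<longlonglongrightarrow> h x" "\<And>n. AE x in ?C. norm (g n x) \<le> M x"
    using lim dom by (simp_all add: AE_count_space)
  have int: "integrable ?C h" "\<And>n. integrable ?C (g n)" "(\<lambda>n. integral\<^sup>L ?C (g n)) \<longlonglongrightarrow> integral\<^sup>L ?C h"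
    using integrable_dominated_convergence[OF _ _ M_int ae] integrable_dominated_convergence2[OF _ _ M_int ae]
      integral_dominated_convergence[OF _ _ M_int ae] by simp_all
  have eq: "integral\<^sup>L ?C f = infsum f A" if "integrable ?C f" for f :: "'a \<Rightarrow> real"
    using that infsetsum_infsum[of f A] by (simp add: infsetsum_def abs_summable_on_def)
  have "s \<longlonglongrightarrow> infsum h A" using int(3) by (simp add: eq int(1,2) infsumI[OF sums])
  with s have "t = infsum h A" by (rule LIMSEQ_unique)
  thus ?thesis using summable_iff int(1) by simp
qed

lemma countable_multi_indices:
  assumes "finite S" shows "countable (multi_indices S)"
proof -
  have "multi_indices S \<subseteq> (\<lambda>g b. if b \<in> S then g b else 0) ` (PiE S (\<lambda>_. UNIV))"
  proof
    fix \<alpha> :: "'a \<Rightarrow> nat" assume "\<alpha> \<in> multi_indices S"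
    hence "\<alpha> = (\<lambda>g b. if b \<in> S then g b else 0) (restrict \<alpha> S)" by (auto simp: multi_indices_def)
    moreover have "restrict \<alpha> S \<in> PiE S (\<lambda>_. UNIV)" by simp
    ultimately show "\<alpha> \<in> (\<lambda>g b. if b \<in> S then g b else 0) ` (PiE S (\<lambda>_. UNIV))" by blast
  qed
  moreover have "countable (PiE S (\<lambda>_. UNIV :: nat set))" by (rule countable_PiE) (use assms in auto)
  ultimately show ?thesis by (meson countable_image countable_subset)
qed

text \<open>The coefficients of the \<open>f n\<close> are bounded but not known to converge, so a
  diagonal subsequence is taken; a product of geometric series dominates the sums. As
  \<open>R\<close>, \<open>C\<close> and \<open>D\<close> stay the same, the result can be applied
  twice, to the alphabet and to the word length.\<close>

theorem bounded_power_series_limit: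
  fixes f :: "nat \<Rightarrow> ('i \<Rightarrow> real) \<Rightarrow> real"
  assumes S: "finite S" and R: "0 < R"
    and D: "\<And>x b. x \<in> D \<Longrightarrow> b \<in> S \<Longrightarrow> \<bar>x b\<bar> < R"
    and f: "\<And>n. bounded_power_series S R C D (f n)"
    and lim: "\<And>x. x \<in> D \<Longrightarrow> (\<lambda>n. f n x) \<longlonglongrightarrow> g x"
  shows "bounded_power_series S R C D g"
proof -
  define Q where "Q n c \<longleftrightarrow> (\<forall>\<alpha>\<in>multi_indices S. \<bar>c \<alpha>\<bar> \<le> C / R ^ sum \<alpha> S) \<and>
     (\<forall>x\<in>D. ((\<lambda>\<alpha>. c \<alpha> * (\<Prod>b\<in>S. x b ^ \<alpha> b)) has_sum f n x) (multi_indices S))" for n c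
  have "\<exists>c. Q n c" for n using f[of n] by (simp add: bounded_power_series_def Q_def)
  then obtain c where "\<And>n. Q n (c n)" by metis
  hence cb: "\<And>n \<alpha>. \<alpha> \<in> multi_indices S \<Longrightarrow> \<bar>c n \<alpha>\<bar> \<le> C / R ^ sum \<alpha> S"
    and c: "\<And>n x. x \<in> D \<Longrightarrow> ((\<lambda>\<alpha>. c n \<alpha> * (\<Prod>b\<in>S. x b ^ \<alpha> b)) has_sum f n x) (multi_indices S)"
    by (simp_all add: Q_def)
  \<comment> \<open>Multiplication with \<open>R ^ sum \<alpha> S\<close> gives all coefficients the
    common bound \<open>C\<close>, as the diagonal extraction requires.\<close>
  obtain k :: "nat \<Rightarrow> nat" where k: "strict_mono k"
    "\<And>\<alpha>. \<alpha> \<in> multi_indices S \<Longrightarrow> \<exists>l. (\<lambda>n. c (k n) \<alpha> * R ^ sum \<alpha> S) \<longlonglongrightarrow> l"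
  proof (rule function_convergent_subsequence[OF countable_multi_indices[OF S], of "\<lambda>n \<alpha>. c n \<alpha> * R ^ sum \<alpha> S" C])
    show "norm (c n \<alpha> * R ^ sum \<alpha> S) \<le> C" if "\<alpha> \<in> multi_indices S" for n \<alpha>
      using cb[OF that, of n] R by (simp add: abs_mult field_simps)
  qed auto
  then obtain l where l: "\<And>\<alpha>. \<alpha> \<in> multi_indices S \<Longrightarrow> (\<lambda>n. c (k n) \<alpha> * R ^ sum \<alpha> S) \<longlonglongrightarrow> l \<alpha>" by metis
  define c' where "c' \<alpha> = l \<alpha> / R ^ sum \<alpha> S" for \<alpha>
  have c': "(\<lambda>n. c (k n) \<alpha>) \<longlonglongrightarrow> c' \<alpha>" if "\<alpha> \<in> multi_indices S" for \<alpha>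
    using tendsto_divide[OF l[OF that] tendsto_const[of "R ^ sum \<alpha> S"]] R by (simp add: c'_def)
  show ?thesis
    unfolding bounded_power_series_def
  proof (intro exI[of _ c'] conjI ballI)
    fix \<alpha> assume \<alpha>: "\<alpha> \<in> multi_indices S"
    show "norm (c' \<alpha>) \<le> C / R ^ sum \<alpha> S"
      unfolding real_norm_def
      by (rule tendsto_upperbound[OF tendsto_rabs[OF c'[OF \<alpha>]]]) (use cb[OF \<alpha>] in auto)
  next
    fix x assume x: "x \<in> D"
    show "((\<lambda>\<alpha>. c' \<alpha> * (\<Prod>b\<in>S. x b ^ \<alpha> b)) has_sum g x) (multi_indices S)"
    proof (rule has_sum_dominated_limit)
      show "(\<lambda>n. c (k n) \<alpha> * (\<Prod>b\<in>S. x b ^ \<alpha> b)) \<longlonglongrightarrow> c' \<alpha> * (\<Prod>b\<in>S. x b ^ \<alpha> b)" if "\<alpha> \<in> multi_indices S" for \<alpha>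
        by (intro tendsto_intros c' that)
      show "\<bar>c (k n) \<alpha> * (\<Prod>b\<in>S. x b ^ \<alpha> b)\<bar> \<le> C * (\<Prod>b\<in>S. (\<bar>x b\<bar> / R) ^ \<alpha> b)" if "\<alpha> \<in> multi_indices S" for n \<alpha>
        using monomial_bound[OF S, of "c (k n) \<alpha>" C R \<alpha> x] cb[OF that, of "k n"] by simp
      show "(\<lambda>\<alpha>. C * (\<Prod>b\<in>S. (\<bar>x b\<bar> / R) ^ \<alpha> b)) summable_on multi_indices S"
        by (intro summable_on_cmult_right summable_on_multi_indices S) (use D[OF x] R in auto)
      show "((\<lambda>\<alpha>. c (k n) \<alpha> * (\<Prod>b\<in>S. x b ^ \<alpha> b)) has_sum f (k n) x) (multi_indices S)" for n by (rule c[OF x])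
      show "(\<lambda>n. f (k n) x) \<longlonglongrightarrow> g x"
        using LIMSEQ_subseq_LIMSEQ[OF lim[OF x] k(1)] by (simp add: o_def)
    qed
  qed
qed

section \<open>Distortion of univalent functions\<close>

text \<open>Otherwise the inverse of \<open>f\<close> maps the disc of radius 2 into the unit disc,
  and Cauchy's estimate gives it a derivative of modulus at most 1/2 at 0, where it must be
  1.\<close>

lemma univalent_omits_small_value:
  assumes hol: "f holomorphic_on ball 0 1" and inj: "inj_on f (ball 0 1)"
    and f0: "f 0 = 0" and f1: "deriv f 0 = 1"
  obtains b where "cmod b \<le> 2" "b \<notin> f ` ball 0 1"
proof (rule ccontr)
  assume "\<not> thesis"
  with that have sub: "cball 0 2 \<subseteq> f ` ball 0 1" by (force simp: subset_iff)
  obtain h where h: "h holomorphic_on (f ` ball 0 1)"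
     "\<And>z. z \<in> ball 0 1 \<Longrightarrow> deriv f z * deriv h (f z) = 1" "\<And>z. z \<in> ball 0 1 \<Longrightarrow> h (f z) = z"
    using holomorphic_has_inverse[OF hol open_ball inj] by blast
  have "cmod ((deriv ^^ 1) h 0 / fact 1) \<le> 1 / 2 ^ 1"
  proof (rule Cauchy_coefficient_bound)
    show "h holomorphic_on ball 0 2" by (rule holomorphic_on_subset[OF h(1)]) (use sub in auto)
    fix w :: complex assume "w \<in> ball 0 2"
    hence "w \<in> f ` ball 0 1" using sub by auto
    then obtain z where "z \<in> ball 0 1" "w = f z" by blast
    thus "cmod (h w) \<le> 1" using h(3)[of z] by (simp add: less_imp_le)
  qed auto
  moreover have "deriv h 0 = 1" using h(2)[of 0] f0 f1 by simp
  ultimately show False by simp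
qed

text \<open>If \<open>b\<close> is an omitted value of a normalised univalent function \<open>f\<close>, then a square root \<open>g\<close>
  of \<open>1 - f / b\<close> omits \<open>0\<close>, and by injectivity of \<open>f\<close> also \<open>-g 0\<close>, so that Schottky's theorem
  applies.\<close>

definition univalent_const :: real where
  "univalent_const = 2 * (1 + exp (pi * exp (pi * (2 + 2 * 1 + 12 * (2 / 3) / (1 - 2 / 3)))) ^ 2)"

lemma univalent_const_pos: "univalent_const > 0"
  unfolding univalent_const_def by (simp add: add_pos_nonneg)

lemma normalised_univalent_bound:
  assumes hol: "f holomorphic_on ball 0 1" and inj: "inj_on f (ball 0 1)"
    and f0: "f 0 = 0" and f1: "deriv f 0 = 1" and z: "cmod z \<le> 1 / 2"
  shows "cmod (f z) \<le> univalent_const"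
proof -
  obtain b where b: "cmod b \<le> 2" "b \<notin> f ` ball 0 1"
    by (rule univalent_omits_small_value[OF hol inj f0 f1])
  have "0 \<in> f ` ball 0 1" by (rule image_eqI[of _ _ 0]) (use f0 in auto)
  hence bnz: "b \<noteq> 0" using b(2) by metis
  obtain g where g: "g holomorphic_on ball 0 1" "\<And>w. w \<in> ball 0 1 \<Longrightarrow> 1 - f w / b = g w ^ 2"
  proof (rule contractible_imp_holomorphic_sqrt[of "\<lambda>w. 1 - f w / b" "ball 0 1"])
    show "1 - f w / b \<noteq> 0" if "w \<in> ball 0 1" for w using b(2) bnz that by auto
  qed (auto simp: convex_imp_contractible intro!: holomorphic_intros hol bnz)
  have g02: "g 0 ^ 2 = 1" using g(2)[of 0] f0 by simp
  hence g0: "g 0 \<noteq> 0" "cmod (g 0) = 1" by (auto simp: power2_eq_1_iff)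
  \<comment> \<open>\<open>H\<close> turns the omitted values 0 and \<open>- g 0\<close> of
    \<open>g\<close> into 0 and 1. The factor 3/4 makes it holomorphic on the closed unit disc and
    moves the radius 1/2 to 2/3, the number in \<open>univalent_const\<close>.\<close>
  define H where "H w = - g (3 / 4 * w) / g 0" for w
  have in_ball: "3 / 4 * w \<in> ball 0 1" if "w \<in> cball 0 1" for w :: complex using that by (simp add: norm_mult)
  define w where "w = 4 / 3 * z"
  have "cmod (H w) \<le> exp (pi * exp (pi * (2 + 2 * 1 + 12 * (2 / 3) / (1 - 2 / 3))))"
  proof (rule Schottky[where f = H and z = w and r = 1 and t = "2 / 3"])
    show "H holomorphic_on cball 0 1"
    proof -
      have "(g \<circ> (\<lambda>w. 3 / 4 * w)) holomorphic_on cball 0 1"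
        by (rule holomorphic_on_compose_gen[OF _ g(1)]) (use in_ball in \<open>auto intro!: holomorphic_intros\<close>)
      thus ?thesis unfolding H_def o_def by (intro holomorphic_intros g0)
    qed
    show "cmod (H 0) \<le> 1" using g0 by (simp add: H_def norm_divide)
    show "\<not> (H w = 0 \<or> H w = 1)" if w: "w \<in> cball 0 1" for w
    proof
      assume "H w = 0 \<or> H w = 1"
      thus False
      proof
        assume "H w = 0"
        hence "g (3 / 4 * w) = 0" using g0 by (simp add: H_def)
        hence "f (3 / 4 * w) = b" using g(2)[OF in_ball[OF w]] bnz by (simp add: field_simps)
        thus False using b(2) in_ball[OF w] by blast
      next
        assume "H w = 1"
        hence gw: "g (3 / 4 * w) = - g 0" using g0 by (simp add: H_def field_simps minus_equation_iff)
        hence "1 - f (3 / 4 * w) / b = 1" using g(2)[OF in_ball[OF w]] g02 by simp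
        hence "f (3 / 4 * w) = f 0" using bnz f0 by simp
        hence "3 / 4 * w = 0" using inj_onD[OF inj _ in_ball[OF w], of 0] by simp
        thus False using gw g0 by simp
      qed
    qed
    show "cmod w \<le> 2 / 3" using z by (simp add: w_def norm_mult)
  qed auto
  moreover have "H w = - g z / g 0" by (simp add: H_def w_def)
  ultimately have gz: "cmod (g z) \<le> exp (pi * exp (pi * (2 + 2 * 1 + 12 * (2 / 3) / (1 - 2 / 3))))"
    using g0 by (simp add: norm_divide)
  have "f z = b * (1 - g z ^ 2)" using g(2)[of z] z bnz by (simp add: field_simps)
  hence "cmod (f z) \<le> 2 * (cmod 1 + cmod (g z ^ 2))"
    unfolding \<open>f z = _\<close> norm_mult by (intro mult_mono norm_triangle_ineq4 b) auto
  also have "\<dots> \<le> univalent_const"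
    unfolding univalent_const_def norm_power norm_one by (intro mult_left_mono add_mono power_mono gz) auto
  finally show ?thesis .
qed

lemma normalised_univalent_deriv:
  assumes hol: "f holomorphic_on ball 0 1" and inj: "inj_on f (ball 0 1)"
    and f0: "f 0 = 0" and f1: "deriv f 0 = 1" and z: "cmod z \<le> 1 / 8"
  shows "cmod (deriv f z - 1) \<le> 64 * univalent_const * cmod z"
    and "cmod (f z) \<le> 64 * univalent_const * cmod z"
proof -
  \<comment> \<open>Room for Cauchy's estimate: 3/8 + 1/8 = 1/2. The remainder bound on radius 3/8
    then gives the constant 2 * 8 * 8 / 3, rounded up to 64.\<close>
  have d: "cmod (deriv f w) \<le> 8 * univalent_const" if "w \<in> ball 0 (3/8)" for w
  proof -
    have sub: "cball w (1 / 8) \<subseteq> cball 0 (1 / 2)"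
    proof
      fix x assume "x \<in> cball w (1 / 8)"
      thus "x \<in> cball 0 (1 / 2)" using that norm_triangle_ineq2[of x w] by (simp add: dist_norm norm_minus_commute)
    qed
    moreover have "cball 0 (1 / 2) \<subseteq> ball (0::complex) 1" by auto
    ultimately have sub': "cball w (1 / 8) \<subseteq> ball 0 1" by (rule subset_trans)
    have "cmod ((deriv ^^ 1) f w) \<le> fact 1 * univalent_const / (1 / 8) ^ 1"
    proof (rule Cauchy_inequality)
      show "f holomorphic_on ball w (1 / 8)"
        by (rule holomorphic_on_subset[OF hol subset_trans[OF ball_subset_cball sub']])
      show "continuous_on (cball w (1 / 8)) f"
        by (rule holomorphic_on_imp_continuous_on, rule holomorphic_on_subset[OF hol sub'])
      show "cmod (f x) \<le> univalent_const" if "cmod (w - x) = 1 / 8" for x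
      proof (rule normalised_univalent_bound[OF hol inj f0 f1])
        have "x \<in> cball w (1 / 8)" using that by (simp add: dist_norm)
        thus "cmod x \<le> 1 / 2" using sub by auto
      qed
    qed auto
    thus ?thesis by simp
  qed
  have hold: "deriv f holomorphic_on ball 0 (3/8)"
    by (rule holomorphic_on_subset[OF holomorphic_deriv[OF hol open_ball]]) auto
  have "cmod (deriv f z - (\<Sum>l<1. (deriv ^^ l) (deriv f) 0 / fact l * z ^ l)) \<le> 2 * (8 * univalent_const) * (cmod z / (3/8)) ^ 1"
    by (rule power_series_remainder_bound[OF hold _ d]) (use z in auto)
  also have "\<dots> \<le> 64 * univalent_const * cmod z" using univalent_const_pos by (simp add: mult_right_mono)
  finally show "cmod (deriv f z - 1) \<le> 64 * univalent_const * cmod z" using f1 by simp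
  have "cmod (f z - f 0) \<le> (8 * univalent_const) * cmod (z - 0)"
  proof (rule field_differentiable_bound[of "ball 0 (3/8)" f "deriv f"])
    fix w :: complex assume w: "w \<in> ball 0 (3/8)"
    have "(f has_field_derivative deriv f w) (at w)"
      by (rule holomorphic_derivI[OF hol open_ball]) (use w in auto)
    thus "(f has_field_derivative deriv f w) (at w within ball 0 (3/8))" by (rule has_field_derivative_at_within)
  qed (use z d in auto)
  also have "\<dots> \<le> 64 * univalent_const * cmod z" using univalent_const_pos by (simp add: mult_right_mono)
  finally show "cmod (f z) \<le> 64 * univalent_const * cmod z" using f0 by simp
qed

text \<open>Rescaling the disc and dividing by \<open>\<rho>\<close> and \<open>deriv f a\<close>
  reduces to the normalised case: Koebe distortion with a crude constant.\<close>

lemma univalent_distortion_ball: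
  assumes \<rho>: "0 < \<rho>" and hol: "f holomorphic_on ball a \<rho>" and inj: "inj_on f (ball a \<rho>)"
    and x: "cmod (x - a) \<le> \<rho> / 8"
  shows "cmod (deriv f x - deriv f a) \<le> 64 * univalent_const / \<rho> * cmod (x - a) * cmod (deriv f a)"
    and "cmod (f x - f a) \<le> 64 * univalent_const * cmod (x - a) * cmod (deriv f a)"
    and "deriv f a \<noteq> 0"
proof -
  show da: "deriv f a \<noteq> 0" by (rule holomorphic_injective_imp_regular[OF hol open_ball inj]) (use \<rho> in auto)
  define l where "l w = a + of_real \<rho> * w" for w
  have l: "l w \<in> ball a \<rho>" if "w \<in> ball 0 1" for w
    using that \<rho> by (simp add: l_def dist_norm norm_mult)
  define F where "F w = (f (l w) - f a) / (of_real \<rho> * deriv f a)" for w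
  have dF: "(F has_field_derivative deriv f (l w) / deriv f a) (at w)" if "w \<in> ball 0 1" for w
  proof -
    have "((\<lambda>w. f (l w)) has_field_derivative deriv f (l w) * \<rho>) (at w)"
      by (rule DERIV_chain2[where f = f and g = l, OF holomorphic_derivI[OF hol open_ball l[OF that]]])
         (auto simp: l_def[abs_def] intro!: derivative_eq_intros)
    hence "(F has_field_derivative (deriv f (l w) * \<rho> - 0) / (of_real \<rho> * deriv f a)) (at w)"
      unfolding F_def[abs_def] by (intro DERIV_cdivide DERIV_diff DERIV_const)
    thus ?thesis using \<rho> by simp
  qed
  have holF: "F holomorphic_on ball 0 1"
    using dF by (meson holomorphic_onI field_differentiable_at_within field_differentiable_def)
  have injF: "inj_on F (ball 0 1)"
  proof (rule inj_onI)
    fix u v assume uv: "u \<in> ball 0 1" "v \<in> ball 0 1" "F u = F v"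
    hence "f (l u) = f (l v)" using da \<rho> by (simp add: F_def)
    hence "l u = l v" using inj_onD[OF inj] l uv by blast
    thus "u = v" using \<rho> by (simp add: l_def)
  qed
  have F0: "F 0 = 0" "deriv F 0 = 1" using DERIV_imp_deriv[OF dF[of 0]] da by (simp_all add: F_def l_def)
  define z where "z = (x - a) / of_real \<rho>"
  have z: "cmod z \<le> 1 / 8" "l z = x" "cmod z = cmod (x - a) / \<rho>"
    using x \<rho> by (simp_all add: z_def l_def norm_divide field_simps)
  have 1: "deriv F z = deriv f x / deriv f a" using DERIV_imp_deriv[OF dF[of z]] z by auto
  have "deriv f x - deriv f a = (deriv F z - 1) * deriv f a" unfolding 1 using da by (simp add: field_simps)
  moreover have "cmod (deriv F z - 1) * cmod (deriv f a) \<le> 64 * univalent_const * cmod z * cmod (deriv f a)"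
    by (rule mult_right_mono[OF normalised_univalent_deriv(1)[OF holF injF F0 z(1)]]) simp
  ultimately show "cmod (deriv f x - deriv f a) \<le> 64 * univalent_const / \<rho> * cmod (x - a) * cmod (deriv f a)"
    by (simp add: norm_mult z(3))
  have "f x - f a = F z * (of_real \<rho> * deriv f a)" using da \<rho> by (simp add: F_def z)
  moreover have "cmod (F z) \<le> 64 * univalent_const * cmod z"
    by (rule normalised_univalent_deriv(2)[OF holF injF F0 z(1)])
  ultimately have "cmod (f x - f a) \<le> 64 * univalent_const * cmod z * (\<rho> * cmod (deriv f a))"
    using \<rho> by (simp add: norm_mult mult_right_mono)
  thus "cmod (f x - f a) \<le> 64 * univalent_const * cmod (x - a) * cmod (deriv f a)"
    using \<rho> by (simp add: z(3))
qed

definition univalent_on :: "(complex \<Rightarrow> complex) \<Rightarrow> complex set \<Rightarrow> bool" where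
  "univalent_on f V \<longleftrightarrow> f holomorphic_on V \<and> inj_on f V"

text \<open>\<open>K\<close> depends on \<open>X\<close> and \<open>V\<close> only, so it serves all
  letters, words and parameters at once. On small discs this is Koebe distortion. Such comparisons
  compose, so comparability with some constant is an equivalence relation on \<open>X\<close> with
  relatively open classes; connectedness leaves one class, and compactness makes the constant
  uniform.\<close>

theorem univalent_distortion:
  assumes X: "compact X" "connected X" and V: "open V" "X \<subseteq> V"
  obtains K where "K \<ge> 1"
    "\<And>f x y. univalent_on f V \<Longrightarrow> x \<in> X \<Longrightarrow> y \<in> X \<Longrightarrow> cmod (deriv f x) \<le> K * cmod (deriv f y)"
    "\<And>f x y z. univalent_on f V \<Longrightarrow> x \<in> X \<Longrightarrow> y \<in> X \<Longrightarrow> z \<in> X \<Longrightarrow> cmod (f x - f y) \<le> K * cmod (deriv f z)"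
    "\<And>f x y. univalent_on f V \<Longrightarrow> x \<in> X \<Longrightarrow> y \<in> X \<Longrightarrow>
       cmod (deriv f x - deriv f y) \<le> K * cmod (x - y) * cmod (deriv f y)"
proof (cases "X = {}")
  case True
  thus ?thesis using that[of 1] by auto
next
  case False
  then obtain x0 where x0: "x0 \<in> X" by blast
  obtain \<rho> where \<rho>: "\<rho> > 0" "\<And>x. x \<in> X \<Longrightarrow> ball x \<rho> \<subseteq> V"
  proof -
    obtain e where "e > 0" "(\<Union>x\<in>X. cball x e) \<subseteq> V"
      using compact_subset_open_imp_cball_epsilon_subset[OF X(1) V] .
    thus ?thesis by (intro that[of e]) (force simp: subset_iff)+
  qed
  define c where "c = 64 * univalent_const"
  have c: "c > 0" using univalent_const_pos by (simp add: c_def)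
  have local: "cmod (deriv f x - deriv f a) \<le> c / \<rho> * cmod (x - a) * cmod (deriv f a)"
     "cmod (f x - f a) \<le> c * cmod (x - a) * cmod (deriv f a)"
    if "univalent_on f V" "a \<in> X" "cmod (x - a) \<le> \<rho> / 8" for f a x
  proof -
    have "f holomorphic_on ball a \<rho>" "inj_on f (ball a \<rho>)"
      using that(1) \<rho>(2)[OF that(2)] unfolding univalent_on_def
      by (auto intro: holomorphic_on_subset inj_on_subset)
    from univalent_distortion_ball[OF \<rho>(1) this that(3)]
    show "cmod (deriv f x - deriv f a) \<le> c / \<rho> * cmod (x - a) * cmod (deriv f a)"
     "cmod (f x - f a) \<le> c * cmod (x - a) * cmod (deriv f a)" by (auto simp: c_def)
  qed
  \<comment> \<open>Values and derivatives are estimated together because a bound by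
    \<open>deriv f y\<close> can be passed on to \<open>z\<close> only through the
    derivatives.\<close>
  define E where "E K x y \<longleftrightarrow> K \<ge> 0 \<and>
     (\<forall>f. univalent_on f V \<longrightarrow> cmod (f x - f y) + cmod (deriv f x) \<le> K * cmod (deriv f y))" for K x y
  have E_mono: "E L x y" if "E K x y" "K \<le> L" for K L x y
    using that unfolding E_def by (meson dual_order.trans mult_right_mono norm_ge_zero)
  have E_trans: "E (K * L + L) x z" if xy: "E K x y" and yz: "E L y z" for K L x y z
    unfolding E_def
  proof (intro conjI allI impI)
    have K: "K \<ge> 0" "L \<ge> 0" using xy yz by (auto simp: E_def)
    thus "K * L + L \<ge> 0" by simp
    fix f assume f: "univalent_on f V"
    have 1: "cmod (f x - f y) + cmod (deriv f x) \<le> K * cmod (deriv f y)"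
      and 2: "cmod (f y - f z) + cmod (deriv f y) \<le> L * cmod (deriv f z)"
      using xy yz f by (auto simp: E_def)
    have "cmod (deriv f y) \<le> L * cmod (deriv f z)" using 2 norm_ge_zero[of "f y - f z"] by linarith
    hence "K * cmod (deriv f y) \<le> K * (L * cmod (deriv f z))" using K by (intro mult_left_mono)
    moreover have "cmod (f x - f z) \<le> cmod (f x - f y) + cmod (f y - f z)"
      by (metis diff_add_cancel add_diff_eq norm_triangle_ineq)
    ultimately have "cmod (f x - f z) + cmod (deriv f x) \<le> K * (L * cmod (deriv f z)) + L * cmod (deriv f z)"
      using 1 2 norm_ge_zero[of "deriv f y"] by linarith
    thus "cmod (f x - f z) + cmod (deriv f x) \<le> (K * L + L) * cmod (deriv f z)" by (simp add: distrib_right mult.assoc)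
  qed
  define k where "k = 1 + c / 8 + c * \<rho>"
  have E_local: "E k x y" if xy: "y \<in> X" "cmod (x - y) \<le> \<rho> / 8" for x y
    unfolding E_def
  proof (intro conjI allI impI)
    show "k \<ge> 0" using c \<rho> by (simp add: k_def)
    fix f assume f: "univalent_on f V"
    have "cmod (deriv f x) \<le> cmod (deriv f x - deriv f y) + cmod (deriv f y)"
      by (metis diff_add_cancel norm_triangle_ineq)
    also have "cmod (deriv f x - deriv f y) \<le> c / \<rho> * (\<rho> / 8) * cmod (deriv f y)"
      by (rule order_trans[OF local(1)[OF f xy]], intro mult_right_mono mult_left_mono xy) (use c \<rho> in auto)
    also have "c / \<rho> * (\<rho> / 8) = c / 8" using \<rho>(1) by simp
    finally have 1: "cmod (deriv f x) \<le> c / 8 * cmod (deriv f y) + cmod (deriv f y)" by simp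
    have "cmod (f x - f y) \<le> c * \<rho> * cmod (deriv f y)"
      by (rule order_trans[OF local(2)[OF f xy]], intro mult_right_mono mult_left_mono) (use c \<rho>(1) xy(2) in auto)
    with 1 show "cmod (f x - f y) + cmod (deriv f x) \<le> k * cmod (deriv f y)" by (simp add: k_def algebra_simps)
  qed
  have "\<exists>K. E K x0 y \<and> E K y x0" if "y \<in> X" for y
  proof -
    have "(\<exists>K. E K x0 y) \<and> (\<exists>K. E K y x0)"
    proof (rule connected_equivalence_relation[OF X(2) x0 that, of "\<lambda>x y. (\<exists>K. E K x y) \<and> (\<exists>K. E K y x)"])
      fix a assume a: "a \<in> X"
      have loc: "E k a x \<and> E k x a" if "x \<in> X \<inter> ball a (\<rho> / 8)" for x
        using E_local[OF a, of x] E_local[of x a] that by (auto simp: dist_norm norm_minus_commute)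
      thus "\<exists>T. openin (top_of_set X) T \<and> a \<in> T \<and> (\<forall>x\<in>T. (\<exists>K. E K a x) \<and> (\<exists>K. E K x a))"
        by (intro exI[of _ "X \<inter> ball a (\<rho> / 8)"] conjI ballI) (use a \<rho>(1) loc in \<open>auto simp: openin_open_Int\<close>)
    qed (use E_trans in blast)+
    then obtain K L where "E K x0 y" "E L y x0" by blast
    hence "E (max K L) x0 y" "E (max K L) y x0" by (auto intro: E_mono)
    thus ?thesis by blast
  qed
  then obtain k' where k': "\<And>y. y \<in> X \<Longrightarrow> E (k' y) x0 y \<and> E (k' y) y x0" by metis
  obtain T where T: "T \<subseteq> X" "finite T" "X \<subseteq> (\<Union>y\<in>T. ball y (\<rho> / 8))"
  proof (rule compactE_image[OF X(1), of X "\<lambda>y. ball y (\<rho> / 8)"])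
    show "X \<subseteq> (\<Union>y\<in>X. ball y (\<rho> / 8))" using \<rho>(1) by force
  qed auto
  define M where "M = (\<Sum>y\<in>T. k' y)"
  have k'0: "k' y \<ge> 0" if "y \<in> T" for y using k' T that by (auto simp: E_def subset_iff)
  define K1 where "K1 = (M * k + k) + (k * M + M)"
  have E1: "E K1 x0 y \<and> E K1 y x0" if y: "y \<in> X" for y
  proof -
    obtain u where u: "u \<in> T" "y \<in> ball u (\<rho> / 8)" using T y by blast
    have "k' u \<le> M" unfolding M_def using u T k'0 by (intro member_le_sum) auto
    hence EM: "E M x0 u" "E M u x0" using k'[of u] u T E_mono by blast+
    have Ek: "E k u y" "E k y u"
      using E_local[of y u] E_local[of u y] u T y by (auto simp: dist_norm norm_minus_commute)
    have "M \<ge> 0" "k \<ge> 0" using EM Ek by (auto simp: E_def)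
    hence "M * k + k \<le> K1" "k * M + M \<le> K1" by (auto simp: K1_def)
    thus ?thesis using E_trans[OF EM(1) Ek(1)] E_trans[OF Ek(2) EM(2)] by (auto intro: E_mono)
  qed
  define K2 where "K2 = K1 * K1 + K1"
  have E2: "E K2 x y" if "x \<in> X" "y \<in> X" for x y unfolding K2_def using E_trans E1 that by blast
  have K2: "K2 \<ge> 0" using E2[OF x0 x0] by (simp add: E_def)
  have E2': "cmod (deriv f x) \<le> K2 * cmod (deriv f y)" "cmod (f x - f y) \<le> K2 * cmod (deriv f y)"
    if "univalent_on f V" "x \<in> X" "y \<in> X" for f x y
    using E2[OF that(2,3)] that(1) norm_ge_zero[of "f x - f y"] norm_ge_zero[of "deriv f x"]
    unfolding E_def by (smt (verit))+
  \<comment> \<open>The last two summands are for the Lipschitz bound: Koebe distortion for close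
    points, and mere boundedness of the derivatives when
    \<open>cmod (x - y) > \<rho> / 8\<close>.\<close>
  define K where "K = 1 + K2 + K2 * K2 + c / \<rho> + (K2 + 1) * 8 / \<rho>"
  have KK: "K2 \<le> K" "K2 * K2 \<le> K" "c / \<rho> \<le> K" "(K2 + 1) * 8 / \<rho> \<le> K" "K \<ge> 1"
    using K2 c \<rho> by (simp_all add: K_def)
  show ?thesis
  proof (rule that[OF KK(5)])
    fix f x y assume f: "univalent_on f V" and xy: "x \<in> X" "y \<in> X"
    show "cmod (deriv f x) \<le> K * cmod (deriv f y)"
      using E2'(1)[OF f xy] mult_right_mono[OF KK(1)] by (rule order_trans) simp
    show "cmod (f x - f y) \<le> K * cmod (deriv f z)" if z: "z \<in> X" for z
    proof -
      have "cmod (f x - f y) \<le> K2 * (K2 * cmod (deriv f z))"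
        using E2'(2)[OF f xy] mult_left_mono[OF E2'(1)[OF f xy(2) z] K2] by (rule order_trans)
      also have "\<dots> \<le> K * cmod (deriv f z)" using mult_right_mono[OF KK(2), of "cmod (deriv f z)"] by simp
      finally show ?thesis .
    qed
    show "cmod (deriv f x - deriv f y) \<le> K * cmod (x - y) * cmod (deriv f y)"
    proof (cases "cmod (x - y) \<le> \<rho> / 8")
      case True
      have "cmod (deriv f x - deriv f y) \<le> c / \<rho> * cmod (x - y) * cmod (deriv f y)" by (rule local(1)[OF f xy(2) True])
      also have "\<dots> \<le> K * cmod (x - y) * cmod (deriv f y)" by (intro mult_right_mono KK) auto
      finally show ?thesis .
    next
      case False
      have "cmod (deriv f x - deriv f y) \<le> cmod (deriv f x) + cmod (deriv f y)" by (rule norm_triangle_ineq4)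
      also have "\<dots> \<le> K2 * cmod (deriv f y) + cmod (deriv f y)" using E2'(1)[OF f xy] by simp
      also have "\<dots> = (K2 + 1) * 8 / \<rho> * (\<rho> / 8) * cmod (deriv f y)" using \<rho>(1) by (simp add: field_simps)
      also have "\<dots> \<le> K * cmod (x - y) * cmod (deriv f y)"
        using False K2 \<rho>(1) order_trans[OF zero_le_one KK(5)] by (intro mult_right_mono mult_mono KK) auto
      finally show ?thesis .
    qed
  qed
qed

section \<open>Iterated function systems of univalent maps\<close>

lemma islimpt_regular_closed:
  assumes "X = closure (interior X)" "x \<in> X"
  shows "x islimpt (X :: complex set)"
proof (cases "x \<in> interior X")
  case False
  hence "x islimpt interior X" using assms by (metis UnE closure_def mem_Collect_eq)
  thus ?thesis by (rule islimpt_subset) (rule interior_subset)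
qed (rule interior_limit_point)

lemma has_field_derivative_within_unique:
  assumes "(f has_field_derivative D) (at x within S)" "(f has_field_derivative E) (at x within S)"
    and "x islimpt S"
  shows "D = E"
  using assms unfolding has_field_derivative_iff
  by (metis tendsto_unique trivial_limit_within)

text \<open>\<open>deriv_within\<close> is a definite description. In a regular closed set every
  point is a limit point, so the derivative within \<open>X\<close> is unique even on the
  boundary.\<close>

lemma deriv_within_eq:
  assumes X: "X = closure (interior X)" "x \<in> X" and V: "open V" "X \<subseteq> V"
    and g: "g holomorphic_on V" and eq: "\<And>y. y \<in> X \<Longrightarrow> f y = g y"
  shows "(f has_field_derivative deriv g x) (at x within X)" "deriv_within X f x = deriv g x"
proof -
  have "(g has_field_derivative deriv g x) (at x within X)"
    using holomorphic_derivI[OF g V(1)] X V by (blast intro: has_field_derivative_at_within)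
  thus 1: "(f has_field_derivative deriv g x) (at x within X)"
    by (rule has_field_derivative_transform_within[OF _ zero_less_one X(2)]) (simp add: eq)
  show "deriv_within X f x = deriv g x"
    unfolding deriv_within_def
    using 1 by (rule the_equality) (rule has_field_derivative_within_unique[OF _ 1 islimpt_regular_closed[OF X]])
qed

lemma norm_derivative_le_Lipschitz:
  assumes f: "(f has_field_derivative D) (at x within S)" and x: "x islimpt S" "x \<in> S"
    and lip: "\<And>y. y \<in> S \<Longrightarrow> cmod (f y - f x) \<le> L * cmod (y - x)"
  shows "cmod D \<le> L"
proof (rule tendsto_upperbound)
  show "((\<lambda>y. cmod ((f y - f x) / (y - x))) \<longlongrightarrow> cmod D) (at x within S)"
    using f unfolding has_field_derivative_iff by (rule tendsto_norm)
  have "eventually (\<lambda>y. y \<in> S \<and> y \<noteq> x) (at x within S)"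
    by (simp add: eventually_at_filter)
  thus "eventually (\<lambda>y. cmod ((f y - f x) / (y - x)) \<le> L) (at x within S)"
    by eventually_elim (use lip in \<open>auto simp: norm_divide divide_le_eq\<close>)
qed (use x in \<open>simp add: trivial_limit_within\<close>)

lemma word_map_Nil [simp]: "word_map \<phi> [] = id"
  by (simp add: word_map_def)

lemma word_map_Cons [simp]: "word_map \<phi> (i # w) = \<phi> i \<circ> word_map \<phi> w"
  by (simp add: word_map_def)

lemma word_map_append: "word_map \<phi> (v @ w) = word_map \<phi> v \<circ> word_map \<phi> w"
  by (induction v) (simp_all add: o_assoc)

lemma shift_case_nat [simp]: "shift (i ## \<omega>) = \<omega>"
  by (simp add: shift_def)

definition words :: "nat set \<Rightarrow> nat \<Rightarrow> nat list set" where
  "words E n = {w. length w = n \<and> set w \<subseteq> E}"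

lemma finite_words: "finite E \<Longrightarrow> finite (words E n)"
  using finite_lists_length_eq[of E n] by (simp add: words_def conj_commute)

lemma words_0 [simp]: "words E 0 = {[]}"
  by (auto simp: words_def)

lemma bij_betw_words_snoc:
  "bij_betw (\<lambda>(i, w). w @ [i]) (E \<times> words E n) (words E (Suc n))"
proof (rule bij_betw_byWitness[where f' = "\<lambda>w. (last w, butlast w)"])
  show "\<forall>w\<in>words E (Suc n). (\<lambda>(i, w). w @ [i]) (last w, butlast w) = w"
    by (auto simp: words_def length_Suc_conv)
  show "(\<lambda>w. (last w, butlast w)) ` words E (Suc n) \<subseteq> E \<times> words E n"
  proof
    fix p assume "p \<in> (\<lambda>w. (last w, butlast w)) ` words E (Suc n)"
    then obtain w where w: "length w = Suc n" "set w \<subseteq> E" "p = (last w, butlast w)" by (auto simp: words_def)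
    have "w \<noteq> []" using w by auto
    thus "p \<in> E \<times> words E n" using w last_in_set[of w] in_set_butlastD[of _ w] by (auto simp: words_def)
  qed
qed (auto simp: words_def)

text \<open>\<open>\<phi>\<close> carries the pressure and the coding, \<open>\<psi>\<close> the
  derivatives. In the local families below \<open>V\<close> is shared by all parameters, while
  \<open>s\<close> is not.\<close>

locale univalent_ifs =
  fixes X V :: "complex set" and \<phi> \<psi> :: "nat \<Rightarrow> complex \<Rightarrow> complex" and s :: real
  assumes X: "compact X" "connected X" "X = closure (interior X)" "X \<noteq> {}"
    and V: "open V" "X \<subseteq> V"
    and maps_X: "\<And>i x. x \<in> X \<Longrightarrow> \<phi> i x \<in> X"
    and s: "0 < s" "s < 1"
    and contraction: "\<And>i x y. x \<in> X \<Longrightarrow> y \<in> X \<Longrightarrow> cmod (\<phi> i x - \<phi> i y) \<le> s * cmod (x - y)"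
    and univalent: "\<And>i. univalent_on (\<psi> i) V" and maps_V: "\<And>i x. x \<in> V \<Longrightarrow> \<psi> i x \<in> V"
    and extends: "\<And>i x. x \<in> X \<Longrightarrow> \<psi> i x = \<phi> i x"
begin

abbreviation "\<pi> \<equiv> coding_map X \<phi>"
abbreviation "dn w x \<equiv> cmod (deriv (word_map \<psi> w) x)"

lemma word_in_X: "x \<in> X \<Longrightarrow> word_map \<phi> w x \<in> X"
  by (induction w) (simp_all add: maps_X)

lemma word_in_V: "x \<in> V \<Longrightarrow> word_map \<psi> w x \<in> V"
  by (induction w) (simp_all add: maps_V)

lemma word_extends: "x \<in> X \<Longrightarrow> word_map \<psi> w x = word_map \<phi> w x"
  by (induction w) (simp_all add: extends word_in_X)

lemma univalent_word: "univalent_on (word_map \<psi> w) V"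
proof (induction w)
  case (Cons i w)
  have "word_map \<psi> w ` V \<subseteq> V" using word_in_V by auto
  thus ?case using Cons univalent[of i] unfolding univalent_on_def
    by (auto intro!: holomorphic_on_compose_gen comp_inj_on intro: inj_on_subset)
qed (simp add: univalent_on_def holomorphic_on_id[unfolded id_def] id_def)

lemma holomorphic_word: "word_map \<psi> w holomorphic_on V"
  using univalent_word by (simp add: univalent_on_def)

lemma deriv_word_nonzero: "x \<in> V \<Longrightarrow> deriv (word_map \<psi> w) x \<noteq> 0"
  using holomorphic_injective_imp_regular[OF holomorphic_word V(1)] univalent_word
  by (auto simp: univalent_on_def)

lemma deriv_word_append:
  assumes "x \<in> V"
  shows "deriv (word_map \<psi> (v @ w)) x = deriv (word_map \<psi> v) (word_map \<psi> w x) * deriv (word_map \<psi> w) x"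
proof -
  have "((word_map \<psi> v \<circ> word_map \<psi> w) has_field_derivative
      deriv (word_map \<psi> v) (word_map \<psi> w x) * deriv (word_map \<psi> w) x) (at x)"
    by (intro DERIV_chain holomorphic_derivI[OF holomorphic_word V(1)] word_in_V assms)
  thus ?thesis by (simp add: word_map_append DERIV_imp_deriv)
qed

lemma word_Lipschitz:
  "x \<in> X \<Longrightarrow> y \<in> X \<Longrightarrow> cmod (word_map \<phi> w x - word_map \<phi> w y) \<le> s ^ length w * cmod (x - y)"
proof (induction w)
  case (Cons i w)
  have "cmod (word_map \<phi> (i # w) x - word_map \<phi> (i # w) y) \<le> s * cmod (word_map \<phi> w x - word_map \<phi> w y)"
    using Cons.prems by (simp add: contraction word_in_X)
  also have "\<dots> \<le> s * (s ^ length w * cmod (x - y))" using Cons s by (intro mult_left_mono) auto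
  finally show ?case by (simp add: mult_ac)
qed simp

lemma deriv_within_word: "x \<in> X \<Longrightarrow> deriv_within X (word_map \<phi> w) x = deriv (word_map \<psi> w) x"
  by (rule deriv_within_eq[OF X(3) _ V holomorphic_word]) (simp_all add: word_extends)

lemma deriv_within_letter: "x \<in> X \<Longrightarrow> deriv_within X (\<phi> i) x = deriv (\<psi> i) x"
  using deriv_within_word[of x "[i]"] by simp

lemma deriv_word_le: "x \<in> X \<Longrightarrow> dn w x \<le> s ^ length w"
  by (rule norm_derivative_le_Lipschitz[OF deriv_within_eq(1)[OF X(3) _ V holomorphic_word]])
     (use islimpt_regular_closed[OF X(3)] in \<open>auto simp: word_extends[symmetric] intro!: order_trans[OF _ word_Lipschitz]\<close>)

lemma diameter_bound: obtains D where "D \<ge> 0" "\<And>x y. x \<in> X \<Longrightarrow> y \<in> X \<Longrightarrow> cmod (x - y) \<le> D"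
  by (rule that[of "diameter X"])
     (use diameter_bounded_bound[OF compact_imp_bounded[OF X(1)]] diameter_ge_0[OF compact_imp_bounded[OF X(1)]]
      in \<open>auto simp: dist_norm\<close>)

lemma word_map_prefix_Suc:
  "word_map \<phi> (map \<omega> [0..<Suc n]) ` X \<subseteq> word_map \<phi> (map \<omega> [0..<n]) ` X"
  using maps_X by (auto simp: word_map_append)

lemma coding_unique:
  assumes "\<And>n. x \<in> word_map \<phi> (map \<omega> [0..<n]) ` X" "\<And>n. y \<in> word_map \<phi> (map \<omega> [0..<n]) ` X"
  shows "x = y"
proof -
  obtain D where D: "D \<ge> 0" "\<And>x y. x \<in> X \<Longrightarrow> y \<in> X \<Longrightarrow> cmod (x - y) \<le> D" using diameter_bound by blast
  have "cmod (x - y) \<le> s ^ n * D" for n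
  proof -
    obtain u v where uv: "u \<in> X" "v \<in> X" "x = word_map \<phi> (map \<omega> [0..<n]) u" "y = word_map \<phi> (map \<omega> [0..<n]) v"
      using assms[of n] by blast
    have "cmod (x - y) \<le> s ^ n * cmod (u - v)" using word_Lipschitz[OF uv(1,2), of "map \<omega> [0..<n]"] uv by simp
    also have "\<dots> \<le> s ^ n * D" using D uv s by (intro mult_left_mono) auto
    finally show ?thesis .
  qed
  moreover have "(\<lambda>n. s ^ n * D) \<longlonglongrightarrow> 0" using s by (intro tendsto_mult_left_zero LIMSEQ_power_zero) auto
  ultimately have "cmod (x - y) \<le> 0" by (intro tendsto_lowerbound[of "\<lambda>n. s ^ n * D"]) auto
  thus ?thesis by simp
qed

lemma coding_in_cylinder: "\<pi> \<omega> \<in> word_map \<phi> (map \<omega> [0..<n]) ` X"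
proof -
  let ?K = "\<lambda>n. word_map \<phi> (map \<omega> [0..<n]) ` X"
  have "\<Inter> (range ?K) \<noteq> {}"
  proof (rule compact_nest)
    show "compact (?K n)" for n
    proof (rule compact_continuous_image[OF _ X(1)])
      have "continuous_on X (word_map \<psi> (map \<omega> [0..<n]))"
        using holomorphic_on_imp_continuous_on[OF holomorphic_word] V(2) continuous_on_subset by blast
      thus "continuous_on X (word_map \<phi> (map \<omega> [0..<n]))"
        by (rule continuous_on_eq) (simp add: word_extends)
    qed
    show "?K n \<subseteq> ?K m" if "m \<le> n" for m n
      by (rule lift_Suc_antimono_le[OF _ that]) (rule word_map_prefix_Suc)
  qed (use X in auto)
  then obtain x where x: "\<And>n. x \<in> ?K n" by blast
  have "\<pi> \<omega> = x"
    unfolding coding_map_def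
  proof (rule the_equality)
    show "x \<in> (\<Inter>n\<in>{1..}. ?K n)" by (rule INT_I) (rule x)
    fix y assume y: "y \<in> (\<Inter>n\<in>{1..}. ?K n)"
    show "y = x"
    proof (rule coding_unique[OF _ x])
      fix n
      \<comment> \<open>\<open>coding_map\<close> intersects from \<open>n = 1\<close> on; the
        cylinder of order 0 is recovered from a deeper one.\<close>
      have "y \<in> ?K (Suc n)" using y by (rule INT_D) simp
      thus "y \<in> ?K n" by (rule subsetD[OF word_map_prefix_Suc])
    qed
  qed
  thus ?thesis using x by simp
qed

lemma coding_in_X: "\<pi> \<omega> \<in> X"
  using coding_in_cylinder[of \<omega> 0] by simp

lemma coding_case_nat: "\<pi> (i ## \<omega>) = \<phi> i (\<pi> \<omega>)"
proof (rule coding_unique[OF coding_in_cylinder])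
  fix n
  have "map (i ## \<omega>) [0..<Suc n] = i # map \<omega> [0..<n]"
    by (simp only: upt_conv_Cons[OF zero_less_Suc] map_Suc_upt[symmetric]) simp
  moreover have "\<phi> i (\<pi> \<omega>) \<in> \<phi> i ` word_map \<phi> (map \<omega> [0..<n]) ` X" using coding_in_cylinder by blast
  ultimately have "\<phi> i (\<pi> \<omega>) \<in> word_map \<phi> (map (i ## \<omega>) [0..<Suc n]) ` X" by (simp add: image_comp)
  thus "\<phi> i (\<pi> \<omega>) \<in> word_map \<phi> (map (i ## \<omega>) [0..<n]) ` X" using word_map_prefix_Suc by blast
qed

text \<open>Approximation by word maps at a fixed point is how holomorphy in the parameter will
  reach the code.\<close>

lemma coding_limit:
  assumes "x0 \<in> X" shows "(\<lambda>n. word_map \<phi> (map \<omega> [0..<n]) x0) \<longlonglongrightarrow> \<pi> \<omega>"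
proof -
  obtain D where D: "D \<ge> 0" "\<And>x y. x \<in> X \<Longrightarrow> y \<in> X \<Longrightarrow> cmod (x - y) \<le> D" using diameter_bound by blast
  show ?thesis
  proof (rule LIM_zero_cancel, rule Lim_null_comparison)
    show "eventually (\<lambda>n. cmod (word_map \<phi> (map \<omega> [0..<n]) x0 - \<pi> \<omega>) \<le> s ^ n * D) sequentially"
    proof (rule always_eventually, rule allI)
      fix n
      obtain u where u: "u \<in> X" "\<pi> \<omega> = word_map \<phi> (map \<omega> [0..<n]) u" using coding_in_cylinder by blast
      have "cmod (word_map \<phi> (map \<omega> [0..<n]) x0 - \<pi> \<omega>) \<le> s ^ n * cmod (x0 - u)"
        using word_Lipschitz[OF assms u(1), of "map \<omega> [0..<n]"] u by simp
      also have "\<dots> \<le> s ^ n * D" using D u assms s by (intro mult_left_mono) auto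
      finally show "cmod (word_map \<phi> (map \<omega> [0..<n]) x0 - \<pi> \<omega>) \<le> s ^ n * D" .
    qed
    show "(\<lambda>n. s ^ n * D) \<longlonglongrightarrow> 0" using s by (intro tendsto_mult_left_zero LIMSEQ_power_zero) auto
  qed
qed

lemma agree_coding:
  assumes "agree n \<omega> \<tau>"
  obtains w x y where "length w = n" "x \<in> X" "y \<in> X" "\<pi> \<omega> = word_map \<phi> w x" "\<pi> \<tau> = word_map \<phi> w y"
proof -
  have eq: "map \<omega> [0..<n] = map \<tau> [0..<n]" using assms by (simp add: agree_def)
  obtain x y where "x \<in> X" "y \<in> X" "\<pi> \<omega> = word_map \<phi> (map \<omega> [0..<n]) x" "\<pi> \<tau> = word_map \<phi> (map \<tau> [0..<n]) y"
    using coding_in_cylinder[of \<omega> n] coding_in_cylinder[of \<tau> n] by blast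
  thus ?thesis using that[of "map \<omega> [0..<n]" x y] eq by simp
qed

definition potential :: "real \<Rightarrow> (nat \<Rightarrow> nat) \<Rightarrow> real" where
  "potential t \<omega> = t * ln (cmod (deriv (\<psi> (\<omega> 0)) (\<pi> (shift \<omega>))))"

text \<open>By the chain rule the exponentials multiply to derivatives of word maps. The letter
  nearest to \<open>\<omega>\<close> is applied first, hence stands last in the word, which explains
  the reindexing by \<open>w @ [i]\<close>.\<close>

lemma transfer_potential:
  assumes "finite E"
  shows "transfer E (potential t) n \<omega> = (\<Sum>w\<in>words E n. dn w (\<pi> \<omega>) powr t)"
proof (induction n arbitrary: \<omega>)
  case 0
  show ?case by simp
next
  case (Suc n)
  have in_V: "\<pi> \<omega> \<in> V" for \<omega> using coding_in_X V by blast
  have "transfer E (potential t) (Suc n) \<omega>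
    = (\<Sum>i\<in>E. cmod (deriv (\<psi> i) (\<pi> \<omega>)) powr t * (\<Sum>w\<in>words E n. dn w (\<psi> i (\<pi> \<omega>)) powr t))"
    using deriv_word_nonzero[OF in_V, of "[_]"]
    by (simp add: potential_def Suc coding_case_nat extends[OF coding_in_X] powr_def)
  also have "\<dots> = (\<Sum>i\<in>E. \<Sum>w\<in>words E n. dn (w @ [i]) (\<pi> \<omega>) powr t)"
    by (simp add: sum_distrib_left deriv_word_append[OF in_V] norm_mult powr_mult mult_ac)
  also have "\<dots> = (\<Sum>p\<in>E \<times> words E n. dn ((\<lambda>(i, w). w @ [i]) p) (\<pi> \<omega>) powr t)"
    by (simp add: sum.cartesian_product case_prod_unfold)
  also have "\<dots> = (\<Sum>w\<in>words E (Suc n). dn w (\<pi> \<omega>) powr t)"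
    by (rule sum.reindex_bij_betw[OF bij_betw_words_snoc])
  finally show ?case .
qed

end

section \<open>Existence of the pressure\<close>

text \<open>The linear lower bound keeps the infimum of \<open>a n / real n\<close> finite; division
  of \<open>n\<close> by a nearly optimal \<open>k\<close> with remainder shows that it is the
  limit.\<close>

lemma fekete:
  fixes a :: "nat \<Rightarrow> real"
  assumes sub: "\<And>m n. a (m + n) \<le> a m + a n" and bd: "\<And>n. c * real n \<le> a n"
  obtains p where "(\<lambda>n. a n / real n) \<longlonglongrightarrow> p"
proof -
  define S where "S = (\<lambda>n. a n / real n) ` {1..}"
  have S_le: "c \<le> a n / real n" if "n \<ge> 1" for n using bd[of n] that by (simp add: field_simps)
  hence bdd: "bdd_below S" by (auto simp: S_def intro!: bdd_belowI2[of _ c])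
  define p where "p = Inf S"
  have p_le: "p \<le> a n / real n" if "n \<ge> 1" for n
    unfolding p_def by (rule cInf_lower[OF _ bdd]) (use that in \<open>auto simp: S_def\<close>)
  have mult: "a (q * k + r) \<le> real q * a k + a r" for q k r
  proof (induction q)
    case (Suc q)
    have "a (Suc q * k + r) \<le> a k + a (q * k + r)" using sub[of k "q * k + r"] by (simp add: add.assoc)
    thus ?case using Suc by (simp add: algebra_simps)
  qed simp
  have "(\<lambda>n. a n / real n) \<longlonglongrightarrow> p"
  proof (rule LIMSEQ_I)
    fix e :: real assume e: "e > 0"
    have "\<exists>x\<in>S. x < p + e / 2"
      using cInf_lessD[of S "p + e / 2"] e by (auto simp: p_def S_def)
    then obtain k where k: "k \<ge> 1" "a k / real k < p + e / 2" by (auto simp: S_def)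
    define M where "M = real k * \<bar>a k / real k\<bar> + (\<Sum>r<k. \<bar>a r\<bar>)"
    have M: "M \<ge> 0" by (auto simp: M_def intro!: add_nonneg_nonneg sum_nonneg)
    have bound: "a n / real n \<le> a k / real k + M / real n" if n: "n \<ge> 1" for n
    proof -
      define q r where "q = n div k" and "r = n mod k"
      have nqr: "n = q * k + r" "r < k" using k by (simp_all add: q_def r_def)
      have "a n \<le> real q * a k + a r" using mult[of q k r] nqr by simp
      also have "real q * a k = (real n - real r) * (a k / real k)" using k by (simp add: nqr)
      also have "\<dots> \<le> real n * (a k / real k) + real k * \<bar>a k / real k\<bar>"
      proof -
        have "- (real r * (a k / real k)) \<le> real r * \<bar>a k / real k\<bar>"
          by (metis abs_ge_minus_self mult_left_mono of_nat_0_le_iff mult_minus_right)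
        also have "\<dots> \<le> real k * \<bar>a k / real k\<bar>" using nqr by (intro mult_right_mono) auto
        finally show ?thesis unfolding left_diff_distrib by linarith
      qed
      also have "a r \<le> (\<Sum>r<k. \<bar>a r\<bar>)"
        using nqr member_le_sum[of r "{..<k}" "\<lambda>r. \<bar>a r\<bar>"] by (auto intro: order_trans[OF abs_ge_self])
      finally have "a n \<le> real n * (a k / real k) + M" by (simp add: M_def)
      thus ?thesis using n by (simp add: field_simps)
    qed
    obtain N where N: "N \<ge> 1" "M / (e / 2) < real N"
      using reals_Archimedean2[of "max 1 (M / (e / 2))"] by (metis max_less_iff_conj less_imp_le of_nat_1 of_nat_le_iff)
    show "\<exists>N. \<forall>n\<ge>N. norm (a n / real n - p) < e"
    proof (intro exI[of _ N] allI impI)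
      fix n assume n: "n \<ge> N"
      have "M / (e / 2) < real n" using N n by (meson less_le_trans of_nat_le_iff)
      hence "M / real n < e / 2" using e n N by (simp add: field_simps)
      hence "a n / real n < p + e" using bound[of n] k n N by linarith
      thus "norm (a n / real n - p) < e" using p_le[of n] n N e by auto
    qed
  qed
  thus ?thesis by (rule that)
qed

lemma words_mono: "E \<subseteq> E' \<Longrightarrow> words E n \<subseteq> words E' n"
  by (auto simp: words_def)

lemma bij_betw_words_append:
  "bij_betw (\<lambda>(v, w). v @ w) (words E n \<times> words E k) (words E (n + k))"
  by (rule bij_betw_byWitness[where f' = "\<lambda>w. (take n w, drop n w)"])
     (auto simp: words_def dest: in_set_takeD in_set_dropD)

locale distorted_ifs = univalent_ifs +
  fixes K t :: real
  assumes K: "K \<ge> 1" and t: "t \<ge> 0"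
    and distortion: "\<And>w x y. x \<in> X \<Longrightarrow> y \<in> X \<Longrightarrow>
      dn w x \<le> K * dn w y"
begin

abbreviation N :: "nat list \<Rightarrow> real" where "N w \<equiv> deriv_norm X (word_map \<phi> w)"

lemma norm_eq: "N w = (SUP x\<in>X. dn w x)"
  unfolding deriv_norm_def by (rule SUP_cong) (simp_all add: deriv_within_word)

lemma deriv_le_norm: "x \<in> X \<Longrightarrow> dn w x \<le> N w"
  unfolding norm_eq by (rule cSUP_upper) (auto intro!: bdd_aboveI2 deriv_word_le)

lemma norm_leI: "(\<And>x. x \<in> X \<Longrightarrow> dn w x \<le> B) \<Longrightarrow> N w \<le> B"
  unfolding norm_eq using X by (intro cSUP_least)

lemma norm_le_deriv: "x \<in> X \<Longrightarrow> N w \<le> K * dn w x"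
  by (rule norm_leI) (rule distortion)

lemma norm_pos: "N w > 0"
proof -
  obtain x where "x \<in> X" using X by blast
  thus ?thesis using deriv_word_nonzero[of x w] deriv_le_norm[of x w] V by (meson zero_less_norm_iff less_le_trans subsetD)
qed

lemma norm_append_le: "N (v @ w) \<le> N v * N w"
proof (rule norm_leI)
  fix x assume x: "x \<in> X"
  show "dn (v @ w) x \<le> N v * N w"
    unfolding deriv_word_append[OF subsetD[OF V(2) x]] norm_mult word_extends[OF x]
    by (intro mult_mono deriv_le_norm word_in_X x) (simp_all add: less_imp_le[OF norm_pos])
qed

lemma norm_append_ge: "N v * N w \<le> K * N (v @ w)"
proof -
  have "N w \<le> K * N (v @ w) / N v"
  proof (rule norm_leI)
    fix x assume x: "x \<in> X"
    have "N v * dn w x \<le> (K * dn v (word_map \<phi> w x)) * dn w x"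
      by (intro mult_right_mono norm_le_deriv word_in_X x) simp
    also have "\<dots> = K * dn (v @ w) x"
      using x V by (auto simp: deriv_word_append norm_mult word_extends)
    also have "\<dots> \<le> K * N (v @ w)" using K by (intro mult_left_mono deriv_le_norm x) simp
    finally show "dn w x \<le> K * N (v @ w) / N v"
      using norm_pos[of v] by (simp add: field_simps)
  qed
  thus ?thesis using norm_pos[of v] by (simp add: field_simps)
qed

definition F :: "nat \<Rightarrow> nat \<Rightarrow> real" where
  "F m n = (\<Sum>w\<in>words {..<m} n. N w powr t)"

text \<open>\<open>F\<close> is submultiplicative and yields the pressure; \<open>T\<close>, with
  derivatives at one coded point, is a transfer iterate and can be perturbed. Distortion makes them
  equal up to the factor \<open>K powr t\<close>.\<close>

definition T :: "nat \<Rightarrow> nat \<Rightarrow> (nat \<Rightarrow> nat) \<Rightarrow> real" where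
  "T m n \<omega> = transfer {..<m} (potential t) n \<omega>"

lemma T_eq: "T m n \<omega> = (\<Sum>w\<in>words {..<m} n. dn w (\<pi> \<omega>) powr t)"
  unfolding T_def by (rule transfer_potential) simp

lemma T_le_F: "T m n \<omega> \<le> F m n"
  unfolding T_eq F_def by (intro sum_mono powr_mono2 t deriv_le_norm coding_in_X) auto

lemma F_le_T: "F m n \<le> K powr t * T m n \<omega>"
  unfolding T_eq F_def sum_distrib_left
proof (rule sum_mono)
  fix w
  have "N w powr t \<le> (K * dn w (\<pi> \<omega>)) powr t"
    by (intro powr_mono2 t norm_le_deriv coding_in_X) (simp add: less_imp_le[OF norm_pos])
  thus "N w powr t \<le> K powr t * dn w (\<pi> \<omega>) powr t"
    using K by (simp add: powr_mult)
qed

lemma F_nonneg: "0 \<le> F m n"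
  unfolding F_def by (intro sum_nonneg) auto

lemma T_mono: "m \<le> m' \<Longrightarrow> T m n \<omega> \<le> T m' n \<omega>"
  unfolding T_eq by (intro sum_mono2 finite_words words_mono) auto

lemma F_mono: "m \<le> m' \<Longrightarrow> F m n \<le> F m' n"
  unfolding F_def by (intro sum_mono2 finite_words words_mono) auto

lemma F_append: "F m (n + k) = (\<Sum>v\<in>words {..<m} n. \<Sum>w\<in>words {..<m} k. N (v @ w) powr t)"
proof -
  have "F m (n + k) = (\<Sum>p\<in>words {..<m} n \<times> words {..<m} k. N (case p of (v, w) \<Rightarrow> v @ w) powr t)"
    unfolding F_def by (rule sum.reindex_bij_betw[OF bij_betw_words_append, symmetric])
  thus ?thesis by (simp add: sum.cartesian_product case_prod_unfold)
qed

lemma F_prod: "F m n * F m k = (\<Sum>v\<in>words {..<m} n. \<Sum>w\<in>words {..<m} k. N v powr t * N w powr t)"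
  by (simp add: F_def sum_product)

lemma F_add: "F m (n + k) \<le> F m n * F m k"
  unfolding F_append F_prod using less_imp_le[OF norm_pos]
  by (intro sum_mono) (auto simp flip: powr_mult intro!: powr_mono2 t norm_append_le)

lemma F_mult_le: "F m n * F m k \<le> K powr t * F m (n + k)"
  unfolding F_append F_prod sum_distrib_left using less_imp_le[OF norm_pos] K
  by (intro sum_mono) (auto simp flip: powr_mult intro!: powr_mono2 t norm_append_ge)

lemma F_pos: "m > 0 \<Longrightarrow> F m n > 0"
  unfolding F_def
proof (rule sum_pos)
  assume "m > 0"
  hence "replicate n 0 \<in> words {..<m} n" by (auto simp: words_def)
  thus "words {..<m} n \<noteq> {}" by blast
qed (use norm_pos in \<open>auto simp: finite_words less_imp_neq[symmetric]\<close>)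

lemma F_0: "F m 0 = N [] powr t"
  by (simp add: F_def)

lemma norm_Nil: "N [] = 1"
proof -
  have "deriv (word_map \<psi> []) x = 1" for x by (simp add: id_def)
  thus ?thesis using X by (simp add: norm_eq del: word_map_Nil)
qed

lemma F_power: "F m n \<le> F m 1 ^ n"
proof (induction n)
  case (Suc n)
  have "F m (Suc n) \<le> F m 1 * F m n" using F_add[of m 1 n] by simp
  also have "\<dots> \<le> F m 1 * F m 1 ^ n" by (intro mult_left_mono Suc F_nonneg)
  finally show ?case by simp
qed (simp add: F_0 norm_Nil del: word_map_Nil)

lemma F_lower: "(F m 1 / K powr t) ^ n \<le> F m n"
proof (induction n)
  case (Suc n)
  have "(F m 1 / K powr t) ^ Suc n \<le> F m 1 / K powr t * F m n"
    unfolding power_Suc using F_nonneg by (intro mult_left_mono Suc) simp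
  also have "\<dots> \<le> F m (Suc n)" using F_mult_le[of m 1 n] K by (simp add: field_simps)
  finally show ?case .
qed (simp add: F_0 norm_Nil del: word_map_Nil)

text \<open>A finite set of words involves finitely many letters, so finite alphabets are cofinal
  among the finite partial sums.\<close>

lemma partition_sum_eq: "partition_sum X \<phi> t n = (SUP m. ennreal (F m n))"
proof -
  have sum_eq: "(\<Sum>w\<in>G. ennreal (N w powr t)) = ennreal (\<Sum>w\<in>G. N w powr t)" for G by (simp add: sum_ennreal)
  have "partition_sum X \<phi> t n = (SUP G\<in>{G. finite G \<and> G \<subseteq> {w. length w = n}}. \<Sum>w\<in>G. ennreal (N w powr t))"
    unfolding partition_sum_def by (rule nonneg_infsum_complete) simp
  also have "\<dots> = (SUP m. ennreal (F m n))"
  proof (intro antisym SUP_least)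
    fix G assume "G \<in> {G. finite G \<and> G \<subseteq> {w :: nat list. length w = n}}"
    hence G: "finite G" "\<And>w. w \<in> G \<Longrightarrow> length w = n" by auto
    have "finite (\<Union>w\<in>G. set w)" using G by auto
    then obtain m where m: "\<forall>i\<in>(\<Union>w\<in>G. set w). i < m" using finite_nat_set_iff_bounded by blast
    have "(\<Sum>w\<in>G. ennreal (N w powr t)) \<le> ennreal (F m n)"
      unfolding sum_eq F_def
      by (intro ennreal_leI sum_mono2 finite_words) (use G m in \<open>auto simp: words_def\<close>)
    also have "\<dots> \<le> (SUP m. ennreal (F m n))" by (rule SUP_upper) simp
    finally show "(\<Sum>w\<in>G. ennreal (N w powr t)) \<le> (SUP m. ennreal (F m n))" .
  next
    fix m
    have "ennreal (F m n) = (\<Sum>w\<in>words {..<m} n. ennreal (N w powr t))" by (simp add: F_def sum_eq)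
    also have "\<dots> \<le> (SUP G\<in>{G. finite G \<and> G \<subseteq> {w. length w = n}}. \<Sum>w\<in>G. ennreal (N w powr t))"
      by (rule SUP_upper) (auto simp: finite_words, auto simp: words_def)
    finally show "ennreal (F m n) \<le> (SUP G\<in>{G. finite G \<and> G \<subseteq> {w. length w = n}}. \<Sum>w\<in>G. ennreal (N w powr t))" .
  qed
  finally show ?thesis .
qed

text \<open>By distortion, words that begin with \<open>n\<close> letters 0 already contribute a
  fixed multiple of the one-letter sum, so divergence at level 1 makes all higher levels
  infinite.\<close>

lemma pressure_infinite:
  assumes "\<not> bdd_above (range (\<lambda>m. T m 1 \<omega>))"
  shows "pressure X \<phi> t = \<infinity>"
proof -
  have Z: "partition_sum X \<phi> t (Suc n) = \<infinity>" for n
  proof (rule ccontr)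
    assume "partition_sum X \<phi> t (Suc n) \<noteq> \<infinity>"
    then obtain z where z: "partition_sum X \<phi> t (Suc n) = ennreal z" "z \<ge> 0"
      by (cases "partition_sum X \<phi> t (Suc n)") auto
    have c: "F 1 n > 0" by (rule F_pos) simp
    have "T m 1 \<omega> \<le> K powr t * z / F 1 n" for m
    proof -
      have "ennreal (F (Suc m) (Suc n)) \<le> ennreal z" unfolding z(1)[symmetric] partition_sum_eq by (rule SUP_upper) simp
      hence Fz: "F (Suc m) (Suc n) \<le> z" using z by simp
      have "F 1 n * T (Suc m) 1 \<omega> \<le> F (Suc m) n * F (Suc m) 1"
        using F_mono[of 1 "Suc m" n] T_le_F c F_nonneg by (intro mult_mono) (auto simp: T_eq intro!: sum_nonneg)
      also have "\<dots> \<le> K powr t * F (Suc m) (Suc n)" using F_mult_le[of "Suc m" n 1] by simp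
      also have "\<dots> \<le> K powr t * z" using Fz by (intro mult_left_mono) auto
      finally have "T (Suc m) 1 \<omega> \<le> K powr t * z / F 1 n" using c by (simp add: field_simps)
      thus ?thesis using T_mono[of m "Suc m" 1 \<omega>] by simp
    qed
    thus False using assms by (auto simp: bdd_above_def)
  qed
  have "log_ennreal (partition_sum X \<phi> t n) / ereal (real n) = \<infinity>" if "n \<ge> 1" for n
    using Z[of "n - 1"] that by (simp add: log_ennreal_def)
  hence "eventually (\<lambda>n. log_ennreal (partition_sum X \<phi> t n) / ereal (real n) = \<infinity>) sequentially"
    by (auto simp: eventually_sequentially)
  hence "(\<lambda>n. log_ennreal (partition_sum X \<phi> t n) / ereal (real n)) \<longlonglongrightarrow> \<infinity>"
    by (rule tendsto_eventually)
  thus ?thesis unfolding pressure_def by (rule limI)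
qed

text \<open>The pressure becomes an iterated limit, over the alphabet and then over the length, of
  the quantities that will be perturbed. Subadditivity holds for the limits \<open>G\<close> of the
  sup-norm sums; passing to \<open>L\<close> costs at most \<open>t * ln K / real n\<close>.\<close>

lemma pressure_finite:
  assumes "bdd_above (range (\<lambda>m. T m 1 \<omega>))"
  obtains p L where "pressure X \<phi> t = ereal p" "\<And>n. L n > 0" "\<And>n. (\<lambda>m. T m n \<omega>) \<longlonglongrightarrow> L n"
    "(\<lambda>n. ln (L n) / real n) \<longlonglongrightarrow> p"
proof -
  obtain B where B: "\<And>m. T m 1 \<omega> \<le> B" using assms by (auto simp: bdd_above_def)
  have F1: "F m 1 \<le> K powr t * B" for m
    by (rule order_trans[OF F_le_T[of m 1 \<omega>]]) (use B in \<open>auto intro: mult_left_mono\<close>)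
  have Fn: "F m n \<le> (K powr t * B) ^ n" for m n
    by (rule order_trans[OF F_power]) (intro power_mono F1 F_nonneg)
  have "\<exists>L. (\<lambda>m. F m n) \<longlonglongrightarrow> L" for n
    using incseq_convergent[of "\<lambda>m. F m n" "(K powr t * B) ^ n"] F_mono Fn by (metis incseq_def)
  then obtain G where G: "\<And>n. (\<lambda>m. F m n) \<longlonglongrightarrow> G n" by metis
  have "\<exists>L. (\<lambda>m. T m n \<omega>) \<longlonglongrightarrow> L" for n
    using incseq_convergent[of "\<lambda>m. T m n \<omega>" "(K powr t * B) ^ n"] T_mono order_trans[OF T_le_F Fn] by (metis incseq_def)
  then obtain L where L: "\<And>n. (\<lambda>m. T m n \<omega>) \<longlonglongrightarrow> L n" by metis
  have F_le_G: "F m n \<le> G n" for m n by (rule incseq_le[OF _ G]) (auto simp: incseq_def F_mono)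
  have LG: "L n \<le> G n" "G n \<le> K powr t * L n" for n
    by (rule LIMSEQ_le[OF L G], use T_le_F in blast)
       (rule LIMSEQ_le[OF G tendsto_mult_left[OF L]], use F_le_T in blast)
  define c where "c = F 1 1 / K powr t"
  have c: "c > 0" using F_pos[of 1 1] K by (simp add: c_def)
  have cG: "c ^ n \<le> G n" for n unfolding c_def by (rule order_trans[OF F_lower F_le_G])
  have G0: "G n > 0" for n using cG[of n] c by (meson less_le_trans zero_less_power)
  have L0: "L n > 0" for n using LG(2)[of n] G0[of n] K by (smt (verit) mult_nonneg_nonpos powr_ge_zero)
  have G_add: "G (m + n) \<le> G m * G n" for m n
    by (rule LIMSEQ_le[OF G tendsto_mult[OF G G]]) (use F_add in blast)
  obtain p where p: "(\<lambda>n. ln (G n) / real n) \<longlonglongrightarrow> p"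
  proof (rule fekete)
    show "ln (G (m + n)) \<le> ln (G m) + ln (G n)" for m n
      using G_add[of m n] G0 by (simp flip: ln_mult_pos)
    show "ln c * real n \<le> ln (G n)" for n
      using cG[of n] c G0[of n] ln_le_cancel_iff[of "c ^ n" "G n"] by (simp add: ln_realpow mult.commute)
  qed
  have Z: "partition_sum X \<phi> t n = ennreal (G n)" for n
  proof -
    have "(\<lambda>m. ennreal (F m n)) \<longlonglongrightarrow> (SUP m. ennreal (F m n))"
      by (rule LIMSEQ_SUP) (auto simp: incseq_def intro!: ennreal_leI F_mono)
    thus ?thesis unfolding partition_sum_eq using tendsto_ennrealI[OF G] by (rule LIMSEQ_unique)
  qed
  have "log_ennreal (partition_sum X \<phi> t n) / ereal (real n) = ereal (ln (G n) / real n)" if "n \<ge> 1" for n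
    using G0[of n] that by (simp add: Z log_ennreal_def ennreal_eq_0_iff)
  hence ev: "eventually (\<lambda>n. log_ennreal (partition_sum X \<phi> t n) / ereal (real n) = ereal (ln (G n) / real n)) sequentially"
    by (auto simp: eventually_sequentially)
  have "(\<lambda>n. log_ennreal (partition_sum X \<phi> t n) / ereal (real n)) \<longlonglongrightarrow> ereal p"
    using p by (subst tendsto_cong[OF ev]) simp
  hence pr: "pressure X \<phi> t = ereal p" unfolding pressure_def by (rule limI)
  have "(\<lambda>n. ln (L n) / real n) \<longlonglongrightarrow> p"
  proof -
    have "(\<lambda>n. ln (L n) / real n - ln (G n) / real n) \<longlonglongrightarrow> 0"
    proof (rule Lim_null_comparison)
      show "eventually (\<lambda>n. norm (ln (L n) / real n - ln (G n) / real n) \<le> t * ln K / real n) sequentially"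
      proof (rule always_eventually, rule allI)
        fix n
        have "ln (L n) \<le> ln (G n)" using LG(1)[of n] L0[of n] G0[of n] by simp
        moreover have "ln (G n) \<le> ln (K powr t * L n)" using LG(2)[of n] L0[of n] G0[of n] K by (subst ln_le_cancel_iff) auto
        hence "ln (G n) \<le> t * ln K + ln (L n)" using L0[of n] K by (simp add: ln_mult_pos ln_powr)
        ultimately have "\<bar>ln (L n) - ln (G n)\<bar> \<le> t * ln K" by linarith
        thus "norm (ln (L n) / real n - ln (G n) / real n) \<le> t * ln K / real n"
          by (simp add: diff_divide_distrib[symmetric] divide_right_mono)
      qed
      show "(\<lambda>n. t * ln K / real n) \<longlonglongrightarrow> 0" by (rule lim_const_over_n)
    qed
    from tendsto_add[OF this p] show ?thesis by simp
  qed
  with pr L0 L show ?thesis by (rule that)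
qed

end

section \<open>Analytic families in a chart\<close>

lemma norm_vector_scalar_mult:
  fixes v :: "complex ^ 'n"
  shows "norm (c *s v) = cmod c * norm v"
  by (simp add: norm_vec_def norm_mult L2_set_right_distrib)

lemma has_derivative_affine_line:
  fixes v z :: "complex ^ 'n"
  shows "((\<lambda>w. z + w *s v) has_derivative (\<lambda>h. h *s v)) (at w within D)"
proof -
  have "linear (\<lambda>w :: complex. w *s v)"
    by (rule linearI) (simp_all add: vec_eq_iff algebra_simps)
  hence "((\<lambda>w. w *s v) has_derivative (\<lambda>h. h *s v)) (at w within D)"
    by (intro bounded_linear_imp_has_derivative) (simp add: linear_conv_bounded_linear)
  thus ?thesis by (auto intro!: derivative_eq_intros)
qed

lemma coord_space_line: "z \<in> coord_space I \<Longrightarrow> v \<in> coord_space I \<Longrightarrow> z + w *s v \<in> coord_space I"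
  by (simp add: coord_space_def)

lemma coord_space_diff: "z \<in> coord_space I \<Longrightarrow> v \<in> coord_space I \<Longrightarrow> z - v \<in> coord_space I"
  by (simp add: coord_space_def)

lemma open_line_preimage:
  fixes z v :: "complex ^ 'n::finite"
  assumes W: "openin (top_of_set (coord_space I)) W" and zv: "z \<in> coord_space I" "v \<in> coord_space I"
  shows "open {w. z + w *s v \<in> W}"
proof -
  obtain O' where O': "open O'" "W = coord_space I \<inter> O'" using W by (auto simp: openin_open)
  have "continuous_on UNIV (\<lambda>w. z + w *s v)"
    using has_derivative_affine_line[of z v] by (meson continuous_on_eq_continuous_within has_derivative_continuous)
  hence "open ((\<lambda>w. z + w *s v) -` O')" using O'(1) by (rule open_vimage[rotated])
  moreover have "{w. z + w *s v \<in> W} = (\<lambda>w. z + w *s v) -` O'"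
    using O'(2) coord_space_line[OF zv] by auto
  ultimately show ?thesis by simp
qed

text \<open>Holomorphy in several variables enters only through restrictions to complex lines.\<close>

definition line_holomorphic :: "'n::finite set \<Rightarrow> (complex ^ 'n) set \<Rightarrow> (complex ^ 'n \<Rightarrow> complex) \<Rightarrow> bool" where
  "line_holomorphic I W f \<longleftrightarrow>
     (\<forall>z\<in>coord_space I. \<forall>v\<in>coord_space I. (\<lambda>w. f (z + w *s v)) holomorphic_on {w. z + w *s v \<in> W})"

lemma line_holomorphicD:
  "line_holomorphic I W f \<Longrightarrow> z \<in> coord_space I \<Longrightarrow> v \<in> coord_space I \<Longrightarrow> T \<subseteq> {w. z + w *s v \<in> W} \<Longrightarrow>
     (\<lambda>w. f (z + w *s v)) holomorphic_on T"
  unfolding line_holomorphic_def by (blast intro: holomorphic_on_subset)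

lemma line_holomorphic_subset:
  "line_holomorphic I W f \<Longrightarrow> W' \<subseteq> W \<Longrightarrow> line_holomorphic I W' f"
  unfolding line_holomorphic_def by (blast intro: holomorphic_on_subset)

lemma line_holomorphic_limit:
  assumes W: "openin (top_of_set (coord_space I)) W" and f: "\<And>n. line_holomorphic I W (f n)"
    and bnd: "\<And>n z. z \<in> W \<Longrightarrow> cmod (f n z) \<le> B" and lim: "\<And>z. z \<in> W \<Longrightarrow> (\<lambda>n. f n z) \<longlonglongrightarrow> g z"
  shows "line_holomorphic I W g"
  unfolding line_holomorphic_def
proof (intro ballI)
  fix z v assume zv: "z \<in> coord_space I" "v \<in> coord_space I"
  show "(\<lambda>w. g (z + w *s v)) holomorphic_on {w. z + w *s v \<in> W}"
    by (rule holomorphic_on_bounded_pointwise_limit[OF open_line_preimage[OF W zv], of "\<lambda>n w. f n (z + w *s v)" B])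
       (use f bnd lim zv in \<open>auto simp: line_holomorphic_def\<close>)
qed

text \<open>Closure under substituting a moving point into a jointly holomorphic map, as needed for
  word maps and for maps evaluated at codes.\<close>

lemma line_holomorphic_joint:
  assumes W: "openin (top_of_set (coord_space I)) W"
    and F: "holomorphic_joint_on F (W \<times> V)" and x: "line_holomorphic I W x" "\<And>z. z \<in> W \<Longrightarrow> x z \<in> V"
  shows "line_holomorphic I W (\<lambda>z. F (z, x z))"
  unfolding line_holomorphic_def
proof (intro ballI)
  fix z v assume zv: "z \<in> coord_space I" "v \<in> coord_space I"
  let ?D = "{w. z + w *s v \<in> W}"
  have D: "open ?D" by (rule open_line_preimage[OF W zv])
  have "\<exists>e. ((\<lambda>w. F (z + w *s v, x (z + w *s v))) has_field_derivative e) (at w)" if w: "w \<in> ?D" for w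
  proof -
    let ?p = "\<lambda>w. (z + w *s v, x (z + w *s v))"
    have "(\<lambda>w. x (z + w *s v)) holomorphic_on ?D" using x(1) zv by (simp add: line_holomorphic_def)
    then obtain d where "((\<lambda>w. x (z + w *s v)) has_field_derivative d) (at w within ?D)"
      using w by (auto simp: holomorphic_on_def field_differentiable_def)
    hence P: "(?p has_derivative (\<lambda>h. (h *s v, d * h))) (at w within ?D)"
      by (intro has_derivative_Pair has_derivative_affine_line) (simp add: has_field_derivative_def)
    from F w x(2) obtain DF where DF: "(F has_derivative DF) (at (?p w) within W \<times> V)"
       and lin: "\<And>c a b. DF (c *s a, c * b) = c * DF (a, b)"
    proof -
      have "?p w \<in> W \<times> V" using w x(2) by auto
      then obtain DF where "(F has_derivative DF) (at (?p w) within W \<times> V)"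
          "\<forall>c q. DF ((\<lambda>c (z, x). (c *s z, c * x)) c q) = c * DF q"
        using F unfolding holomorphic_joint_on_def complex_differentiable_on_def by meson
      thus ?thesis by (intro that[of DF]) auto
    qed
    have sub: "?p ` ?D \<subseteq> W \<times> V" using x(2) by auto
    have "((\<lambda>w. F (?p w)) has_derivative (\<lambda>h. DF (h *s v, d * h))) (at w within ?D)"
      by (rule has_derivative_in_compose[OF P has_derivative_subset[OF DF sub]])
    hence "((\<lambda>w. F (?p w)) has_derivative (\<lambda>h. DF (h *s v, d * h))) (at w)"
      unfolding at_within_open[OF w D] .
    moreover have "(\<lambda>h. DF (h *s v, d * h)) = (*) (DF (v, d))"
    proof
      fix h show "DF (h *s v, d * h) = DF (v, d) * h"
        unfolding mult.commute[of d h] mult.commute[of _ h] by (rule lin)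
    qed
    ultimately have "((\<lambda>w. F (?p w)) has_field_derivative DF (v, d)) (at w)"
      by (simp only: has_field_derivative_def)
    thus ?thesis by (rule exI)
  qed
  thus "(\<lambda>w. F (z + w *s v, x (z + w *s v))) holomorphic_on ?D"
    unfolding holomorphic_on_def field_differentiable_def
    by (blast intro: has_field_derivative_at_within)
qed

text \<open>On the complex line through \<open>z0\<close> and \<open>z\<close> this is the remainder
  bound with \<open>k = 1\<close>, as long as \<open>z\<close> is within \<open>R / 2\<close> of
  \<open>z0\<close>; further out the trivial bound suffices because
  \<open>2 * norm (z - z0) / R > 1\<close>.\<close>

lemma line_holomorphic_Schwarz:
  fixes z0 :: "complex ^ 'n::finite"
  assumes z0: "z0 \<in> coord_space I" and R: "R > 0"
    and f: "line_holomorphic I (coord_space I \<inter> ball z0 R) f"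
    and bnd: "\<And>z. z \<in> coord_space I \<inter> ball z0 R \<Longrightarrow> cmod (f z) \<le> M" and f0: "f z0 = 0"
    and z: "z \<in> coord_space I \<inter> ball z0 R"
  shows "cmod (f z) \<le> 2 * M * norm (z - z0) / R"
proof -
  have M: "M \<ge> 0" using bnd[of z0] z0 R f0 by simp
  consider "z = z0" | "norm (z - z0) \<le> R / 2" "z \<noteq> z0" | "norm (z - z0) > R / 2" by linarith
  thus ?thesis
  proof cases
    case 1 thus ?thesis using f0 by simp
  next
    case 3
    have "cmod (f z) \<le> M * 1" using bnd z by simp
    also have "\<dots> \<le> M * (2 * norm (z - z0) / R)" using 3 M R by (intro mult_left_mono) (auto simp: field_simps)
    finally show ?thesis by (simp add: mult_ac)
  next
    case 2
    \<comment> \<open>The radius in \<open>w\<close> within which the line stays in the ball; the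
      point \<open>z\<close> sits at \<open>w = 1\<close>.\<close>
    define \<rho> where "\<rho> = R / norm (z - z0)"
    have \<rho>: "\<rho> \<ge> 2" using 2 by (simp add: \<rho>_def field_simps)
    have in_ball: "z0 + w *s (z - z0) \<in> coord_space I \<inter> ball z0 R" if "w \<in> ball 0 \<rho>" for w
    proof -
      have "cmod w * norm (z - z0) < R" using that 2 by (simp add: \<rho>_def field_simps)
      moreover have "dist z0 (z0 + u) = norm u" for u by (simp add: dist_norm)
      ultimately have "z0 + w *s (z - z0) \<in> ball z0 R" by (simp only: mem_ball norm_vector_scalar_mult)
      thus ?thesis using z z0 coord_space_line[OF z0 coord_space_diff[of z I z0]] by blast
    qed
    have "cmod (f (z0 + 1 *s (z - z0)) - (\<Sum>l<1. (deriv ^^ l) (\<lambda>w. f (z0 + w *s (z - z0))) 0 / fact l * 1 ^ l)) \<le> 2 * M * (cmod 1 / \<rho>) ^ 1"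
    proof (rule power_series_remainder_bound[of "\<lambda>w. f (z0 + w *s (z - z0))"])
      show "(\<lambda>w. f (z0 + w *s (z - z0))) holomorphic_on ball 0 \<rho>"
        by (rule line_holomorphicD[OF f z0]) (use z z0 in_ball coord_space_diff in auto)
      show "cmod (f (z0 + w *s (z - z0))) \<le> M" if "w \<in> ball 0 \<rho>" for w by (rule bnd[OF in_ball[OF that]])
    qed (use \<rho> in auto)
    thus ?thesis using f0 by (simp add: \<rho>_def)
  qed
qed

text \<open>The bound that makes difference quotients admissible in
  \<open>line_holomorphic_limit\<close>.\<close>

lemma norm_difference_quotient_le:
  assumes "f holomorphic_on ball x \<rho>" "\<And>y. y \<in> ball x \<rho> \<Longrightarrow> cmod (f y) \<le> M" "\<rho> > 0" "cmod h \<le> \<rho> / 2" "h \<noteq> 0"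
  shows "cmod ((f (x + h) - f x) / h) \<le> 2 * M / \<rho>"
proof -
  have "cmod (f (x + h) - (\<Sum>l<1. (deriv ^^ l) (\<lambda>u. f (x + u)) 0 / fact l * h ^ l)) \<le> 2 * M * (cmod h / \<rho>) ^ 1"
  proof (rule power_series_remainder_bound[of "\<lambda>u. f (x + u)"])
    have "(f \<circ> (\<lambda>u. x + u)) holomorphic_on ball 0 \<rho>"
      by (rule holomorphic_on_compose_gen[OF _ assms(1)]) (auto intro!: holomorphic_intros simp: dist_norm)
    thus "(\<lambda>u. f (x + u)) holomorphic_on ball 0 \<rho>" by (simp add: o_def)
    show "cmod (f (x + u)) \<le> M" if "u \<in> ball 0 \<rho>" for u using assms(2)[of "x + u"] that by (simp add: dist_norm)
  qed (use assms in auto)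
  thus ?thesis using assms(3,5) by (simp add: norm_divide field_simps)
qed

lemma norm_Ln_diff_le:
  assumes "u \<in> cball 1 (1/2)" "v \<in> cball 1 (1/2)"
  shows "cmod (Ln u - Ln v) \<le> 2 * cmod (u - v)"
proof (rule field_differentiable_bound[of "cball 1 (1/2)" Ln inverse])
  fix z :: complex assume z: "z \<in> cball 1 (1/2)"
  have re: "Re z \<ge> 1 / 2" using z abs_Re_le_cmod[of "1 - z"] by (auto simp: dist_norm)
  hence "z \<notin> \<real>\<^sub>\<le>\<^sub>0" by (auto simp: complex_nonpos_Reals_iff)
  thus "(Ln has_field_derivative inverse z) (at z within cball 1 (1/2))"
    by (rule has_field_derivative_at_within[OF has_field_derivative_Ln])
  have "1 / 2 \<le> cmod z" using re complex_Re_le_cmod order_trans by blast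
  thus "cmod (inverse z) \<le> 2" by (simp add: norm_divide inverse_eq_divide divide_le_eq)
qed (use assms in auto)

text \<open>An analytic family read in a chart near \<open>z0\<close>. The ratio \<open>s\<close> is
  chosen separately for each \<open>z\<close>; a common contraction rate is derived later from
  \<open>ratio_bound\<close>.\<close>

locale local_family =
  fixes I :: "'n::finite set" and W :: "(complex ^ 'n) set" and z0 :: "complex ^ 'n"
    and X V :: "complex set" and \<Phi> \<Psi> :: "complex ^ 'n \<Rightarrow> nat \<Rightarrow> complex \<Rightarrow> complex" and B t :: real
  assumes W: "openin (top_of_set (coord_space I)) W" "z0 \<in> W"
    and ifs: "\<And>z. z \<in> W \<Longrightarrow> \<exists>s. univalent_ifs X V (\<Phi> z) (\<Psi> z) s"
    and bounded_V: "bounded V"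
    and joint: "\<And>i. holomorphic_joint_on (\<lambda>(z, x). \<Psi> z i x) (W \<times> V)"
    and ratio_bound: "\<And>\<omega> z. z \<in> W \<Longrightarrow>
      cmod (deriv_within X (\<Phi> z (\<omega> 0)) (coding_map X (\<Phi> z) (shift \<omega>)) /
            deriv_within X (\<Phi> z0 (\<omega> 0)) (coding_map X (\<Phi> z0) (shift \<omega>))) \<le> B"
    and t: "0 \<le> t"
begin

abbreviation nbhd :: "real \<Rightarrow> (complex ^ 'n) set" where
  "nbhd R \<equiv> coord_space I \<inter> ball z0 R"

abbreviation code :: "complex ^ 'n \<Rightarrow> (nat \<Rightarrow> nat) \<Rightarrow> complex" where
  "code z \<omega> \<equiv> coding_map X (\<Phi> z) \<omega>"

lemma X: "compact X" "connected X" "X = closure (interior X)" "X \<noteq> {}" and V: "open V" "X \<subseteq> V"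
  using ifs[OF W(2)] unfolding univalent_ifs_def by auto

lemma z0_coord: "z0 \<in> coord_space I"
  using W openin_imp_subset by blast

lemma line_holomorphic_word:
  assumes "x0 \<in> V" shows "line_holomorphic I W (\<lambda>z. word_map (\<Psi> z) w x0)"
proof (induction w)
  case Nil
  show ?case by (simp add: line_holomorphic_def)
next
  case (Cons i w)
  have "line_holomorphic I W (\<lambda>z. (\<lambda>(z, x). \<Psi> z i x) (z, word_map (\<Psi> z) w x0))"
  proof (rule line_holomorphic_joint[OF W(1) joint Cons])
    fix z assume "z \<in> W"
    then obtain s where "univalent_ifs X V (\<Phi> z) (\<Psi> z) s" using ifs by blast
    thus "word_map (\<Psi> z) w x0 \<in> V" using assms by (rule univalent_ifs.word_in_V)
  qed
  thus ?case by simp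
qed

lemma code_in_X: "z \<in> W \<Longrightarrow> code z \<omega> \<in> X"
  using ifs univalent_ifs.coding_in_X by blast

text \<open>Word maps at a fixed point of \<open>X\<close> are holomorphic in \<open>z\<close>, have
  values in the bounded set \<open>X\<close>, and converge to the code; the rate depends on
  \<open>z\<close>, which Montel's theorem tolerates.\<close>

lemma line_holomorphic_code: "line_holomorphic I W (\<lambda>z. code z \<omega>)"
proof -
  obtain x0 where x0: "x0 \<in> X" using X by blast
  obtain M where M: "\<And>x. x \<in> X \<Longrightarrow> cmod x \<le> M" using compact_imp_bounded[OF X(1)] by (auto simp: bounded_iff)
  show ?thesis
  proof (rule line_holomorphic_limit[OF W(1)])
    show "line_holomorphic I W (\<lambda>z. word_map (\<Psi> z) (map \<omega> [0..<n]) x0)" for n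
      by (rule line_holomorphic_word) (use x0 V in blast)
    fix z assume "z \<in> W"
    then obtain s where "univalent_ifs X V (\<Phi> z) (\<Psi> z) s" using ifs by blast
    then interpret univalent_ifs X V "\<Phi> z" "\<Psi> z" s .
    show "cmod (word_map (\<Psi> z) (map \<omega> [0..<n]) x0) \<le> M" for n
      using M word_in_X x0 by (simp add: word_extends)
    show "(\<lambda>n. word_map (\<Psi> z) (map \<omega> [0..<n]) x0) \<longlonglongrightarrow> code z \<omega>"
      using coding_limit[OF x0] by (simp add: word_extends[OF x0])
  qed
qed

definition D :: "complex ^ 'n \<Rightarrow> nat \<Rightarrow> (nat \<Rightarrow> nat) \<Rightarrow> complex" where
  "D z i \<omega> = deriv (\<Psi> z i) (code z \<omega>)"

text \<open>The derivative in the space variable is a limit of difference quotients taken along the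
  moving code. They have a common bound because the maps send the bounded set \<open>V\<close> into
  itself.\<close>

lemma line_holomorphic_D: "line_holomorphic I W (\<lambda>z. D z i \<omega>)"
proof -
  obtain \<rho> where \<rho>: "\<rho> > 0" "(\<Union>x\<in>X. cball x \<rho>) \<subseteq> V"
    using compact_subset_open_imp_cball_epsilon_subset[OF X(1) V] .
  have ball_V: "ball x \<rho> \<subseteq> V" if "x \<in> X" for x using \<rho>(2) that by force
  obtain M where M: "\<And>x. x \<in> V \<Longrightarrow> cmod x \<le> M" using bounded_V by (auto simp: bounded_iff)
  define h :: "nat \<Rightarrow> complex" where "h n = of_real (\<rho> / 2 / real (Suc n))" for n
  have h0: "h n \<noteq> 0" for n using \<rho>(1) unfolding h_def of_real_eq_0_iff by simp
  have hn: "cmod (h n) \<le> \<rho> / 2" for n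
  proof -
    have "\<rho> / 2 / real (Suc n) \<le> \<rho> / 2 / 1" using \<rho>(1) by (intro divide_left_mono) auto
    thus ?thesis using \<rho>(1) unfolding h_def norm_of_real by simp
  qed
  have "(\<lambda>n. \<rho> / 2 / real (Suc n)) \<longlonglongrightarrow> 0" by (rule LIMSEQ_Suc[OF lim_const_over_n])
  hence h_lim: "filterlim h (at 0) sequentially"
    using tendsto_of_real[where 'a = complex] h0 by (fastforce simp: filterlim_at h_def[abs_def])
  show ?thesis
  proof (rule line_holomorphic_limit[OF W(1)])
    fix n
    have "line_holomorphic I W (\<lambda>z. (\<lambda>(z, x). \<Psi> z i x) (z, code z \<omega> + h n))"
    proof (rule line_holomorphic_joint[OF W(1) joint])
      show "line_holomorphic I W (\<lambda>z. code z \<omega> + h n)"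
        using line_holomorphic_code[of \<omega>] unfolding line_holomorphic_def by (auto intro!: holomorphic_intros)
      fix z assume "z \<in> W"
      have "code z \<omega> + h n \<in> ball (code z \<omega>) \<rho>" using hn[of n] \<rho>(1) by (simp add: dist_norm)
      thus "code z \<omega> + h n \<in> V" using ball_V[OF code_in_X[OF \<open>z \<in> W\<close>]] by blast
    qed
    moreover have "line_holomorphic I W (\<lambda>z. (\<lambda>(z, x). \<Psi> z i x) (z, code z \<omega>))"
      by (rule line_holomorphic_joint[OF W(1) joint line_holomorphic_code]) (use code_in_X V in blast)
    ultimately show "line_holomorphic I W (\<lambda>z. (\<Psi> z i (code z \<omega> + h n) - \<Psi> z i (code z \<omega>)) / h n)"
      unfolding line_holomorphic_def using h0 by (auto intro!: holomorphic_intros)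
  next
    fix z assume z: "z \<in> W"
    then obtain s where "univalent_ifs X V (\<Phi> z) (\<Psi> z) s" using ifs by blast
    then interpret univalent_ifs X V "\<Phi> z" "\<Psi> z" s .
    have hol: "\<Psi> z i holomorphic_on V" using univalent by (simp add: univalent_on_def)
    have b: "ball (code z \<omega>) \<rho> \<subseteq> V" by (rule ball_V[OF coding_in_X])
    show "cmod ((\<Psi> z i (code z \<omega> + h n) - \<Psi> z i (code z \<omega>)) / h n) \<le> 2 * M / \<rho>" for n
      by (rule norm_difference_quotient_le[OF holomorphic_on_subset[OF hol b]])
         (use M maps_V b \<rho> hn h0 in auto)
    have "(\<Psi> z i has_field_derivative D z i \<omega>) (at (code z \<omega>))"
      unfolding D_def using holomorphic_derivI[OF hol V(1)] coding_in_X V by blast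
    hence "(\<lambda>h. (\<Psi> z i (code z \<omega> + h) - \<Psi> z i (code z \<omega>)) / h) \<midarrow>0\<rightarrow> D z i \<omega>"
      by (simp add: DERIV_def)
    thus "(\<lambda>n. (\<Psi> z i (code z \<omega> + h n) - \<Psi> z i (code z \<omega>)) / h n) \<longlonglongrightarrow> D z i \<omega>"
      using h_lim by (rule filterlim_compose)
  qed
qed

lemma D_nonzero: "z \<in> W \<Longrightarrow> D z i \<omega> \<noteq> 0"
  unfolding D_def using ifs code_in_X V univalent_ifs.deriv_word_nonzero[of X V "\<Phi> z" "\<Psi> z" _ "code z \<omega>" "[i]"]
  by fastforce

lemma D_eq: "z \<in> W \<Longrightarrow> D z i \<omega> = deriv_within X (\<Phi> z i) (code z \<omega>)"
  unfolding D_def using ifs univalent_ifs.deriv_within_letter code_in_X by metis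

text \<open>The quotient in the hypothesis, with the first letter \<open>i\<close> separated from
  the tail \<open>\<omega>\<close>.\<close>

definition ratio :: "complex ^ 'n \<Rightarrow> nat \<Rightarrow> (nat \<Rightarrow> nat) \<Rightarrow> complex" where
  "ratio z i \<omega> = D z i \<omega> / D z0 i \<omega>"

lemma ratio_le: "z \<in> W \<Longrightarrow> cmod (ratio z i \<omega>) \<le> B"
  using ratio_bound[of z "i ## \<omega>"] W(2) by (simp add: ratio_def D_eq)

lemma ratio_z0 [simp]: "ratio z0 i \<omega> = 1"
  using D_nonzero[OF W(2)] by (simp add: ratio_def)

lemma line_holomorphic_ratio: "line_holomorphic I W (\<lambda>z. ratio z i \<omega>)"
  using line_holomorphic_D[of i \<omega>] D_nonzero[OF W(2)] unfolding line_holomorphic_def ratio_def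
  by (auto intro!: holomorphic_intros)

text \<open>Derivatives are controlled at coded points only, since the hypothesis speaks of no
  others. This suffices for the chain rule: word maps send codes to codes.\<close>

lemma D_product:
  assumes z: "z \<in> W" and le: "\<And>i \<omega>. cmod (D z i \<omega>) \<le> \<theta>"
  shows "cmod (deriv (word_map (\<Psi> z) w) (code z \<tau>)) \<le> \<theta> ^ length w"
proof -
  obtain s where "univalent_ifs X V (\<Phi> z) (\<Psi> z) s" using ifs z by blast
  then interpret univalent_ifs X V "\<Phi> z" "\<Psi> z" s .
  have code_word: "code z (foldr (##) w \<tau>) = word_map (\<Phi> z) w (code z \<tau>)" for w
    by (induction w) (simp_all add: coding_case_nat)
  have \<theta>: "\<theta> \<ge> 0" using le[of 0 \<tau>] norm_ge_zero order_trans by blast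
  have cV: "code z \<tau> \<in> V" using coding_in_X V by blast
  show ?thesis
  proof (induction w)
    case (Cons i w)
    have "deriv (word_map (\<Psi> z) ([i] @ w)) (code z \<tau>) = D z i (foldr (##) w \<tau>) * deriv (word_map (\<Psi> z) w) (code z \<tau>)"
      unfolding deriv_word_append[OF cV] D_def code_word by (simp add: word_extends[OF coding_in_X])
    hence "cmod (deriv (word_map (\<Psi> z) (i # w)) (code z \<tau>)) \<le> \<theta> * \<theta> ^ length w"
      using le \<theta> Cons by (auto simp: norm_mult intro!: mult_mono)
    thus ?case by (simp add: o_def)
  qed (simp add: id_def)
qed

end

section \<open>Tools for complex parameters\<close>

lemma holomorphic_transfer:
  assumes "\<And>\<omega>. (\<lambda>w. G w \<omega>) holomorphic_on T"
  shows "(\<lambda>w. transfer E (G w) k \<omega>) holomorphic_on T"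
  by (induction k arbitrary: \<omega>) (auto intro!: holomorphic_intros assms)

lemma half_disc_not_nonpos_Reals:
  assumes "cmod (u - 1) \<le> 1 / 2" shows "u \<notin> \<real>\<^sub>\<le>\<^sub>0"
proof
  assume "u \<in> \<real>\<^sub>\<le>\<^sub>0"
  thus False using abs_Re_le_cmod[of "u - 1"] assms by (auto simp: complex_nonpos_Reals_iff)
qed

lemma norm_Ln_half_disc: "cmod (u - 1) \<le> 1 / 2 \<Longrightarrow> cmod (Ln u) \<le> 1"
  using norm_Ln_diff_le[of u 1] by (simp add: dist_norm norm_minus_commute)

text \<open>The real linear parametrisation of \<open>h\<close> by the numbers
  \<open>h \<bullet> b\<close> is extended to complex coefficients \<open>\<zeta> b\<close>, with
  the directions projected to the coordinates in \<open>I\<close>. Real coefficients give back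
  \<open>h\<close> if \<open>h\<close> lies in \<open>coord_space I\<close>.\<close>

definition complex_coords :: "'n::finite set \<Rightarrow> (complex ^ 'n \<Rightarrow> complex) \<Rightarrow> complex ^ 'n" where
  "complex_coords I \<zeta> = (\<chi> i. if i \<in> I then \<Sum>b\<in>Basis. \<zeta> b * b $ i else 0)"

definition coord_proj :: "'n::finite set \<Rightarrow> complex ^ 'n \<Rightarrow> complex ^ 'n" where
  "coord_proj I v = (\<chi> i. if i \<in> I then v $ i else 0)"

lemma complex_coords_in [simp]: "complex_coords I \<zeta> \<in> coord_space I"
  and coord_proj_in [simp]: "coord_proj I v \<in> coord_space I"
  by (simp_all add: complex_coords_def coord_proj_def coord_space_def)

lemma complex_coords_eq_sum: "complex_coords I \<zeta> = (\<Sum>b\<in>Basis. \<zeta> b *s coord_proj I b)"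
  by (simp add: complex_coords_def coord_proj_def vec_eq_iff)

lemma complex_coords_fun_upd:
  assumes "b \<in> Basis"
  shows "complex_coords I (\<zeta>(b := w)) = complex_coords I (\<zeta>(b := 0)) + w *s coord_proj I b"
proof -
  have "(\<Sum>b'\<in>Basis - {b}. (\<zeta>(b := w)) b' *s coord_proj I b') = (\<Sum>b'\<in>Basis - {b}. (\<zeta>(b := 0)) b' *s coord_proj I b')"
    by (rule sum.cong) auto
  thus ?thesis unfolding complex_coords_eq_sum using assms by (simp add: sum.remove[OF finite_Basis assms])
qed

lemma norm_complex_coords: "norm (complex_coords I \<zeta>) \<le> (\<Sum>b\<in>Basis. cmod (\<zeta> b))"
  unfolding complex_coords_eq_sum
proof (rule sum_norm_le)
  fix b :: "complex ^ 'a" assume b: "b \<in> Basis"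
  have "norm (coord_proj I b) \<le> norm b"
    unfolding norm_vec_def coord_proj_def by (intro L2_set_mono) auto
  thus "norm (\<zeta> b *s coord_proj I b) \<le> cmod (\<zeta> b)"
    using b by (simp add: norm_vector_scalar_mult mult_left_le)
qed

lemma complex_coords_real:
  assumes "h \<in> coord_space I" and "\<And>b. b \<in> Basis \<Longrightarrow> \<zeta> b = of_real (h \<bullet> b)"
  shows "complex_coords I \<zeta> = h"
proof (rule vec_eq_iff[THEN iffD2], rule allI)
  fix i
  have "(\<Sum>b\<in>Basis. \<zeta> b * b $ i) = (\<Sum>b\<in>Basis. (h \<bullet> b) *\<^sub>R b) $ i"
    using assms(2) by (simp add: scaleR_conv_of_real[where 'a = complex])
  also have "(\<Sum>b\<in>Basis. (h \<bullet> b) *\<^sub>R b) = h" by (rule euclidean_representation)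
  finally show "complex_coords I \<zeta> $ i = h $ i"
    using assms(1) by (simp add: complex_coords_def coord_space_def)
qed

section \<open>Uniform estimates near a parameter\<close>

context local_family
begin

text \<open>One rate \<open>\<theta>\<close> serves all nearby \<open>z\<close>: the ratios are
  close to 1 by the Schwarz lemma, so the contraction of the system at \<open>z0\<close> carries
  over to coded points of the others. Univalent distortion on the common \<open>V\<close> turns this
  into sizes of cylinders.\<close>

lemma derivative_estimates:
  obtains R \<theta> C where "R > 0" "0 < \<theta>" "\<theta> < 1" "C \<ge> 0" "nbhd R \<subseteq> W"
    "\<And>z i \<omega>. z \<in> nbhd R \<Longrightarrow> cmod (ratio z i \<omega> - 1) \<le> 1 / 2"
    "\<And>n z i \<omega> \<tau>. z \<in> nbhd R \<Longrightarrow> agree n \<omega> \<tau> \<Longrightarrow>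
       cmod (D z i \<omega> - D z i \<tau>) \<le> C * \<theta> ^ n * cmod (D z i \<tau>)"
proof -
  obtain R0 where R0: "R0 > 0" "nbhd R0 \<subseteq> W"
  proof -
    obtain O' where O': "open O'" "W = coord_space I \<inter> O'" using W(1) by (auto simp: openin_open)
    then obtain r where "r > 0" "ball z0 r \<subseteq> O'" using W(2) open_contains_ball_eq by blast
    thus ?thesis using O' by (intro that[of r]) auto
  qed
  obtain s where "univalent_ifs X V (\<Phi> z0) (\<Psi> z0) s" using ifs W by blast
  then interpret base: univalent_ifs X V "\<Phi> z0" "\<Psi> z0" s .
  obtain K where K: "K \<ge> 1"
    "\<And>f x y z. univalent_on f V \<Longrightarrow> x \<in> X \<Longrightarrow> y \<in> X \<Longrightarrow> z \<in> X \<Longrightarrow> cmod (f x - f y) \<le> K * cmod (deriv f z)"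
    "\<And>f x y. univalent_on f V \<Longrightarrow> x \<in> X \<Longrightarrow> y \<in> X \<Longrightarrow>
       cmod (deriv f x - deriv f y) \<le> K * cmod (x - y) * cmod (deriv f y)"
    using univalent_distortion[OF X(1,2) V] by metis
  have B1: "B \<ge> 1" using ratio_le[OF W(2), of 0 "\<lambda>_. 0"] by simp
  \<comment> \<open>\<open>\<delta>\<close> ensures
    \<open>(1 + \<delta>) * s \<le> (1 + s) / 2\<close>, the value of \<open>\<theta>\<close>; then
    \<open>R\<close> makes the Schwarz bound \<open>2 * (B + 1) * R / R0\<close> at most
    \<open>\<delta>\<close>.\<close>
  define \<delta> where "\<delta> = min (1 / 2) ((1 - s) / (2 * s))"
  have \<delta>: "\<delta> > 0" "\<delta> \<le> 1 / 2" "\<delta> \<le> (1 - s) / (2 * s)" using base.s by (auto simp: \<delta>_def)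
  define R where "R = min R0 (\<delta> * R0 / (2 * (B + 1)))"
  define \<theta> where "\<theta> = (1 + s) / 2"
  have R: "R > 0" "R \<le> R0" "R \<le> \<delta> * R0 / (2 * (B + 1))" using R0 \<delta> B1 by (auto simp: R_def)
  have \<theta>: "0 < \<theta>" "\<theta> < 1" using base.s by (auto simp: \<theta>_def)
  have sub: "nbhd R \<subseteq> W" using R0 R by force
  have near: "cmod (ratio z i \<omega> - 1) \<le> \<delta>" if z: "z \<in> nbhd R" for z i \<omega>
  proof -
    have "cmod (ratio z i \<omega> - 1) \<le> 2 * (B + 1) * norm (z - z0) / R0"
    proof (rule line_holomorphic_Schwarz[OF z0_coord R0(1), of "\<lambda>z. ratio z i \<omega> - 1"])
      show "line_holomorphic I (nbhd R0) (\<lambda>z. ratio z i \<omega> - 1)"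
        using line_holomorphic_subset[OF line_holomorphic_ratio R0(2), of i \<omega>]
        unfolding line_holomorphic_def by (auto intro!: holomorphic_intros)
      show "cmod (ratio z i \<omega> - 1) \<le> B + 1" if "z \<in> nbhd R0" for z
        using norm_triangle_ineq4[of "ratio z i \<omega>" 1] ratio_le[of z i \<omega>] that R0(2) by fastforce
    qed (use z R in auto)
    also have "\<dots> \<le> 2 * (B + 1) * R / R0"
      using z B1 R0 by (intro divide_right_mono mult_left_mono) (auto simp: dist_norm norm_minus_commute)
    also have "\<dots> \<le> \<delta>" using R(3) B1 R0 by (simp add: field_simps)
    finally show ?thesis .
  qed
  have D_le: "cmod (D z i \<omega>) \<le> \<theta>" if z: "z \<in> nbhd R" for z i \<omega>
  proof -
    have "cmod (ratio z i \<omega>) \<le> cmod (ratio z i \<omega> - 1) + 1"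
      using norm_triangle_ineq[of "ratio z i \<omega> - 1" 1] by simp
    hence 1: "cmod (ratio z i \<omega>) \<le> 1 + (1 - s) / (2 * s)" using near[OF z, of i \<omega>] \<delta>(3) by linarith
    have 2: "cmod (D z0 i \<omega>) \<le> s" using base.deriv_word_le[OF base.coding_in_X, of "[i]" \<omega>] by (simp add: D_def)
    have "cmod (D z i \<omega>) = cmod (ratio z i \<omega>) * cmod (D z0 i \<omega>)"
      using D_nonzero[OF W(2)] by (simp add: ratio_def norm_divide)
    also have "\<dots> \<le> (1 + (1 - s) / (2 * s)) * s" using 1 2 base.s by (intro mult_mono) auto
    also have "\<dots> = \<theta>" using base.s by (simp add: \<theta>_def field_simps)
    finally show ?thesis .
  qed
  show ?thesis
  proof (rule that[OF R(1) \<theta> _ sub])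
    \<comment> \<open>One factor \<open>K\<close> bounds the distance of the codes, the other the
      oscillation of the derivative.\<close>
    show "K * K \<ge> 0" by simp
    show "cmod (ratio z i \<omega> - 1) \<le> 1 / 2" if "z \<in> nbhd R" for z i \<omega>
      using near[OF that] \<delta>(2) by (rule order_trans)
    fix n z i \<omega> \<tau> assume z: "z \<in> nbhd R" and ag: "agree n \<omega> \<tau>"
    have zW: "z \<in> W" using z sub by blast
    then obtain s' where "univalent_ifs X V (\<Phi> z) (\<Psi> z) s'" using ifs by blast
    then interpret univalent_ifs X V "\<Phi> z" "\<Psi> z" s' .
    obtain w x y where w: "length w = n" "x \<in> X" "y \<in> X"
        "code z \<omega> = word_map (\<Phi> z) w x" "code z \<tau> = word_map (\<Phi> z) w y"
      using agree_coding[OF ag] .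
    have "cmod (code z \<omega> - code z \<tau>) \<le> K * cmod (deriv (word_map (\<Psi> z) w) (code z \<tau>))"
      using K(2)[OF univalent_word w(2,3) coding_in_X, of w \<tau>] w by (simp add: word_extends)
    also have "\<dots> \<le> K * \<theta> ^ n"
      using D_product[OF zW D_le[OF z], of w \<tau>] w(1) K(1) by (intro mult_left_mono) auto
    finally have 1: "cmod (code z \<omega> - code z \<tau>) \<le> K * \<theta> ^ n" .
    have "cmod (D z i \<omega> - D z i \<tau>) \<le> K * cmod (code z \<omega> - code z \<tau>) * cmod (D z i \<tau>)"
      unfolding D_def by (rule K(3)[OF univalent coding_in_X coding_in_X])
    also have "\<dots> \<le> K * (K * \<theta> ^ n) * cmod (D z i \<tau>)" using 1 K(1) by (intro mult_right_mono mult_left_mono) auto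
    finally show "cmod (D z i \<omega> - D z i \<tau>) \<le> K * K * \<theta> ^ n * cmod (D z i \<tau>)" by (simp add: mult_ac)
  qed
qed

definition pot :: "complex ^ 'n \<Rightarrow> (nat \<Rightarrow> nat) \<Rightarrow> real" where
  "pot z \<omega> = t * ln (cmod (D z (\<omega> 0) (shift \<omega>)))"

definition log_ratio :: "complex ^ 'n \<Rightarrow> (nat \<Rightarrow> nat) \<Rightarrow> complex" where
  "log_ratio z \<omega> = Ln (ratio z (\<omega> 0) (shift \<omega>))"

text \<open>The small oscillation comes from a second use of the Schwarz lemma: the difference of
  the logarithms at two words with a common prefix is holomorphic in \<open>z\<close>, vanishes at
  \<open>z0\<close> and is at most \<open>C1 * \<theta> ^ n\<close>. So it gains the factor
  \<open>norm (z - z0)\<close> and keeps \<open>\<theta> ^ n\<close>.\<close>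

lemma log_ratio_estimates:
  obtains R \<theta> C where "R > 0" "0 < \<theta>" "\<theta> < 1" "C > 0" "nbhd R \<subseteq> W"
    "\<And>\<omega>. line_holomorphic I (nbhd R) (\<lambda>z. log_ratio z \<omega>)"
    "\<And>z \<omega>. z \<in> nbhd R \<Longrightarrow> cmod (log_ratio z \<omega>) \<le> C * norm (z - z0)"
    "\<And>z. z \<in> nbhd R \<Longrightarrow> prefix_Hoelder \<theta> (C * norm (z - z0)) (log_ratio z)"
    "prefix_Hoelder \<theta> C (pot z0)"
proof -
  obtain R \<theta> C where R: "R > 0" and \<theta>: "0 < \<theta>" "\<theta> < 1" and C: "C \<ge> 0" and sub: "nbhd R \<subseteq> W"
    and near: "\<And>z i \<omega>. z \<in> nbhd R \<Longrightarrow> cmod (ratio z i \<omega> - 1) \<le> 1 / 2"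
    and Dd: "\<And>n z i \<omega> \<tau>. z \<in> nbhd R \<Longrightarrow> agree n \<omega> \<tau> \<Longrightarrow>
       cmod (D z i \<omega> - D z i \<tau>) \<le> C * \<theta> ^ n * cmod (D z i \<tau>)"
    by (rule derivative_estimates) metis
  \<comment> \<open>The outer 2 is the Lipschitz constant of \<open>Ln\<close> on the disc of radius
    1/2 about 1, 3/2 bounds the ratio, and \<open>C * (C + 2)\<close> comes from the bound on
    \<open>a * b - 1\<close> below.\<close>
  define C1 where "C1 = 2 * (3 / 2 * (C * (C + 2)))"
  define C2 where "C2 = 2 / R + 2 * C1 / R + t * C"
  have C1: "C1 \<ge> 0" using C by (simp add: C1_def)
  have C2: "2 / R \<le> C2" "2 * C1 / R \<le> C2" "t * C \<le> C2"
    using C C1 R t by (simp_all add: C2_def)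
  have C2_pos: "C2 > 0" using less_le_trans[OF _ C2(1)] R by simp
  have z0B: "z0 \<in> nbhd R" using z0_coord R by simp
  have quot: "cmod (D z i \<omega> / D z i \<tau> - 1) \<le> C * \<theta> ^ n"
    if "z \<in> nbhd R" "agree n \<omega> \<tau>" for n z i \<omega> \<tau>
  proof -
    have nz: "D z i \<tau> \<noteq> 0" using D_nonzero that(1) sub by blast
    have "D z i \<omega> / D z i \<tau> - 1 = (D z i \<omega> - D z i \<tau>) / D z i \<tau>" using nz by (simp add: field_simps)
    thus ?thesis using Dd[OF that, of i] nz by (simp add: norm_divide divide_le_eq)
  qed
  have hol: "line_holomorphic I (nbhd R) (\<lambda>z. log_ratio z \<omega>)" for \<omega>
    unfolding line_holomorphic_def log_ratio_def
  proof (intro ballI holomorphic_on_Ln')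
    fix z v assume zv: "z \<in> coord_space I" "v \<in> coord_space I"
    show "(\<lambda>w. ratio (z + w *s v) (\<omega> 0) (shift \<omega>)) holomorphic_on {w. z + w *s v \<in> nbhd R}"
      by (rule line_holomorphicD[OF line_holomorphic_ratio zv]) (use sub in auto)
    show "ratio (z + w *s v) (\<omega> 0) (shift \<omega>) \<notin> \<real>\<^sub>\<le>\<^sub>0" if "w \<in> {w. z + w *s v \<in> nbhd R}" for w
      by (rule half_disc_not_nonpos_Reals[OF near]) (use that in blast)
  qed
  have diff: "cmod (log_ratio z (i ## \<omega>) - log_ratio z (i ## \<tau>)) \<le> C1 * \<theta> ^ n"
    if z: "z \<in> nbhd R" and ag: "agree n \<omega> \<tau>" for n z i \<omega> \<tau>
  proof -
    \<comment> \<open>The derivatives at the two codes are compared at \<open>z\<close> and,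
      inverted, at \<open>z0\<close>; the product \<open>a * b\<close> is the quotient of the two
      ratios.\<close>
    define a b where "a = D z i \<omega> / D z i \<tau>" and "b = D z0 i \<tau> / D z0 i \<omega>"
    have nz: "D z i \<omega> \<noteq> 0" "D z0 i \<omega> \<noteq> 0" for \<omega> using D_nonzero z sub W(2) by blast+
    have ab: "cmod (a - 1) \<le> C * \<theta> ^ n" "cmod (b - 1) \<le> C * \<theta> ^ n"
      unfolding a_def b_def by (rule quot[OF z ag], rule quot[OF z0B agree_sym[OF ag]])
    have \<theta>n: "0 \<le> C * \<theta> ^ n" "C * \<theta> ^ n \<le> C" using C \<theta> by (auto simp: mult_left_le power_le_one)
    have "cmod b \<le> 1 + C" using ab(2) \<theta>n norm_triangle_ineq[of "b - 1" 1] by simp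
    hence "cmod (a - 1) * cmod b + cmod (b - 1) \<le> C * \<theta> ^ n * (1 + C) + C * \<theta> ^ n"
      using ab \<theta>n by (intro add_mono mult_mono) auto
    moreover have "a * b - 1 = (a - 1) * b + (b - 1)" by (simp add: algebra_simps)
    ultimately have "cmod (a * b - 1) \<le> C * \<theta> ^ n * (1 + C) + C * \<theta> ^ n"
      by (metis norm_mult norm_triangle_ineq order_trans)
    hence abn: "cmod (a * b - 1) \<le> C * (C + 2) * \<theta> ^ n" by (simp add: algebra_simps)
    have req: "ratio z i \<omega> - ratio z i \<tau> = ratio z i \<tau> * (a * b - 1)"
      using nz by (simp add: ratio_def a_def b_def field_simps)
    have rn: "cmod (ratio z i \<tau>) \<le> 3 / 2"
      using near[OF z, of i \<tau>] norm_triangle_ineq[of "ratio z i \<tau> - 1" 1] by simp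
    have "cmod (ratio z i \<omega> - ratio z i \<tau>) \<le> 3 / 2 * (C * (C + 2) * \<theta> ^ n)"
      unfolding req norm_mult by (rule mult_mono[OF rn abn]) simp_all
    moreover have "cmod (log_ratio z (i ## \<omega>) - log_ratio z (i ## \<tau>)) \<le> 2 * cmod (ratio z i \<omega> - ratio z i \<tau>)"
      unfolding log_ratio_def using near[OF z, of i] by (auto simp: dist_norm norm_minus_commute intro!: norm_Ln_diff_le)
    ultimately show ?thesis by (simp add: C1_def)
  qed
  have at_z0: "log_ratio z0 \<omega> = 0" for \<omega> by (simp add: log_ratio_def)
  show ?thesis
  proof (rule that[OF R \<theta> C2_pos sub hol])
    fix z \<omega> assume z: "z \<in> nbhd R"
    have "cmod (log_ratio z \<omega>) \<le> 2 * 1 * norm (z - z0) / R"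
      by (rule line_holomorphic_Schwarz[OF z0_coord R hol _ at_z0 z])
         (auto simp: log_ratio_def intro!: norm_Ln_half_disc near)
    also have "\<dots> = 2 / R * norm (z - z0)" by simp
    also have "\<dots> \<le> C2 * norm (z - z0)" by (intro mult_right_mono C2) simp
    finally show "cmod (log_ratio z \<omega>) \<le> C2 * norm (z - z0)" .
  next
    fix z assume z: "z \<in> nbhd R"
    show "prefix_Hoelder \<theta> (C2 * norm (z - z0)) (log_ratio z)"
      unfolding prefix_Hoelder_def
    proof (intro allI impI)
      fix n i and \<omega> \<tau> assume ag: "agree n \<omega> \<tau>"
      have "cmod (log_ratio z (i ## \<omega>) - log_ratio z (i ## \<tau>)) \<le> 2 * (C1 * \<theta> ^ n) * norm (z - z0) / R"
      proof (rule line_holomorphic_Schwarz[OF z0_coord R _ _ _ z])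
        show "line_holomorphic I (nbhd R) (\<lambda>z. log_ratio z (i ## \<omega>) - log_ratio z (i ## \<tau>))"
          using hol[of "i ## \<omega>"] hol[of "i ## \<tau>"] unfolding line_holomorphic_def
          by (intro ballI holomorphic_on_diff) simp_all
      qed (use diff[OF _ ag] at_z0 in auto)
      also have "\<dots> = 2 * C1 / R * (\<theta> ^ n * norm (z - z0))" by simp
      also have "\<dots> \<le> C2 * (\<theta> ^ n * norm (z - z0))" using \<theta> by (intro mult_right_mono C2) simp
      finally show "cmod (log_ratio z (i ## \<omega>) - log_ratio z (i ## \<tau>)) \<le> C2 * norm (z - z0) * \<theta> ^ n"
        by (simp add: mult_ac)
    qed
  next
    have nz: "D z0 i \<omega> \<noteq> 0" for i \<omega> using D_nonzero W(2) by blast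
    have le: "ln (cmod (D z0 i \<omega>)) - ln (cmod (D z0 i \<tau>)) \<le> C * \<theta> ^ n" if "agree n \<omega> \<tau>" for n i \<omega> \<tau>
    proof -
      have "ln (cmod (D z0 i \<omega>)) - ln (cmod (D z0 i \<tau>)) = ln (cmod (D z0 i \<omega> / D z0 i \<tau>))"
        using nz by (simp add: norm_divide ln_div)
      also have "\<dots> \<le> cmod (D z0 i \<omega> / D z0 i \<tau>) - 1" using nz by (intro ln_le_minus_one) simp
      also have "\<dots> \<le> cmod (D z0 i \<omega> / D z0 i \<tau> - 1)" using norm_triangle_ineq2[of "D z0 i \<omega> / D z0 i \<tau>" 1] by simp
      also have "\<dots> \<le> C * \<theta> ^ n" by (rule quot[OF z0B that])
      finally show ?thesis .
    qed
    show "prefix_Hoelder \<theta> C2 (pot z0)"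
      unfolding prefix_Hoelder_def
    proof (intro allI impI)
      fix n i and \<omega> \<tau> assume ag: "agree n \<omega> \<tau>"
      have "norm (pot z0 (i ## \<omega>) - pot z0 (i ## \<tau>)) = t * \<bar>ln (cmod (D z0 i \<omega>)) - ln (cmod (D z0 i \<tau>))\<bar>"
        using t by (simp add: pot_def abs_mult flip: right_diff_distrib)
      also have "\<dots> \<le> t * (C * \<theta> ^ n)" using le[OF ag, of i] le[OF agree_sym[OF ag], of i] t by (intro mult_left_mono) auto
      also have "\<dots> \<le> C2 * \<theta> ^ n" using mult_right_mono[OF C2(3), of "\<theta> ^ n"] \<theta> by simp
      finally show "norm (pot z0 (i ## \<omega>) - pot z0 (i ## \<tau>)) \<le> C2 * \<theta> ^ n" .
    qed
  qed
qed

end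

section \<open>The complexified potential and its partition sums\<close>

context local_family
begin

definition TT :: "complex ^ 'n \<Rightarrow> nat \<Rightarrow> nat \<Rightarrow> real" where
  "TT z m n = transfer {..<m} (pot z) n (\<lambda>_. 0)"

lemma TT_pos: "m > 0 \<Longrightarrow> TT z m n > 0"
  unfolding TT_def by (rule transfer_pos) auto

text \<open>\<open>ln (cmod u)\<close> is half the sum of \<open>Ln u\<close> and its conjugate.
  Conjugating the coordinates as well makes the second term holomorphic in \<open>\<zeta>\<close>;
  for real \<open>\<zeta>\<close> both arguments coincide, and the result is \<open>t\<close> times
  the logarithm of the modulus of the ratio.\<close>

definition perturbation :: "(complex ^ 'n \<Rightarrow> complex) \<Rightarrow> (nat \<Rightarrow> nat) \<Rightarrow> complex" where
  "perturbation \<zeta> \<omega> = of_real (t / 2) *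
     (log_ratio (z0 + complex_coords I \<zeta>) \<omega> + cnj (log_ratio (z0 + complex_coords I (\<lambda>b. cnj (\<zeta> b))) \<omega>))"

lemma pot_eq_real_perturbation:
  assumes z: "z0 + h \<in> W" and h: "h \<in> coord_space I"
    and \<zeta>: "\<And>b. b \<in> Basis \<Longrightarrow> \<zeta> b = of_real (h \<bullet> b)"
  shows "of_real (pot z0 \<omega>) + perturbation \<zeta> \<omega> = of_real (pot (z0 + h) \<omega>)"
proof -
  let ?r = "ratio (z0 + h) (\<omega> 0) (shift \<omega>)"
  have nz: "D (z0 + h) (\<omega> 0) (shift \<omega>) \<noteq> 0" "D z0 (\<omega> 0) (shift \<omega>) \<noteq> 0"
    using D_nonzero z W(2) by blast+
  hence rnz: "?r \<noteq> 0" by (simp add: ratio_def)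
  have "complex_coords I \<zeta> = h" "complex_coords I (\<lambda>b. cnj (\<zeta> b)) = h"
    by (rule complex_coords_real[OF h]; simp add: \<zeta>)+
  hence "perturbation \<zeta> \<omega> = of_real (t / 2) * of_real (2 * Re (Ln ?r))"
    unfolding perturbation_def log_ratio_def by (simp only: complex_add_cnj)
  also have "\<dots> = of_real (t * ln (cmod ?r))" using rnz by simp
  also have "ln (cmod ?r) = ln (cmod (D (z0 + h) (\<omega> 0) (shift \<omega>))) - ln (cmod (D z0 (\<omega> 0) (shift \<omega>)))"
    using nz by (simp add: ratio_def norm_divide ln_div)
  finally show ?thesis by (simp add: pot_def algebra_simps)
qed

text \<open>What extends holomorphically is the average of the principal logarithms of consecutive
  quotients. Each has modulus at most 1, so the average is bounded by 1 for all \<open>m\<close> and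
  \<open>n\<close>, and no branch for the whole quotient has to be followed. The series is claimed
  at real points of \<open>coord_space I\<close>, where the perturbed potential is the true
  one.\<close>

lemma transfer_quotient_power_series:
  obtains R where "R > 0" "nbhd R \<subseteq> W"
    "\<And>m n z. m > 0 \<Longrightarrow> z \<in> nbhd R \<Longrightarrow> \<bar>ln (TT z m n / TT z0 m n)\<bar> \<le> real n"
    "\<And>m n. m > 0 \<Longrightarrow> bounded_power_series Basis R 1
       ((\<lambda>h b. if b \<in> Basis then h \<bullet> b else 0) ` (coord_space I \<inter> ball 0 R))
       (\<lambda>x. ln (TT (z0 + (\<Sum>b\<in>Basis. x b *\<^sub>R b)) m n / TT z0 m n) / real n)"
proof -
  obtain R1 \<theta> C where R1: "R1 > 0" and \<theta>: "0 < \<theta>" "\<theta> < 1" and C: "C > 0" and sub: "nbhd R1 \<subseteq> W"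
    and hol: "\<And>\<omega>. line_holomorphic I (nbhd R1) (\<lambda>z. log_ratio z \<omega>)"
    and le: "\<And>z \<omega>. z \<in> nbhd R1 \<Longrightarrow> cmod (log_ratio z \<omega>) \<le> C * norm (z - z0)"
    and diff: "\<And>z. z \<in> nbhd R1 \<Longrightarrow> prefix_Hoelder \<theta> (C * norm (z - z0)) (log_ratio z)"
    and pot: "prefix_Hoelder \<theta> C (pot z0)"
    by (rule log_ratio_estimates) (rule that)
  define o' :: "nat \<Rightarrow> nat" where "o' = (\<lambda>_. 0)"
  obtain \<epsilon> where \<epsilon>: "\<epsilon> > 0" and stable: "\<And>E p o' k. finite E \<Longrightarrow> E \<noteq> {} \<Longrightarrow>
       \<forall>\<omega>. cmod (p \<omega>) \<le> \<epsilon> \<Longrightarrow> prefix_Hoelder \<theta> \<epsilon> p \<Longrightarrow> transfer_quotient E (pot z0) p k o' \<noteq> 0 \<and>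
       cmod (transfer_quotient E (pot z0) p (Suc k) o' / transfer_quotient E (pot z0) p k o' - 1) \<le> 1 / 2"
    by (rule transfer_quotient_stable[OF C \<theta> pot]) (rule that)
  \<comment> \<open>The summand 1 keeps the denominator positive when \<open>t = 0\<close>.\<close>
  define R2 where "R2 = min R1 (\<epsilon> / (t * C + 1))"
  have R2: "R2 > 0" "R2 \<le> R1" "t * C * R2 \<le> \<epsilon>"
  proof -
    have tC: "t * C \<ge> 0" using t C by (simp add: less_imp_le)
    show "R2 > 0" "R2 \<le> R1" using R1 \<epsilon> tC by (auto simp: R2_def)
    have "t * C * R2 \<le> (t * C + 1) * (\<epsilon> / (t * C + 1))"
      using tC \<epsilon> R1 by (intro mult_mono) (auto simp: R2_def)
    thus "t * C * R2 \<le> \<epsilon>" using tC by simp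
  qed
  define d where "d = real (card (Basis :: (complex ^ 'n) set))"
  \<comment> \<open>\<open>d\<close> counts the real directions, so a polydisc of radius
    \<open>R2 / d\<close> is mapped into a ball of radius \<open>R2\<close>.\<close>
  define R where "R = R2 / d"
  have d: "d > 0" by (simp add: d_def)
  have d1: "d \<ge> 1" using d unfolding d_def by (metis One_nat_def Suc_leI of_nat_0_less_iff of_nat_1 of_nat_le_iff)
  have R: "R > 0" "R \<le> R2" using R2 d d1 by (auto simp: R_def divide_le_eq mult_left_le mult_le_cancel_left1)
  have dR: "d * R = R2" using d by (simp add: R_def)
  have in_ball: "z0 + complex_coords I \<zeta> \<in> nbhd R2" if "\<And>b. b \<in> Basis \<Longrightarrow> cmod (\<zeta> b) < R" for \<zeta>
  proof -
    have "norm (complex_coords I \<zeta>) \<le> (\<Sum>b\<in>Basis. cmod (\<zeta> b))" by (rule norm_complex_coords)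
    also have "\<dots> < (\<Sum>b\<in>(Basis :: (complex ^ 'n) set). R)" by (rule sum_strict_mono) (use that in auto)
    also have "\<dots> = R2" using dR by (simp add: d_def)
    finally have "norm (complex_coords I \<zeta>) < R2" .
    moreover have "z0 + complex_coords I \<zeta> \<in> coord_space I"
      using coord_space_line[OF z0_coord complex_coords_in, of 1 \<zeta>] by simp
    ultimately show ?thesis by (simp add: dist_norm)
  qed
  have in_ball': "z0 + complex_coords I \<zeta> \<in> nbhd R1" "norm (complex_coords I \<zeta>) \<le> R2"
    if "\<And>b. b \<in> Basis \<Longrightarrow> cmod (\<zeta> b) < R" for \<zeta>
    using in_ball[of \<zeta>] that R2(2) by (auto simp: dist_norm)
  have p_le: "cmod (perturbation \<zeta> \<omega>) \<le> \<epsilon>"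
    and p_diff: "prefix_Hoelder \<theta> \<epsilon> (perturbation \<zeta>)"
    if \<zeta>: "\<zeta> \<in> polydisc Basis R" for \<zeta> \<omega>
  proof -
    define c1 c2 where "c1 = complex_coords I \<zeta>" and "c2 = complex_coords I (\<lambda>b. cnj (\<zeta> b))"
    have c1: "z0 + c1 \<in> nbhd R1" "norm c1 \<le> R2"
      and c2: "z0 + c2 \<in> nbhd R1" "norm c2 \<le> R2"
      using in_ball'[of \<zeta>] in_ball'[of "\<lambda>b. cnj (\<zeta> b)"] \<zeta> by (auto simp: polydisc_def c1_def c2_def)
    have half: "cmod (of_real (t / 2) * (a + cnj b)) \<le> t * M" if "cmod a \<le> M" "cmod b \<le> M" for a b M
    proof -
      have "cmod (a + cnj b) \<le> M + M" using that by (intro norm_triangle_le add_mono) auto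
      hence "t / 2 * cmod (a + cnj b) \<le> t / 2 * (M + M)" using t by (intro mult_left_mono) auto
      thus ?thesis using t by (simp add: norm_mult)
    qed
    have CR: "C * norm c1 \<le> C * R2" "C * norm c2 \<le> C * R2" using c1 c2 C by (auto intro: mult_left_mono)
    have "cmod (perturbation \<zeta> \<omega>) \<le> t * (C * R2)"
      unfolding perturbation_def c1_def[symmetric] c2_def[symmetric]
      using le[OF c1(1), of \<omega>] le[OF c2(1), of \<omega>] CR by (intro half) auto
    thus "cmod (perturbation \<zeta> \<omega>) \<le> \<epsilon>" using R2(3) by simp
    show "prefix_Hoelder \<theta> \<epsilon> (perturbation \<zeta>)"
      unfolding prefix_Hoelder_def
    proof (intro allI impI)
      fix n i and \<omega> \<tau> assume ag: "agree n \<omega> \<tau>"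
      let ?a = "log_ratio (z0 + c1) (i ## \<omega>) - log_ratio (z0 + c1) (i ## \<tau>)"
      let ?b = "log_ratio (z0 + c2) (i ## \<omega>) - log_ratio (z0 + c2) (i ## \<tau>)"
      have "perturbation \<zeta> (i ## \<omega>) - perturbation \<zeta> (i ## \<tau>) = of_real (t / 2) * (?a + cnj ?b)"
        unfolding perturbation_def c1_def[symmetric] c2_def[symmetric] by (simp only: complex_cnj_diff) (simp add: algebra_simps)
      also have "cmod \<dots> \<le> t * (C * R2 * \<theta> ^ n)"
      proof (rule half)
        have "C * norm c1 * \<theta> ^ n \<le> C * R2 * \<theta> ^ n" "C * norm c2 * \<theta> ^ n \<le> C * R2 * \<theta> ^ n"
          using CR \<theta> by (auto intro: mult_right_mono)
        thus "cmod ?a \<le> C * R2 * \<theta> ^ n" "cmod ?b \<le> C * R2 * \<theta> ^ n"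
          using prefix_HoelderD[OF diff[OF c1(1)] ag, of i] prefix_HoelderD[OF diff[OF c2(1)] ag, of i] by auto
      qed
      also have "\<dots> \<le> \<epsilon> * \<theta> ^ n" using mult_right_mono[OF R2(3), of "\<theta> ^ n"] \<theta> by (simp add: mult_ac)
      finally show "cmod (perturbation \<zeta> (i ## \<omega>) - perturbation \<zeta> (i ## \<tau>)) \<le> \<epsilon> * \<theta> ^ n" .
    qed
  qed
  have p_hol: "(\<lambda>w. perturbation (\<zeta>(b := w)) \<omega>) holomorphic_on ball 0 R"
    if b: "b \<in> Basis" and \<zeta>: "\<zeta> \<in> polydisc Basis R" for \<zeta> b \<omega>
  proof -
    have l_hol: "(\<lambda>w. log_ratio (z0 + complex_coords I (\<zeta>(b := w))) \<omega>) holomorphic_on ball 0 R"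
      if "\<zeta> \<in> polydisc Basis R" for \<zeta>
    proof -
      have "(\<lambda>w. log_ratio ((z0 + complex_coords I (\<zeta>(b := 0))) + w *s coord_proj I b) \<omega>) holomorphic_on ball 0 R"
      proof (rule line_holomorphicD[OF hol _ coord_proj_in])
        show "z0 + complex_coords I (\<zeta>(b := 0)) \<in> coord_space I"
          using coord_space_line[OF z0_coord complex_coords_in, of 1] by simp
        show "ball 0 R \<subseteq> {w. z0 + complex_coords I (\<zeta>(b := 0)) + w *s coord_proj I b \<in> nbhd R1}"
        proof
          fix w :: complex assume w: "w \<in> ball 0 R"
          have "z0 + complex_coords I (\<zeta>(b := w)) \<in> nbhd R1"
            by (rule in_ball'(1)) (use that w in \<open>auto simp: polydisc_def\<close>)
          thus "w \<in> {w. z0 + complex_coords I (\<zeta>(b := 0)) + w *s coord_proj I b \<in> nbhd R1}"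
            by (subst (asm) complex_coords_fun_upd[OF b, of I \<zeta> w]) (simp add: add.assoc)
        qed
      qed
      moreover have "log_ratio ((z0 + complex_coords I (\<zeta>(b := 0))) + w *s coord_proj I b) \<omega>
          = log_ratio (z0 + complex_coords I (\<zeta>(b := w))) \<omega>" for w
        by (subst complex_coords_fun_upd[OF b, of I \<zeta> w]) (simp only: add.assoc)
      ultimately show ?thesis by (rule holomorphic_transform)
    qed
    let ?\<zeta>' = "\<lambda>b. cnj (\<zeta> b)"
    have \<zeta>': "?\<zeta>' \<in> polydisc Basis R" using \<zeta> by (simp add: polydisc_def)
    have "cnj ` ball 0 R = ball 0 R"
      by (auto simp: image_iff intro!: bexI[of _ "cnj _"])
    hence "cnj \<circ> (\<lambda>w. log_ratio (z0 + complex_coords I (?\<zeta>'(b := w))) \<omega>) \<circ> cnj holomorphic_on ball 0 R"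
      using l_hol[OF \<zeta>'] by (intro holomorphic_on_compose_cnj_cnj) auto
    moreover have "(\<lambda>c. cnj ((\<zeta>(b := w)) c)) = ?\<zeta>'(b := cnj w)" for w by (auto simp: fun_eq_iff)
    ultimately have "(\<lambda>w. cnj (log_ratio (z0 + complex_coords I (\<lambda>c. cnj ((\<zeta>(b := w)) c))) \<omega>)) holomorphic_on ball 0 R"
      by (simp only: o_def)
    thus ?thesis unfolding perturbation_def using l_hol[OF \<zeta>] by (intro holomorphic_intros)
  qed
  define r where "r m k \<zeta> = transfer_quotient {..<m} (pot z0) (perturbation \<zeta>) k o'" for m k \<zeta>
  \<comment> \<open>For \<open>n = 0\<close> division by zero makes \<open>q\<close> vanish, as does
    the quotient by \<open>real n\<close> in the claim.\<close>
  define q where "q m n \<zeta> = (\<Sum>k<n. Ln (r m (Suc k) \<zeta> / r m k \<zeta>)) / of_nat n" for m n \<zeta>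
  have r0: "r m k \<zeta> \<noteq> 0" and r_half: "cmod (r m (Suc k) \<zeta> / r m k \<zeta> - 1) \<le> 1 / 2"
    if "m > 0" "\<zeta> \<in> polydisc Basis R" for m k \<zeta>
    unfolding r_def using stable[OF finite_lessThan _ _ p_diff[OF that(2)], of m k o'] p_le[OF that(2)] that(1) by auto
  have q_le: "cmod (q m n \<zeta>) \<le> 1" if "m > 0" "\<zeta> \<in> polydisc Basis R" for m n \<zeta>
  proof -
    have "cmod (\<Sum>k<n. Ln (r m (Suc k) \<zeta> / r m k \<zeta>)) \<le> (\<Sum>k<n. 1)"
      by (intro sum_norm_le norm_Ln_half_disc r_half that)
    thus ?thesis by (cases "n = 0") (auto simp: q_def norm_divide divide_le_eq)
  qed
  have q_hol: "(\<lambda>w. q m n (\<zeta>(b := w))) holomorphic_on ball 0 R"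
    if "m > 0" and b: "b \<in> Basis" and \<zeta>: "\<zeta> \<in> polydisc Basis R" for m n b \<zeta>
  proof -
    have PD: "\<zeta>(b := w) \<in> polydisc Basis R" if "w \<in> ball 0 R" for w
      using that b \<zeta> by (auto simp: polydisc_def)
    have rh: "(\<lambda>w. r m k (\<zeta>(b := w))) holomorphic_on ball 0 R" for k
      unfolding r_def transfer_quotient_def using TT_pos[OF that(1), of z0 k, unfolded TT_def]
      by (intro holomorphic_intros holomorphic_transfer p_hol b \<zeta>) auto
    show ?thesis
    proof (cases "n = 0")
      case False
      show ?thesis
        unfolding q_def
        by (intro holomorphic_intros rh half_disc_not_nonpos_Reals r_half r0 PD that(1)) (use False in auto)
    qed (simp add: q_def)
  qed
  have q_real: "q m n \<zeta> = of_real (ln (TT (z0 + h) m n / TT z0 m n) / real n)"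
    if m: "m > 0" and z: "z0 + h \<in> W" and h: "h \<in> coord_space I" and \<zeta>: "\<And>b. b \<in> Basis \<Longrightarrow> \<zeta> b = of_real (h \<bullet> b)" for m n h \<zeta>
  proof -
    define y where "y k = TT (z0 + h) m k / TT z0 m k" for k
    have y0: "y k > 0" for k using TT_pos[OF m] by (simp add: y_def)
    have pot_eq: "(\<lambda>\<omega>. of_real (pot z0 \<omega>) + perturbation \<zeta> \<omega>) = (\<lambda>\<omega>. complex_of_real (pot (z0 + h) \<omega>))"
      by (rule ext) (rule pot_eq_real_perturbation[OF z h \<zeta>])
    have ry: "r m k \<zeta> = of_real (y k)" for k
      unfolding r_def y_def transfer_quotient_def pot_eq by (simp add: TT_def o'_def of_real_transfer)
    have "Ln (r m (Suc k) \<zeta> / r m k \<zeta>) = of_real (ln (y (Suc k)) - ln (y k))" for k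
    proof -
      have "Ln (r m (Suc k) \<zeta> / r m k \<zeta>) = Ln (of_real (y (Suc k) / y k))" by (simp add: ry)
      also have "\<dots> = of_real (ln (y (Suc k) / y k))" by (rule Ln_of_real) (use y0 in simp)
      finally show ?thesis using y0[of k] y0[of "Suc k"] by (simp add: ln_div)
    qed
    hence "q m n \<zeta> = of_real ((\<Sum>k<n. ln (y (Suc k)) - ln (y k)) / real n)" by (simp add: q_def)
    also have "(\<Sum>k<n. ln (y (Suc k)) - ln (y k)) = ln (y n)"
      unfolding sum_lessThan_telescope[of "\<lambda>k. ln (y k)"] by (simp add: y_def TT_def)
    finally show ?thesis by (simp add: y_def)
  qed
  define lift :: "complex ^ 'n \<Rightarrow> complex ^ 'n \<Rightarrow> complex" where
    "lift h b = (if b \<in> Basis then of_real (h \<bullet> b) else 0)" for h b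
  have lift: "lift h \<in> polydisc Basis R" if "h \<in> ball 0 R" for h
    using that Basis_le_norm[of _ h] by (auto simp: polydisc_def lift_def intro: le_less_trans)
  have sub_R: "nbhd R \<subseteq> W" using sub R R2 by force
  have in_W: "z0 + h \<in> W" if "h \<in> coord_space I \<inter> ball 0 R" for h
    using that sub_R coord_space_line[OF z0_coord, of h 1] by (auto simp: dist_norm)
  show ?thesis
  proof (rule that[OF R(1) sub_R])
    fix m n :: nat and z assume m: "m > 0" and z: "z \<in> nbhd R"
    define h where "h = z - z0"
    have h: "h \<in> coord_space I \<inter> ball 0 R" and zh: "z = z0 + h"
      using z coord_space_diff[OF _ z0_coord] by (auto simp: h_def dist_norm norm_minus_commute)
    have "cmod (q m n (lift h)) \<le> 1" using q_le[OF m lift] h by auto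
    also have "q m n (lift h) = of_real (ln (TT z m n / TT z0 m n) / real n)"
      unfolding zh by (rule q_real[OF m in_W[OF h]]) (use h in \<open>auto simp: lift_def\<close>)
    finally have 1: "\<bar>ln (TT z m n / TT z0 m n) / real n\<bar> \<le> 1" by (simp only: norm_of_real)
    show "\<bar>ln (TT z m n / TT z0 m n)\<bar> \<le> real n"
    proof (cases "n = 0")
      case False thus ?thesis using 1 by (simp add: abs_divide divide_le_eq)
    qed (simp add: TT_def)
  next
    fix m n :: nat assume m: "m > 0"
    have "bounded_power_series Basis R 1 (polydisc Basis R) (q m n)"
      using separately_holomorphic_power_series[OF finite_Basis R(1) q_hol[OF m] q_le[OF m]] .
    then obtain c where c: "\<And>\<alpha>. \<alpha> \<in> multi_indices Basis \<Longrightarrow> cmod (c \<alpha>) \<le> 1 / R ^ sum \<alpha> Basis"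
      "\<And>\<zeta>. \<zeta> \<in> polydisc Basis R \<Longrightarrow> ((\<lambda>\<alpha>. c \<alpha> * (\<Prod>b\<in>Basis. \<zeta> b ^ \<alpha> b)) has_sum q m n \<zeta>) (multi_indices Basis)"
      unfolding bounded_power_series_def by blast
    show "bounded_power_series Basis R 1 ((\<lambda>h b. if b \<in> Basis then h \<bullet> b else 0) ` (coord_space I \<inter> ball 0 R))
       (\<lambda>x. ln (TT (z0 + (\<Sum>b\<in>Basis. x b *\<^sub>R b)) m n / TT z0 m n) / real n)"
      unfolding bounded_power_series_def
    \<comment> \<open>Since \<open>q\<close> and the monomials are real at real points, the real
      parts of the coefficients give the same sums there.\<close>
    proof (intro exI[of _ "\<lambda>\<alpha>. Re (c \<alpha>)"] conjI ballI)
      show "norm (Re (c \<alpha>)) \<le> 1 / R ^ sum \<alpha> Basis" if "\<alpha> \<in> multi_indices Basis" for \<alpha>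
        using abs_Re_le_cmod[of "c \<alpha>"] c(1)[OF that] by simp
      fix x assume "x \<in> (\<lambda>h b. if b \<in> Basis then h \<bullet> b else 0) ` (coord_space I \<inter> ball 0 R)"
      then obtain h where h: "h \<in> coord_space I \<inter> ball 0 R" and x: "x = (\<lambda>b. if b \<in> Basis then h \<bullet> b else 0)" by blast
      have hx: "(\<Sum>b\<in>Basis. x b *\<^sub>R b) = h" using euclidean_representation[of h] by (simp add: x)
      have lx: "lift h b = of_real (x b)" for b by (simp add: lift_def x)
      have "((\<lambda>\<alpha>. Re (c \<alpha> * (\<Prod>b\<in>Basis. lift h b ^ \<alpha> b))) has_sum Re (q m n (lift h))) (multi_indices Basis)"
        by (rule has_sum_Re[OF c(2)[OF lift]]) (use h in blast)
      moreover have "Re (c \<alpha> * (\<Prod>b\<in>Basis. lift h b ^ \<alpha> b)) = Re (c \<alpha>) * (\<Prod>b\<in>Basis. x b ^ \<alpha> b)" for \<alpha>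
      proof -
        have "(\<Prod>b\<in>Basis. lift h b ^ \<alpha> b) = of_real (\<Prod>b\<in>Basis. x b ^ \<alpha> b)" by (simp add: lx)
        moreover have "Re (u * of_real v) = Re u * v" for u v by simp
        ultimately show ?thesis by (simp only:)
      qed
      moreover have "q m n (lift h) = of_real (ln (TT (z0 + h) m n / TT z0 m n) / real n)"
        by (rule q_real[OF m in_W[OF h]]) (use h in \<open>auto simp: lift_def\<close>)
      ultimately show "((\<lambda>\<alpha>. Re (c \<alpha>) * (\<Prod>b\<in>Basis. x b ^ \<alpha> b)) has_sum
          ln (TT (z0 + (\<Sum>b\<in>Basis. x b *\<^sub>R b)) m n / TT z0 m n) / real n) (multi_indices Basis)"
        unfolding hx by (simp only: Re_complex_of_real)
    qed
  qed
qed

end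

section \<open>Local behaviour of the pressure\<close>

context local_family
begin

lemma distorted:
  assumes "z \<in> W" obtains s K where "distorted_ifs X V (\<Phi> z) (\<Psi> z) s K t"
    "\<And>m n. distorted_ifs.T X (\<Phi> z) (\<Psi> z) t m n (\<lambda>_. 0) = TT z m n"
proof -
  obtain K where K: "K \<ge> 1"
    "\<And>f x y. univalent_on f V \<Longrightarrow> x \<in> X \<Longrightarrow> y \<in> X \<Longrightarrow> cmod (deriv f x) \<le> K * cmod (deriv f y)"
    using univalent_distortion[OF X(1,2) V] by metis
  obtain s where "univalent_ifs X V (\<Phi> z) (\<Psi> z) s" using ifs assms by blast
  then interpret univalent_ifs X V "\<Phi> z" "\<Psi> z" s .
  interpret distorted_ifs X V "\<Phi> z" "\<Psi> z" s K t
    by unfold_locales (use K univalent_word t in auto)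
  have "potential t = pot z" by (simp add: fun_eq_iff potential_def pot_def D_def)
  thus ?thesis using that[OF distorted_ifs_axioms] by (simp add: T_def TT_def)
qed

lemma TT_mono: "z \<in> W \<Longrightarrow> m \<le> m' \<Longrightarrow> TT z m n \<le> TT z m' n"
  by (erule distorted) (metis distorted_ifs.T_mono)

lemma TT_unbounded:
  assumes "z \<in> W" "\<not> bdd_above (range (\<lambda>m. TT z m 1))"
  shows "pressure X (\<Phi> z) t = \<infinity>"
proof -
  obtain s K where d: "distorted_ifs X V (\<Phi> z) (\<Psi> z) s K t"
    "\<And>m n. distorted_ifs.T X (\<Phi> z) (\<Psi> z) t m n (\<lambda>_. 0) = TT z m n" using distorted[OF assms(1)] by metis
  show ?thesis
    by (rule distorted_ifs.pressure_infinite[OF d(1), of "\<lambda>_. 0"]) (use assms(2) in \<open>simp add: d(2)\<close>)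
qed

lemma TT_bounded:
  assumes "z \<in> W" "bdd_above (range (\<lambda>m. TT z m 1))"
  shows "\<exists>p L. pressure X (\<Phi> z) t = ereal p \<and> (\<forall>n. L n > 0) \<and> (\<forall>n. (\<lambda>m. TT z m n) \<longlonglongrightarrow> L n) \<and>
    (\<lambda>n. ln (L n) / real n) \<longlonglongrightarrow> p"
proof -
  obtain s K where d: "distorted_ifs X V (\<Phi> z) (\<Psi> z) s K t"
    "\<And>m n. distorted_ifs.T X (\<Phi> z) (\<Psi> z) t m n (\<lambda>_. 0) = TT z m n" using distorted[OF assms(1)] by metis
  obtain p L where "pressure X (\<Phi> z) t = ereal p" "\<And>n. L n > 0" "\<And>n. (\<lambda>m. TT z m n) \<longlonglongrightarrow> L n"
      "(\<lambda>n. ln (L n) / real n) \<longlonglongrightarrow> p"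
    by (rule distorted_ifs.pressure_finite[OF d(1), of "\<lambda>_. 0", unfolded d(2), OF assms(2)]) (rule that)
  thus ?thesis by blast
qed

lemma TT_bounded_iff:
  assumes "z \<in> W"
  shows "pressure X (\<Phi> z) t < \<infinity> \<longleftrightarrow> bdd_above (range (\<lambda>m. TT z m 1))"
proof (cases "bdd_above (range (\<lambda>m. TT z m 1))")
  case True
  obtain p where "pressure X (\<Phi> z) t = ereal p" using TT_bounded[OF assms True] by (elim exE conjE)
  thus ?thesis using True by simp
next
  case False
  thus ?thesis using TT_unbounded[OF assms False] by simp
qed

text \<open>Finiteness is decided by the one-letter sums, and the case \<open>n = 1\<close> of the
  logarithmic bound makes those at \<open>z\<close> and \<open>z0\<close> comparable within the
  factor \<open>exp 1\<close>. In the finite case the power series pass through both limits with the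
  same coefficient bounds, so \<open>R\<close> does not shrink.\<close>

theorem local_pressure:
  obtains R where "R > 0" "nbhd R \<subseteq> W"
    "\<And>z. z \<in> nbhd R \<Longrightarrow> pressure X (\<Phi> z) t < \<infinity> \<longleftrightarrow> pressure X (\<Phi> z0) t < \<infinity>"
    "pressure X (\<Phi> z0) t < \<infinity> \<Longrightarrow> \<exists>p a. \<forall>z\<in>nbhd R. pressure X (\<Phi> z) t = ereal (p z) \<and>
       ((\<lambda>\<alpha>. a \<alpha> * (\<Prod>b\<in>Basis. ((z - z0) \<bullet> b) ^ \<alpha> b)) has_sum p z) (multi_indices Basis)"
proof -
  obtain R where R: "R > 0" and sub: "nbhd R \<subseteq> W"
    and close: "\<And>m n z. m > 0 \<Longrightarrow> z \<in> nbhd R \<Longrightarrow> \<bar>ln (TT z m n / TT z0 m n)\<bar> \<le> real n"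
    and series: "\<And>m n. m > 0 \<Longrightarrow> bounded_power_series Basis R 1
       ((\<lambda>h b. if b \<in> Basis then h \<bullet> b else 0) ` (coord_space I \<inter> ball 0 R))
       (\<lambda>x. ln (TT (z0 + (\<Sum>b\<in>Basis. x b *\<^sub>R b)) m n / TT z0 m n) / real n)"
    by (rule transfer_quotient_power_series) (rule that)
  have comparable: "TT z m 1 \<le> exp 1 * TT z0 m 1" "TT z0 m 1 \<le> exp 1 * TT z m 1"
    if "m > 0" "z \<in> nbhd R" for m z
  proof -
    have pos: "TT z m 1 > 0" "TT z0 m 1 > 0" using TT_pos that by blast+
    have "\<bar>ln (TT z m 1) - ln (TT z0 m 1)\<bar> \<le> 1" using close[OF that, of 1] pos by (simp add: ln_div)
    hence "ln (TT z m 1) \<le> ln (exp 1 * TT z0 m 1)" "ln (TT z0 m 1) \<le> ln (exp 1 * TT z m 1)"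
      using pos by (auto simp: ln_mult_pos)
    thus "TT z m 1 \<le> exp 1 * TT z0 m 1" "TT z0 m 1 \<le> exp 1 * TT z m 1" using pos by simp_all
  qed
  have bdd: "bdd_above (range (\<lambda>m. TT y m 1))"
    if y: "y \<in> W" and x: "bdd_above (range (\<lambda>m. TT x m 1))" and yx: "\<And>m. m > 0 \<Longrightarrow> TT y m 1 \<le> exp 1 * TT x m 1" for x y
  proof -
    obtain M where M: "\<And>m. TT x m 1 \<le> M" using x by (auto simp: bdd_above_def)
    have "TT y m 1 \<le> exp 1 * M" for m
    proof -
      have "TT y m 1 \<le> TT y (Suc m) 1" by (rule TT_mono[OF y]) simp
      also have "\<dots> \<le> exp 1 * TT x (Suc m) 1" by (rule yx) simp
      also have "\<dots> \<le> exp 1 * M" by (intro mult_left_mono M) simp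
      finally show ?thesis .
    qed
    thus ?thesis by (auto simp: bdd_above_def)
  qed
  have iff: "pressure X (\<Phi> z) t < \<infinity> \<longleftrightarrow> pressure X (\<Phi> z0) t < \<infinity>" if z: "z \<in> nbhd R" for z
    unfolding TT_bounded_iff[OF subsetD[OF sub z]] TT_bounded_iff[OF W(2)]
  proof
    show "bdd_above (range (\<lambda>m. TT z0 m 1))" if "bdd_above (range (\<lambda>m. TT z m 1))"
      by (rule bdd[OF W(2) that comparable(2)[OF _ z]])
    show "bdd_above (range (\<lambda>m. TT z m 1))" if "bdd_above (range (\<lambda>m. TT z0 m 1))"
      by (rule bdd[OF subsetD[OF sub z] that comparable(1)[OF _ z]])
  qed
  show ?thesis
  proof (rule that[OF R sub iff])
    assume fin: "pressure X (\<Phi> z0) t < \<infinity>"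
    have z0B: "z0 \<in> nbhd R" using z0_coord R by simp
    define Q where "Q z p L \<longleftrightarrow> pressure X (\<Phi> z) t = ereal p \<and> (\<forall>n. L n > 0) \<and> (\<forall>n. (\<lambda>m. TT z m n) \<longlonglongrightarrow> L n) \<and>
        (\<lambda>n. ln (L n) / real n) \<longlonglongrightarrow> p" for z p L
    have "\<exists>p L. Q z p L" if z: "z \<in> nbhd R" for z
    proof -
      have "z \<in> W" using z sub by blast
      moreover have "pressure X (\<Phi> z) t < \<infinity>" using iff[OF z] fin by (rule iffD2)
      ultimately show ?thesis unfolding Q_def by (intro TT_bounded TT_bounded_iff[THEN iffD1])
    qed
    then obtain p L where Q: "\<And>z. z \<in> nbhd R \<Longrightarrow> Q z (p z) (L z)" by metis
    have p: "pressure X (\<Phi> z) t = ereal (p z)" and L0: "L z n > 0"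
      and L: "(\<lambda>m. TT z m n) \<longlonglongrightarrow> L z n" and Lp: "(\<lambda>n. ln (L z n) / real n) \<longlonglongrightarrow> p z"
      if "z \<in> nbhd R" for z n
      using Q[OF that] by (simp_all add: Q_def)
    define Dm where "Dm = (\<lambda>h b. if b \<in> Basis then h \<bullet> b else 0) ` (coord_space I \<inter> ball (0 :: complex ^ 'n) R)"
    define pt where "pt x = z0 + (\<Sum>b\<in>Basis. x b *\<^sub>R b)" for x :: "complex ^ 'n \<Rightarrow> real"
    have pt: "pt (\<lambda>b. if b \<in> Basis then h \<bullet> b else 0) = z0 + h" for h
      using euclidean_representation[of h] by (simp add: pt_def)
    have ptB: "pt x \<in> nbhd R" if "x \<in> Dm" for x
      using that coord_space_line[OF z0_coord, of _ 1] by (auto simp: Dm_def pt dist_norm)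
    have small: "\<bar>x b\<bar> < R" if "x \<in> Dm" "b \<in> Basis" for x b
      using that by (auto simp: Dm_def intro!: le_less_trans[OF Basis_le_norm])
    have "bounded_power_series Basis R 1 Dm (\<lambda>x. p (pt x) - p z0)"
    proof (rule bounded_power_series_limit[OF finite_Basis R])
      show "\<bar>x b\<bar> < R" if "x \<in> Dm" "b \<in> Basis" for x b using that by (rule small)
    next
      fix n
      show "bounded_power_series Basis R 1 Dm (\<lambda>x. ln (L (pt x) n / L z0 n) / real n)"
      proof (rule bounded_power_series_limit[OF finite_Basis R])
        show "\<bar>x b\<bar> < R" if "x \<in> Dm" "b \<in> Basis" for x b using that by (rule small)
      next
        \<comment> \<open>The shift to \<open>Suc m\<close> avoids the empty alphabet, for which the
          sums of positive length vanish.\<close>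
        show "bounded_power_series Basis R 1 Dm (\<lambda>x. ln (TT (pt x) (Suc m) n / TT z0 (Suc m) n) / real n)" for m
          unfolding Dm_def pt_def by (rule series) simp
        fix x assume x: "x \<in> Dm"
        have "(\<lambda>m. TT (pt x) (Suc m) n / TT z0 (Suc m) n) \<longlonglongrightarrow> L (pt x) n / L z0 n"
          using L[OF ptB[OF x], THEN LIMSEQ_Suc] L[OF z0B, THEN LIMSEQ_Suc] L0[OF z0B, of n] by (intro tendsto_divide) auto
        hence "(\<lambda>m. ln (TT (pt x) (Suc m) n / TT z0 (Suc m) n)) \<longlonglongrightarrow> ln (L (pt x) n / L z0 n)"
          by (rule tendsto_ln) (use L0[OF z0B, of n] L0[OF ptB[OF x], of n] in auto)
        thus "(\<lambda>m. ln (TT (pt x) (Suc m) n / TT z0 (Suc m) n) / real n) \<longlonglongrightarrow> ln (L (pt x) n / L z0 n) / real n"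
          unfolding divide_inverse[of _ "real n"] by (intro tendsto_mult_right)
      qed
    next
      fix x assume x: "x \<in> Dm"
      have "(\<lambda>n. ln (L (pt x) n) / real n - ln (L z0 n) / real n) \<longlonglongrightarrow> p (pt x) - p z0"
        by (intro tendsto_diff Lp ptB x z0B)
      moreover have "ln (L (pt x) n / L z0 n) / real n = ln (L (pt x) n) / real n - ln (L z0 n) / real n" for n
        using L0[OF z0B, of n] L0[OF ptB[OF x], of n] by (simp add: ln_div diff_divide_distrib)
      ultimately show "(\<lambda>n. ln (L (pt x) n / L z0 n) / real n) \<longlonglongrightarrow> p (pt x) - p z0" by simp
    qed
    then obtain c where c: "\<And>x. x \<in> Dm \<Longrightarrow> ((\<lambda>\<alpha>. c \<alpha> * (\<Prod>b\<in>Basis. x b ^ \<alpha> b)) has_sum p (pt x) - p z0) (multi_indices Basis)"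
      unfolding bounded_power_series_def by blast
    \<comment> \<open>The constant term restores \<open>p z0\<close>, which was removed by dividing
      by the sums at \<open>z0\<close>.\<close>
    define a where "a \<alpha> = c \<alpha> + (if \<alpha> = (\<lambda>_. 0) then p z0 else 0)" for \<alpha>
    show "\<exists>p a. \<forall>z\<in>nbhd R. pressure X (\<Phi> z) t = ereal (p z) \<and>
       ((\<lambda>\<alpha>. a \<alpha> * (\<Prod>b\<in>Basis. ((z - z0) \<bullet> b) ^ \<alpha> b)) has_sum p z) (multi_indices Basis)"
    proof (intro exI[of _ p] exI[of _ a] ballI conjI p)
      fix z assume z: "z \<in> nbhd R"
      define x where "x = (\<lambda>b. if b \<in> Basis then (z - z0) \<bullet> b else 0)"
      have "z - z0 \<in> coord_space I \<inter> ball 0 R" using z coord_space_diff[OF _ z0_coord] by (auto simp: dist_norm norm_minus_commute)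
      hence x: "x \<in> Dm" unfolding Dm_def x_def by blast
      have ptx: "pt x = z" by (simp add: x_def pt)
      have prod: "(\<Prod>b\<in>Basis. x b ^ \<alpha> b) = (\<Prod>b\<in>Basis. ((z - z0) \<bullet> b) ^ \<alpha> b)" for \<alpha>
        by (rule prod.cong) (simp_all add: x_def)
      let ?g = "\<lambda>\<alpha>. (if \<alpha> = (\<lambda>_. 0) then p z0 else 0) * (\<Prod>b\<in>Basis. ((z - z0) \<bullet> b) ^ \<alpha> b)"
      have "(?g has_sum p z0) (multi_indices Basis)"
        by (rule has_sum_finite_neutralI[of "{\<lambda>_. 0}"]) (auto simp: multi_indices_def)
      from has_sum_add[OF c[OF x] this]
      show "((\<lambda>\<alpha>. a \<alpha> * (\<Prod>b\<in>Basis. ((z - z0) \<bullet> b) ^ \<alpha> b)) has_sum p z) (multi_indices Basis)"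
        unfolding a_def distrib_right prod ptx by simp
    qed
  qed
qed

end

section \<open>From charts to the manifold\<close>

lemma holomorphic_joint_on_subset:
  "holomorphic_joint_on f S \<Longrightarrow> T \<subseteq> S \<Longrightarrow> holomorphic_joint_on f T"
  unfolding holomorphic_joint_on_def complex_differentiable_on_def
  by (meson has_derivative_subset subsetD)

lemma univalent_ifs_if_HIFS:
  assumes X: "cifs_domain X" and \<phi>: "\<phi> \<in> HIFS X" and V: "open V" "X \<subseteq> V"
    and \<psi>: "\<And>i. holomorphic_diffeo_into V (\<psi> i)" "\<And>i x. x \<in> X \<Longrightarrow> \<psi> i x = \<phi> i x"
  shows "\<exists>s. univalent_ifs X V \<phi> \<psi> s"
proof -
  have "\<phi> \<in> CIFS X" using \<phi> by (simp add: HIFS_def)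
  hence cifs: "(\<forall>i. \<phi> i ` X \<subseteq> X \<and> inj_on (\<phi> i) X) \<and> (\<exists>s. 0 < s \<and> s < 1 \<and>
      (\<forall>i. \<forall>x\<in>X. \<forall>y\<in>X. norm (\<phi> i x - \<phi> i y) \<le> s * norm (x - y)))"
    unfolding CIFS_def mem_Collect_eq by (elim conjE) (intro conjI)
  hence maps: "\<phi> i ` X \<subseteq> X" for i by simp
  obtain s where s: "0 < s" "s < 1" "\<And>i x y. x \<in> X \<Longrightarrow> y \<in> X \<Longrightarrow> norm (\<phi> i x - \<phi> i y) \<le> s * norm (x - y)"
    using cifs by (elim conjE exE) simp
  have "univalent_ifs X V \<phi> \<psi> s"
    using X V s maps \<psi> unfolding univalent_ifs_def cifs_domain_def univalent_on_def holomorphic_diffeo_into_def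
    by (auto simp: image_subset_iff)
  thus ?thesis by blast
qed

lemma chart_inv_into:
  assumes A: "complex_manifold M I A" "(U, \<kappa>) \<in> A"
  shows "openin M U" "U \<subseteq> topspace M" "\<kappa> ` U \<subseteq> coord_space I" "inj_on \<kappa> U"
    "openin M S \<Longrightarrow> openin (top_of_set (coord_space I)) (\<kappa> ` (U \<inter> S))"
    "open B \<Longrightarrow> openin M {\<gamma> \<in> U. \<kappa> \<gamma> \<in> B}"
proof -
  have U: "openin M U" and op: "openin (top_of_set (coord_space I)) (\<kappa> ` U)"
    and hom: "homeomorphic_map (subtopology M U) (top_of_set (\<kappa> ` U)) \<kappa>"
    using A unfolding complex_manifold_def by blast+
  show "openin M U" by (rule U)
  show sub: "U \<subseteq> topspace M" by (rule openin_subset[OF U])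
  hence top: "topspace (subtopology M U) = U" by auto
  show "\<kappa> ` U \<subseteq> coord_space I" using openin_imp_subset[OF op] .
  show "inj_on \<kappa> U" using homeomorphic_imp_injective_map[OF hom] top by simp
  show "openin (top_of_set (coord_space I)) (\<kappa> ` (U \<inter> S))" if "openin M S"
  proof -
    have "openin (subtopology M U) (U \<inter> S)" using that by (auto simp: openin_subtopology)
    hence "openin (top_of_set (\<kappa> ` U)) (\<kappa> ` (U \<inter> S))"
      using homeomorphic_imp_open_map[OF hom] by (auto simp: open_map_def)
    thus ?thesis using op by (rule openin_trans)
  qed
  show "openin M {\<gamma> \<in> U. \<kappa> \<gamma> \<in> B}" if "open B"
  proof -
    have "openin (top_of_set (\<kappa> ` U)) (\<kappa> ` U \<inter> B)" by (rule openin_open_Int[OF that])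
    from openin_continuous_map_preimage[OF homeomorphic_imp_continuous_map[OF hom] this]
    have "openin (subtopology M U) {\<gamma> \<in> U. \<kappa> \<gamma> \<in> \<kappa> ` U \<inter> B}" unfolding top .
    hence "openin M {\<gamma> \<in> U. \<kappa> \<gamma> \<in> \<kappa> ` U \<inter> B}" using U by (rule openin_trans_full)
    moreover have "{\<gamma> \<in> U. \<kappa> \<gamma> \<in> \<kappa> ` U \<inter> B} = {\<gamma> \<in> U. \<kappa> \<gamma> \<in> B}" by auto
    ultimately show ?thesis by simp
  qed
qed

lemma chart_local_family:
  assumes X: "cifs_domain X" and fam: "analytic_family M I A X \<phi>"
    and ratio: "\<forall>\<gamma>0\<in>topspace M. \<exists>\<Gamma>0 B. openin M \<Gamma>0 \<and> \<gamma>0 \<in> \<Gamma>0 \<and> 0 \<le> B \<and>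
           (\<forall>\<omega>. \<forall>\<gamma>\<in>\<Gamma>0.
              cmod (deriv_within X (\<phi> \<gamma> (\<omega> 0)) (coding_map X (\<phi> \<gamma>) (shift \<omega>)) /
                    deriv_within X (\<phi> \<gamma>0 (\<omega> 0)) (coding_map X (\<phi> \<gamma>0) (shift \<omega>))) \<le> B)"
    and t: "0 \<le> t" and chart: "(U, \<kappa>) \<in> A" "\<gamma>0 \<in> U"
  shows "\<exists>W V \<Psi> B. local_family I W (\<kappa> \<gamma>0) X V (\<lambda>z. \<phi> (inv_into U \<kappa> z)) \<Psi> B t"
proof -
  have mf: "complex_manifold M I A" and H: "\<And>\<gamma>. \<gamma> \<in> topspace M \<Longrightarrow> \<phi> \<gamma> \<in> HIFS X"
    using fam unfolding analytic_family_def by blast+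
  note ch = chart_inv_into[OF mf chart(1)]
  have g0: "\<gamma>0 \<in> topspace M" using ch(2) chart(2) by blast
  obtain \<Gamma>0 V \<psi> where \<Gamma>0: "openin M \<Gamma>0" "\<gamma>0 \<in> \<Gamma>0"
    and V: "open V" "connected V" "bounded V" "X \<subseteq> V"
    and \<psi>: "\<forall>i. \<forall>\<gamma>\<in>topspace M. holomorphic_diffeo_into V (\<psi> \<gamma> i) \<and> (\<forall>x\<in>X. \<psi> \<gamma> i x = \<phi> \<gamma> i x)"
    and joint: "\<forall>i. \<forall>(U, \<kappa>)\<in>A. holomorphic_joint_on (\<lambda>(z, x). \<psi> (inv_into U \<kappa> z) i x) (\<kappa> ` (U \<inter> \<Gamma>0) \<times> V)"
    using bspec[OF conjunct2[OF conjunct2[OF conjunct2[OF fam[unfolded analytic_family_def]]]] g0]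
    by (elim exE conjE)
  obtain \<Gamma>1 B where \<Gamma>1: "openin M \<Gamma>1" "\<gamma>0 \<in> \<Gamma>1" "0 \<le> B"
    and B: "\<forall>\<omega>. \<forall>\<gamma>\<in>\<Gamma>1. cmod (deriv_within X (\<phi> \<gamma> (\<omega> 0)) (coding_map X (\<phi> \<gamma>) (shift \<omega>)) /
                    deriv_within X (\<phi> \<gamma>0 (\<omega> 0)) (coding_map X (\<phi> \<gamma>0) (shift \<omega>))) \<le> B"
    using bspec[OF ratio g0] by (elim exE conjE)
  \<comment> \<open>The part of the chart where joint holomorphy and the bound \<open>B\<close> hold
    together.\<close>
  define W where "W = \<kappa> ` (U \<inter> (\<Gamma>0 \<inter> \<Gamma>1))"
  have inv: "inv_into U \<kappa> (\<kappa> \<gamma>) = \<gamma>" if "\<gamma> \<in> U" for \<gamma> using inv_into_f_f[OF ch(4) that] .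
  have inW: "inv_into U \<kappa> z \<in> topspace M" "inv_into U \<kappa> z \<in> \<Gamma>1" if "z \<in> W" for z
    using that inv ch(2) by (auto simp: W_def)
  have "local_family I W (\<kappa> \<gamma>0) X V (\<lambda>z. \<phi> (inv_into U \<kappa> z)) (\<lambda>z. \<psi> (inv_into U \<kappa> z)) B t"
  proof
    show "openin (top_of_set (coord_space I)) W" unfolding W_def by (intro ch(5) openin_Int \<Gamma>0 \<Gamma>1)
    show "\<kappa> \<gamma>0 \<in> W" using chart \<Gamma>0 \<Gamma>1 by (auto simp: W_def)
    show "\<exists>s. univalent_ifs X V (\<phi> (inv_into U \<kappa> z)) (\<psi> (inv_into U \<kappa> z)) s" if "z \<in> W" for z
      by (rule univalent_ifs_if_HIFS[OF X H V(1,4)]) (use inW(1)[OF that] \<psi> in auto)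
    show "holomorphic_joint_on (\<lambda>(z, x). \<psi> (inv_into U \<kappa> z) i x) (W \<times> V)" for i
      by (rule holomorphic_joint_on_subset[of _ "\<kappa> ` (U \<inter> \<Gamma>0) \<times> V"]) (use spec[OF joint, of i] chart(1) in \<open>auto simp: W_def\<close>)
    show "cmod (deriv_within X (\<phi> (inv_into U \<kappa> z) (\<omega> 0)) (coding_map X (\<phi> (inv_into U \<kappa> z)) (shift \<omega>)) /
      deriv_within X (\<phi> (inv_into U \<kappa> (\<kappa> \<gamma>0)) (\<omega> 0)) (coding_map X (\<phi> (inv_into U \<kappa> (\<kappa> \<gamma>0))) (shift \<omega>))) \<le> B"
      if "z \<in> W" for z \<omega>
      unfolding inv[OF chart(2)] by (rule bspec[OF spec[OF B] inW(2)[OF that]])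
  qed (use V t in auto)
  thus ?thesis by blast
qed

lemma connected_space_locally_constant:
  assumes con: "connected_space M"
    and loc: "\<And>x. x \<in> topspace M \<Longrightarrow> \<exists>T. openin M T \<and> x \<in> T \<and> (\<forall>y\<in>T. P y \<longleftrightarrow> P x)"
    and x: "x \<in> topspace M" "P x" and y: "y \<in> topspace M"
  shows "P y"
proof -
  have op: "openin M {y \<in> topspace M. P y \<longleftrightarrow> b}" for b
    unfolding openin_subopen[of M "{y \<in> topspace M. P y \<longleftrightarrow> b}"]
  proof
    fix z assume z: "z \<in> {y \<in> topspace M. P y \<longleftrightarrow> b}"
    then obtain T where T: "openin M T" "z \<in> T" "\<forall>y\<in>T. P y \<longleftrightarrow> P z" using loc by blast
    have "T \<subseteq> {y \<in> topspace M. P y \<longleftrightarrow> b}" using z T(3) openin_subset[OF T(1)] by auto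
    with T show "\<exists>T. openin M T \<and> z \<in> T \<and> T \<subseteq> {y \<in> topspace M. P y \<longleftrightarrow> b}" by blast
  qed
  have "topspace M - {y \<in> topspace M. P y \<longleftrightarrow> True} = {y \<in> topspace M. P y \<longleftrightarrow> False}" by auto
  hence "closedin M {y \<in> topspace M. P y \<longleftrightarrow> True}" using op[of False] by (simp add: closedin_def)
  hence "{y \<in> topspace M. P y \<longleftrightarrow> True} = topspace M"
    using con op[of True] x unfolding connected_space_clopen_in by blast
  thus ?thesis using y by blast
qed

theorem theorem4p10:
  fixes M :: "'g topology" and I :: "'n::finite set" and A :: "('g, 'n) chart set"
    and X :: "complex set" and \<phi> :: "'g \<Rightarrow> nat \<Rightarrow> complex \<Rightarrow> complex"
    and t :: real and \<gamma>1 :: 'g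
  assumes "cifs_domain X"
    and "analytic_family M I A X \<phi>"
    and "\<forall>\<gamma>0\<in>topspace M. \<exists>\<Gamma>0 B. openin M \<Gamma>0 \<and> \<gamma>0 \<in> \<Gamma>0 \<and> 0 \<le> B \<and>
           (\<forall>\<omega>. \<forall>\<gamma>\<in>\<Gamma>0.
              cmod (deriv_within X (\<phi> \<gamma> (\<omega> 0)) (coding_map X (\<phi> \<gamma>) (shift \<omega>)) /
                    deriv_within X (\<phi> \<gamma>0 (\<omega> 0)) (coding_map X (\<phi> \<gamma>0) (shift \<omega>))) \<le> B)"
    and "0 \<le> t"
    and "\<gamma>1 \<in> topspace M"
    and "pressure X (\<phi> \<gamma>1) t < \<infinity>"
  shows "(\<forall>\<gamma>\<in>topspace M. pressure X (\<phi> \<gamma>) t < \<infinity>) \<and>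
         (\<exists>p :: 'g \<Rightarrow> real. (\<forall>\<gamma>\<in>topspace M. pressure X (\<phi> \<gamma>) t = ereal (p \<gamma>)) \<and>
            manifold_real_analytic A p)"
proof -
  \<comment> \<open>The default value at infinite pressure never occurs once finiteness is known.
    Defining \<open>p\<close> on the manifold beforehand lets the series in all charts speak of one
    function.\<close>
  define p where "p \<gamma> = real_of_ereal (pressure X (\<phi> \<gamma>) t)" for \<gamma>
  have mf: "complex_manifold M I A" and con: "connected_space M"
    using assms(2) unfolding analytic_family_def by blast+
  have cover: "\<exists>U \<kappa>. (U, \<kappa>) \<in> A \<and> \<gamma> \<in> U" if "\<gamma> \<in> topspace M" for \<gamma>
    using mf that unfolding complex_manifold_def by blast
  \<comment> \<open>Finiteness is compared with that at \<open>\<gamma>0\<close> in both directions,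
    so that finite and infinite pressure each define an open set, as the connectedness argument
    requires.\<close>
  have local: "\<exists>R>0. (\<forall>\<gamma>\<in>U. \<kappa> \<gamma> \<in> ball (\<kappa> \<gamma>0) R \<longrightarrow> (pressure X (\<phi> \<gamma>) t < \<infinity> \<longleftrightarrow> pressure X (\<phi> \<gamma>0) t < \<infinity>)) \<and>
      (pressure X (\<phi> \<gamma>0) t < \<infinity> \<longrightarrow> (\<exists>a. \<forall>\<gamma>\<in>U. \<kappa> \<gamma> \<in> ball (\<kappa> \<gamma>0) R \<longrightarrow> pressure X (\<phi> \<gamma>) t = ereal (p \<gamma>) \<and>
       ((\<lambda>\<alpha>. a \<alpha> * (\<Prod>b\<in>Basis. ((\<kappa> \<gamma> - \<kappa> \<gamma>0) \<bullet> b) ^ \<alpha> b)) has_sum p \<gamma>) (multi_indices Basis)))"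
    if chart: "(U, \<kappa>) \<in> A" "\<gamma>0 \<in> U" for U \<kappa> \<gamma>0
  proof -
    note ch = chart_inv_into[OF mf chart(1)]
    have inv: "inv_into U \<kappa> (\<kappa> \<gamma>) = \<gamma>" if "\<gamma> \<in> U" for \<gamma> using inv_into_f_f[OF ch(4) that] .
    obtain W V \<Psi> B where lf: "local_family I W (\<kappa> \<gamma>0) X V (\<lambda>z. \<phi> (inv_into U \<kappa> z)) \<Psi> B t"
      using chart_local_family[OF assms(1-4) chart] by blast
    obtain R where R: "R > 0"
      "\<And>z. z \<in> coord_space I \<inter> ball (\<kappa> \<gamma>0) R \<Longrightarrow> pressure X (\<phi> (inv_into U \<kappa> z)) t < \<infinity> \<longleftrightarrow> pressure X (\<phi> \<gamma>0) t < \<infinity>"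
      "pressure X (\<phi> \<gamma>0) t < \<infinity> \<Longrightarrow> \<exists>p a. \<forall>z\<in>coord_space I \<inter> ball (\<kappa> \<gamma>0) R. pressure X (\<phi> (inv_into U \<kappa> z)) t = ereal (p z) \<and>
       ((\<lambda>\<alpha>. a \<alpha> * (\<Prod>b\<in>Basis. ((z - \<kappa> \<gamma>0) \<bullet> b) ^ \<alpha> b)) has_sum p z) (multi_indices Basis)"
      by (rule local_family.local_pressure[OF lf, unfolded inv[OF chart(2)]]) (rule that)
    have coord: "\<kappa> \<gamma> \<in> coord_space I \<inter> ball (\<kappa> \<gamma>0) R" if "\<gamma> \<in> U" "\<kappa> \<gamma> \<in> ball (\<kappa> \<gamma>0) R" for \<gamma>
      using that ch(3) by blast
    show ?thesis
    proof (intro exI[of _ R] conjI R(1) ballI impI)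
      fix \<gamma> assume "\<gamma> \<in> U" "\<kappa> \<gamma> \<in> ball (\<kappa> \<gamma>0) R"
      thus "pressure X (\<phi> \<gamma>) t < \<infinity> \<longleftrightarrow> pressure X (\<phi> \<gamma>0) t < \<infinity>" using R(2)[OF coord] inv by simp
    next
      assume "pressure X (\<phi> \<gamma>0) t < \<infinity>"
      from R(3)[OF this] obtain q a where qa: "\<forall>z\<in>coord_space I \<inter> ball (\<kappa> \<gamma>0) R. pressure X (\<phi> (inv_into U \<kappa> z)) t = ereal (q z) \<and>
         ((\<lambda>\<alpha>. a \<alpha> * (\<Prod>b\<in>Basis. ((z - \<kappa> \<gamma>0) \<bullet> b) ^ \<alpha> b)) has_sum q z) (multi_indices Basis)" by (elim exE)
      show "\<exists>a. \<forall>\<gamma>\<in>U. \<kappa> \<gamma> \<in> ball (\<kappa> \<gamma>0) R \<longrightarrow> pressure X (\<phi> \<gamma>) t = ereal (p \<gamma>) \<and>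
         ((\<lambda>\<alpha>. a \<alpha> * (\<Prod>b\<in>Basis. ((\<kappa> \<gamma> - \<kappa> \<gamma>0) \<bullet> b) ^ \<alpha> b)) has_sum p \<gamma>) (multi_indices Basis)"
      proof (intro exI[of _ a] ballI impI)
        fix \<gamma> assume \<gamma>: "\<gamma> \<in> U" "\<kappa> \<gamma> \<in> ball (\<kappa> \<gamma>0) R"
        have "p \<gamma> = q (\<kappa> \<gamma>)" using bspec[OF qa coord[OF \<gamma>]] by (simp add: p_def inv[OF \<gamma>(1)])
        thus "pressure X (\<phi> \<gamma>) t = ereal (p \<gamma>) \<and>
         ((\<lambda>\<alpha>. a \<alpha> * (\<Prod>b\<in>Basis. ((\<kappa> \<gamma> - \<kappa> \<gamma>0) \<bullet> b) ^ \<alpha> b)) has_sum p \<gamma>) (multi_indices Basis)"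
          using bspec[OF qa coord[OF \<gamma>]] by (simp add: inv[OF \<gamma>(1)])
      qed
    qed
  qed
  have fin: "pressure X (\<phi> \<gamma>) t < \<infinity>" if "\<gamma> \<in> topspace M" for \<gamma>
  proof (rule connected_space_locally_constant[where P = "\<lambda>\<gamma>. pressure X (\<phi> \<gamma>) t < \<infinity>", OF con _ assms(5,6) that])
    fix \<gamma>0 assume "\<gamma>0 \<in> topspace M"
    then obtain U \<kappa> where chart: "(U, \<kappa>) \<in> A" "\<gamma>0 \<in> U" using cover by blast
    obtain R where R: "R > 0" "\<forall>\<gamma>\<in>U. \<kappa> \<gamma> \<in> ball (\<kappa> \<gamma>0) R \<longrightarrow> (pressure X (\<phi> \<gamma>) t < \<infinity> \<longleftrightarrow> pressure X (\<phi> \<gamma>0) t < \<infinity>)"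
      using local[OF chart] by (elim exE conjE) (rule that)
    show "\<exists>T. openin M T \<and> \<gamma>0 \<in> T \<and> (\<forall>\<gamma>\<in>T. pressure X (\<phi> \<gamma>) t < \<infinity> \<longleftrightarrow> pressure X (\<phi> \<gamma>0) t < \<infinity>)"
    proof (intro exI conjI ballI)
      show "openin M {\<gamma> \<in> U. \<kappa> \<gamma> \<in> ball (\<kappa> \<gamma>0) R}" by (rule chart_inv_into(6)[OF mf chart(1) open_ball])
      show "\<gamma>0 \<in> {\<gamma> \<in> U. \<kappa> \<gamma> \<in> ball (\<kappa> \<gamma>0) R}" using R(1) chart(2) by simp
      fix \<gamma> assume "\<gamma> \<in> {\<gamma> \<in> U. \<kappa> \<gamma> \<in> ball (\<kappa> \<gamma>0) R}"
      thus "pressure X (\<phi> \<gamma>) t < \<infinity> \<longleftrightarrow> pressure X (\<phi> \<gamma>0) t < \<infinity>"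
        using R(2) by (elim CollectE conjE) (drule bspec, assumption, erule mp)
    qed
  qed
  have series: "\<exists>R a. R > 0 \<and> (\<forall>\<gamma>\<in>U. \<kappa> \<gamma> \<in> ball (\<kappa> \<gamma>0) R \<longrightarrow> pressure X (\<phi> \<gamma>) t = ereal (p \<gamma>) \<and>
       ((\<lambda>\<alpha>. a \<alpha> * (\<Prod>b\<in>Basis. ((\<kappa> \<gamma> - \<kappa> \<gamma>0) \<bullet> b) ^ \<alpha> b)) has_sum p \<gamma>) (multi_indices Basis))"
    if chart: "(U, \<kappa>) \<in> A" "\<gamma>0 \<in> U" for U \<kappa> \<gamma>0
  proof -
    have "pressure X (\<phi> \<gamma>0) t < \<infinity>" using fin chart_inv_into(2)[OF mf chart(1)] chart(2) by blast
    thus ?thesis using local[OF chart] by (elim exE conjE) (drule mp, assumption, elim exE, intro exI conjI)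
  qed
  have p: "pressure X (\<phi> \<gamma>) t = ereal (p \<gamma>)" if g: "\<gamma> \<in> topspace M" for \<gamma>
  proof -
    obtain U \<kappa> where chart: "(U, \<kappa>) \<in> A" "\<gamma> \<in> U" using cover[OF g] by blast
    thus ?thesis using series[OF chart] by auto
  qed
  have "real_analytic_on (p \<circ> inv_into U \<kappa>) (\<kappa> ` U)" if chart: "(U, \<kappa>) \<in> A" for U \<kappa>
    unfolding real_analytic_on_def multi_indices_def[symmetric]
  proof
    fix x assume "x \<in> \<kappa> ` U"
    then obtain \<gamma> where \<gamma>: "\<gamma> \<in> U" "x = \<kappa> \<gamma>" by blast
    note inv = inv_into_f_f[OF chart_inv_into(4)[OF mf chart]]
    show "\<exists>r>0. \<exists>a. \<forall>y\<in>\<kappa> ` U \<inter> ball x r. ((\<lambda>\<alpha>. a \<alpha> * (\<Prod>b\<in>Basis. ((y - x) \<bullet> b) ^ \<alpha> b)) has_sum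
        (p \<circ> inv_into U \<kappa>) y) (multi_indices Basis)"
      using series[OF chart \<gamma>(1)] by (elim exE conjE, intro exI conjI) (auto simp: \<gamma>(2) inv)
  qed
  hence "manifold_real_analytic A p" by (auto simp: manifold_real_analytic_def)
  with fin p show ?thesis by blast
qed

end
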